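(* Let $G$ be a connected subcubic graph with $n$ vertices and at least $7$ edges, not isomorphic to $K_{3,3}$, and having no pair of open twins of degree $1$ and no pair of open twins of degree $2$. Then $\gamma^{LD}(G)\le \frac{n}{2}$.
   Context: All graphs are finite and simple. A graph is subcubic if every vertex has degree at most $3$. Two distinct vertices $u,v$ are open twins if $N(u)=N(v)$; they are open twins of degree $d$ if moreover $|N(u)|=d$. (Open twins of degree $3$ and closed twins, $N[u]=N[v]$, are allowed.) For $S\subseteq V(G)$, $I(v)=N[v]\cap S$. A set $S$ is locating-dominating if every vertex $v$ has $I(v)\ne\emptyset$ and $I(u)\neq I(v)$ for all distinct $u,v\in V(G)\setminus S$. $\gamma^{LD}(G)$ denotes the minimum size of a locating-dominating set of $G$. *)

theory Defs
  imports Main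
begin

definition graph :: "'a set \<Rightarrow> ('a \<Rightarrow> 'a \<Rightarrow> bool) \<Rightarrow> bool" where
  "graph V E \<longleftrightarrow> finite V \<and> (\<forall>u v. E u v \<longrightarrow> u \<in> V \<and> v \<in> V)
     \<and> (\<forall>u v. E u v \<longrightarrow> E v u) \<and> (\<forall>v. \<not> E v v)"

definition nbhd :: "('a \<Rightarrow> 'a \<Rightarrow> bool) \<Rightarrow> 'a \<Rightarrow> 'a set" where
  "nbhd E v = {u. E v u}"

definition cnbhd :: "('a \<Rightarrow> 'a \<Rightarrow> bool) \<Rightarrow> 'a \<Rightarrow> 'a set" where
  "cnbhd E v = insert v (nbhd E v)"

definition degree :: "('a \<Rightarrow> 'a \<Rightarrow> bool) \<Rightarrow> 'a \<Rightarrow> nat" where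
  "degree E v = card (nbhd E v)"

definition edges :: "('a \<Rightarrow> 'a \<Rightarrow> bool) \<Rightarrow> 'a set set" where
  "edges E = {{u, v} | u v. E u v}"

definition subcubic :: "'a set \<Rightarrow> ('a \<Rightarrow> 'a \<Rightarrow> bool) \<Rightarrow> bool" where
  "subcubic V E \<longleftrightarrow> (\<forall>v\<in>V. degree E v \<le> 3)"

definition connected_graph :: "'a set \<Rightarrow> ('a \<Rightarrow> 'a \<Rightarrow> bool) \<Rightarrow> bool" where
  "connected_graph V E \<longleftrightarrow> V \<noteq> {} \<and> (\<forall>u\<in>V. \<forall>v\<in>V. E\<^sup>*\<^sup>* u v)"

definition open_twins_deg :: "'a set \<Rightarrow> ('a \<Rightarrow> 'a \<Rightarrow> bool) \<Rightarrow> nat \<Rightarrow> 'a \<Rightarrow> 'a \<Rightarrow> bool" where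
  "open_twins_deg V E d u v \<longleftrightarrow> u \<in> V \<and> v \<in> V \<and> u \<noteq> v
     \<and> nbhd E u = nbhd E v \<and> card (nbhd E u) = d"

definition K33_V :: "nat set" where "K33_V = {0..<6}"
definition K33_E :: "nat \<Rightarrow> nat \<Rightarrow> bool" where
  "K33_E i j \<longleftrightarrow> (i < 3 \<and> 3 \<le> j \<and> j < 6) \<or> (j < 3 \<and> 3 \<le> i \<and> i < 6)"

definition graph_iso :: "'a set \<Rightarrow> ('a \<Rightarrow> 'a \<Rightarrow> bool) \<Rightarrow> 'b set \<Rightarrow> ('b \<Rightarrow> 'b \<Rightarrow> bool) \<Rightarrow> bool" where
  "graph_iso V E W F \<longleftrightarrow> (\<exists>f. bij_betw f V W \<and> (\<forall>u\<in>V. \<forall>v\<in>V. E u v \<longleftrightarrow> F (f u) (f v)))"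

definition locating_dominating :: "'a set \<Rightarrow> ('a \<Rightarrow> 'a \<Rightarrow> bool) \<Rightarrow> 'a set \<Rightarrow> bool" where
  "locating_dominating V E S \<longleftrightarrow> S \<subseteq> V
     \<and> (\<forall>v\<in>V. cnbhd E v \<inter> S \<noteq> {})
     \<and> (\<forall>u\<in>V - S. \<forall>v\<in>V - S. u \<noteq> v \<longrightarrow> cnbhd E u \<inter> S \<noteq> cnbhd E v \<inter> S)"

definition ld_number :: "'a set \<Rightarrow> ('a \<Rightarrow> 'a \<Rightarrow> bool) \<Rightarrow> nat" where
  "ld_number V E = (LEAST k. \<exists>S. locating_dominating V E S \<and> card S = k)"

end

theory Submission
  imports Defs
begin

text \<open>A counterexample of minimal size is sought among all subcubic graphs, connected or not, that avoid a
  list of configurations, called violations: the components K1, K3 and K4, two leaves at a vertex,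
  two twins of degree two with a leaf at a common neighbour, and three vertices with the same
  neighbourhood. This class is larger than that of the theorem: pairs of twins of degree two are mostly
  allowed, which makes it robust under deletions. Whenever a set W can be deleted within the class, and half of W
  extends every locating-dominating set of the rest, the graph is not a minimal counterexample.

  Such reductions exclude, in this order, twins of degree two, twins of degree three, leaves and
  vertices of degree two. In the remaining cubic graph every edge lies in a square, as it could be deleted
  otherwise. Hence a triangle can only occur in a prism. In a graph without triangles, deleting both ends
  of an edge is possible unless the edge lies in two squares arranged as in a cube, and if all edges do, then the
  component is a cube. The prism and the cube have locating-dominating sets of half their order.\<close>

text \<open>A deletion changes only the neighbourhoods of vertices next to the deleted set, so the
  rest stays in the class as soon as no such vertex belongs to a violation. Most of the case
  analysis proves exactly this, vertex by vertex. The obstacle is a neighbour for which it cannot be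
  proved. Such a neighbour is offered for deletion as well. It is then known that some subset
  \<open>B\<close> of the offered vertices suffices, but not which one, so every possible
  \<open>B\<close> needs its own extension.

  The order of the reductions serves the same purpose. Two vertices that acquire equal
  neighbourhoods by losing the same vertices were twins before. Once twins are excluded, new
  equalities can only arise between vertices that lost different neighbours, or between a vertex
  that lost some and one that lost none.\<close>

lemma nbhd_sym: "graph V E \<Longrightarrow> a \<in> nbhd E b \<longleftrightarrow> b \<in> nbhd E a"
  unfolding graph_def nbhd_def by blast

lemma nbhd_irrefl: "graph V E \<Longrightarrow> a \<notin> nbhd E a"
  unfolding graph_def nbhd_def by blast

lemma nbhd_subset: "graph V E \<Longrightarrow> nbhd E a \<subseteq> V"
  unfolding graph_def nbhd_def by blast

lemma finite_nbhd: "graph V E \<Longrightarrow> finite (nbhd E a)"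
  using nbhd_subset finite_subset unfolding graph_def by metis

lemma nbhd_outside: "graph V E \<Longrightarrow> a \<notin> V \<Longrightarrow> nbhd E a = {}"
  unfolding graph_def nbhd_def by blast

lemma subcubic_card: "graph V E \<Longrightarrow> subcubic V E \<Longrightarrow> card (nbhd E a) \<le> 3"
  unfolding subcubic_def degree_def by (cases "a \<in> V") (auto simp: nbhd_outside)

text \<open>Deleted vertices get an empty neighbourhood, just like every element outside the vertex
  set, so the type never changes and iterated deletions merge into one.\<close>

definition del :: "'a set \<Rightarrow> ('a \<Rightarrow> 'a \<Rightarrow> bool) \<Rightarrow> 'a \<Rightarrow> 'a \<Rightarrow> bool" where
  "del W E a b \<longleftrightarrow> E a b \<and> a \<notin> W \<and> b \<notin> W"

lemma nbhd_del: "nbhd (del W E) v = (if v \<in> W then {} else nbhd E v - W)"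
  unfolding nbhd_def del_def by auto

lemma del_del: "del W (del W' E) = del (W \<union> W') E"
  unfolding del_def by (auto simp: fun_eq_iff)

lemma graph_del: "graph V E \<Longrightarrow> graph (V - W) (del W E)"
  unfolding graph_def del_def by auto

lemma subcubic_mono:
  assumes "graph V E" "subcubic V E" "V' \<subseteq> V" "\<And>v. nbhd E' v \<subseteq> nbhd E v"
  shows "subcubic V' E'"
  unfolding subcubic_def degree_def
proof
  fix v assume "v \<in> V'"
  have "card (nbhd E' v) \<le> card (nbhd E v)"
    by (rule card_mono) (use assms finite_nbhd in auto)
  also have "\<dots> \<le> 3" using assms(1,2) by (rule subcubic_card)
  finally show "card (nbhd E' v) \<le> 3" .
qed

lemma subcubic_del: "graph V E \<Longrightarrow> subcubic V E \<Longrightarrow> subcubic (V - W) (del W E)"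
  by (rule subcubic_mono) (auto simp: nbhd_del)

subsection \<open>Violations\<close>

text \<open>The set argument collects the vertices whose whole neighbourhoods are prescribed, so a
  violation persists as long as these neighbourhoods do. Common neighbours of leaves or twins are
  left out, since they may have further neighbours. Elements outside the vertex set have an empty
  neighbourhood, whence \<open>v \<in> V\<close> in the first rule and \<open>X \<noteq> {}\<close>
  in the last. The bound fails for K1, for the path on three vertices, for the gadget on five
  vertices, and for K3, K4 and K33: their locating-dominating numbers are 1, 2, 3, 2, 3 and
  4.\<close>

inductive viol :: "'a set \<Rightarrow> ('a \<Rightarrow> 'a \<Rightarrow> bool) \<Rightarrow> 'a set \<Rightarrow> bool" for V E where
  isolated: "v \<in> V \<Longrightarrow> nbhd E v = {} \<Longrightarrow> viol V E {v}"
| leaf_twins: "u \<noteq> v \<Longrightarrow> nbhd E u = {x} \<Longrightarrow> nbhd E v = {x} \<Longrightarrow> viol V E {u, v}"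
| leaf_gadget: "u \<noteq> v \<Longrightarrow> nbhd E l = {y} \<Longrightarrow> nbhd E u = {y, z} \<Longrightarrow> nbhd E v = {y, z} \<Longrightarrow> viol V E {l, u, v}"
| triangle: "nbhd E a = {b, c} \<Longrightarrow> nbhd E b = {a, c} \<Longrightarrow> nbhd E c = {a, b} \<Longrightarrow> viol V E {a, b, c}"
| tetrahedron: "nbhd E a = {b, c, d} \<Longrightarrow> nbhd E b = {a, c, d} \<Longrightarrow> nbhd E c = {a, b, d} \<Longrightarrow> nbhd E d = {a, b, c}
    \<Longrightarrow> viol V E {a, b, c, d}"
| triplets: "distinct [u, v, w] \<Longrightarrow> nbhd E u = X \<Longrightarrow> nbhd E v = X \<Longrightarrow> nbhd E w = X \<Longrightarrow> X \<noteq> {} \<Longrightarrow> viol V E {u, v, w}"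

definition tame :: "'a set \<Rightarrow> ('a \<Rightarrow> 'a \<Rightarrow> bool) \<Rightarrow> bool" where
  "tame V E \<longleftrightarrow> graph V E \<and> subcubic V E \<and> (\<forall>X. \<not> viol V E X)"

definition inert :: "'a set \<Rightarrow> ('a \<Rightarrow> 'a \<Rightarrow> bool) \<Rightarrow> 'a \<Rightarrow> bool" where
  "inert V E a \<longleftrightarrow> (\<forall>X. viol V E X \<longrightarrow> a \<notin> X)"

lemma viol_subset:
  assumes "graph V E" "viol V E X"
  shows "X \<subseteq> V"
proof
  fix v assume "v \<in> X"
  with assms(2) have "v \<in> V \<or> nbhd E v \<noteq> {}" by cases auto
  with assms(1) show "v \<in> V" using nbhd_outside by metis
qed

text \<open>Every rule prescribes neighbourhoods of members of \<open>X\<close> only; membership in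
  \<open>V\<close> serves the rule \<open>isolated\<close>.\<close>

lemma viol_transfer:
  assumes "viol V' E' X" "\<And>v. v \<in> X \<Longrightarrow> nbhd E' v = nbhd E v" "X \<subseteq> V"
  shows "viol V E X"
  using assms(1)
proof cases
  case (isolated v)
  show ?thesis unfolding isolated(1)
    by (rule viol.isolated) (use isolated assms(2)[of v] assms(3) in simp_all)
next
  case (leaf_twins u v x)
  show ?thesis unfolding leaf_twins(1)
    by (rule viol.leaf_twins) (use leaf_twins assms(2)[of u] assms(2)[of v] in simp_all)
next
  case (leaf_gadget u v l y z)
  show ?thesis unfolding leaf_gadget(1)
    by (rule viol.leaf_gadget) (use leaf_gadget assms(2)[of u] assms(2)[of v] assms(2)[of l] in simp_all)
next
  case (triangle a b c)
  show ?thesis unfolding triangle(1)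
    by (rule viol.triangle) (use triangle assms(2)[of a] assms(2)[of b] assms(2)[of c] in simp_all)
next
  case (tetrahedron a b c d)
  show ?thesis unfolding tetrahedron(1)
    by (rule viol.tetrahedron)
      (use tetrahedron assms(2)[of a] assms(2)[of b] assms(2)[of c] assms(2)[of d] in simp_all)
next
  case (triplets u v w X)
  show ?thesis unfolding triplets(1)
    by (rule viol.triplets) (use triplets assms(2)[of u] assms(2)[of v] assms(2)[of w] in simp_all)
qed

lemma viol_not_inert: "viol V E X \<Longrightarrow> a \<in> X \<Longrightarrow> \<not> inert V E a"
  unfolding inert_def by blast

lemma viol_changed:
  assumes "tame V E" "viol V' E' X" "V' \<subseteq> V" "graph V' E'"
  shows "\<exists>a\<in>X. nbhd E' a \<noteq> nbhd E a"
  using viol_transfer[OF assms(2), of E V] viol_subset[OF assms(4,2)] assms(1,3)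
  unfolding tame_def by blast

text \<open>A new violation must contain a vertex that has lost a neighbour.\<close>

lemma tame_delI:
  assumes "tame V E" "\<And>a. a \<in> V - W \<Longrightarrow> nbhd E a \<inter> W \<noteq> {} \<Longrightarrow> inert (V - W) (del W E) a"
  shows "tame (V - W) (del W E)"
  unfolding tame_def
proof (intro conjI allI notI)
  have G: "graph V E" and S: "subcubic V E" using assms(1) unfolding tame_def by auto
  show G': "graph (V - W) (del W E)" using G by (rule graph_del)
  show "subcubic (V - W) (del W E)" using G S by (rule subcubic_del)
  fix X assume X: "viol (V - W) (del W E) X"
  from viol_changed[OF assms(1) this _ G'] obtain a where a: "a \<in> X" "nbhd (del W E) a \<noteq> nbhd E a" by auto
  have "a \<in> V - W" using viol_subset[OF G' X] a(1) by auto
  moreover from this a(2) have "nbhd E a \<inter> W \<noteq> {}" by (auto simp: nbhd_del split: if_splits)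
  ultimately show False using assms(2) X a(1) unfolding inert_def by blast
qed

section \<open>Criteria for inert vertices\<close>

lemma inertI:
  assumes "nbhd E a \<noteq> {}"
    and "\<And>x v. nbhd E a = {x} \<Longrightarrow> nbhd E v = {x} \<Longrightarrow> v \<noteq> a \<Longrightarrow> False"
    and "\<And>y u v z. nbhd E a = {y} \<Longrightarrow> nbhd E u = {y, z} \<Longrightarrow> nbhd E v = {y, z} \<Longrightarrow> u \<noteq> v \<Longrightarrow> False"
    and "\<And>l y z v. nbhd E l = {y} \<Longrightarrow> nbhd E a = {y, z} \<Longrightarrow> nbhd E v = {y, z} \<Longrightarrow> v \<noteq> a \<Longrightarrow> False"
    and "\<And>b c. nbhd E a = {b, c} \<Longrightarrow> nbhd E b = {a, c} \<Longrightarrow> nbhd E c = {a, b} \<Longrightarrow> False"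
    and "\<And>b c d. nbhd E a = {b, c, d} \<Longrightarrow> nbhd E b = {a, c, d} \<Longrightarrow> nbhd E c = {a, b, d} \<Longrightarrow> nbhd E d = {a, b, c} \<Longrightarrow> False"
    and "\<And>v w. nbhd E v = nbhd E a \<Longrightarrow> nbhd E w = nbhd E a \<Longrightarrow> distinct [a, v, w] \<Longrightarrow> False"
  shows "inert V E a"
  unfolding inert_def
proof (intro allI impI notI)
  fix Y assume "viol V E Y" and aY: "a \<in> Y"
  then show False
  proof cases
    case (isolated v) with assms(1) aY show ?thesis by auto
  next
    case (leaf_twins u v x) with assms(2)[of x u] assms(2)[of x v] aY show ?thesis by auto
  next
    case (leaf_gadget u v l y z)
    from leaf_gadget(1) aY consider "a = l" | "a = u" | "a = v" by auto
    then show ?thesis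
      using leaf_gadget(2-) assms(3)[of y u z v] assms(4)[of l y z v] assms(4)[of l y z u] by cases simp_all
  next
    case (triangle b c d)
    from triangle(1) aY consider "a = b" | "a = c" | "a = d" by auto
    then show ?thesis
    proof cases
      case 1 show ?thesis by (rule assms(5)[of c d]) (use triangle 1 in simp_all)
    next
      case 2 show ?thesis by (rule assms(5)[of b d]) (use triangle 2 in \<open>simp_all add: insert_commute\<close>)
    next
      case 3 show ?thesis by (rule assms(5)[of b c]) (use triangle 3 in \<open>simp_all add: insert_commute\<close>)
    qed
  next
    case (tetrahedron b c d e)
    from tetrahedron(1) aY consider "a = b" | "a = c" | "a = d" | "a = e" by auto
    then show ?thesis
    proof cases
      case 1 show ?thesis by (rule assms(6)[of c d e]) (use tetrahedron 1 in simp_all)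
    next
      case 2 show ?thesis by (rule assms(6)[of b d e]) (use tetrahedron 2 in \<open>simp_all add: insert_commute\<close>)
    next
      case 3 show ?thesis by (rule assms(6)[of b c e]) (use tetrahedron 3 in \<open>simp_all add: insert_commute\<close>)
    next
      case 4 show ?thesis by (rule assms(6)[of b c d]) (use tetrahedron 4 in \<open>simp_all add: insert_commute\<close>)
    qed
  next
    case (triplets u v w X)
    with assms(7)[of u v] assms(7)[of u w] assms(7)[of v w] aY show ?thesis by auto
  qed
qed

lemma tetra_card:
  assumes "graph V E" "nbhd E a = {b, c, d}" "nbhd E b = {a, c, d}" "nbhd E c = {a, b, d}" "nbhd E d = {a, b, c}"
  shows "card (nbhd E a) = 3"
proof -
  have "distinct [b, c, d]"
    using nbhd_irrefl[OF assms(1), of b] nbhd_irrefl[OF assms(1), of c] nbhd_irrefl[OF assms(1), of d] assms(3-5) by auto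
  then show ?thesis using assms(2) by auto
qed

text \<open>Another vertex with the neighbourhood of \<open>a\<close> would be adjacent to the leaf
  \<open>l\<close>, whose only neighbour is \<open>a\<close>; a triangle through \<open>a\<close>
  would contain \<open>l\<close> and give it a second neighbour. The degree bound excludes the
  tetrahedron. This is the most common reason why a vertex that has just lost a neighbour is
  harmless.\<close>

lemma inert_support:
  assumes G: "graph V E" and l: "nbhd E l = {a}" and c: "card (nbhd E a) \<le> 2"
  shows "inert V E a"
proof -
  have la: "l \<in> nbhd E a" using nbhd_sym[OF G, of a l] l by simp
  have sym: "v = a" if "l \<in> nbhd E v" for v using nbhd_sym[OF G, of l v] l that by simp
  show ?thesis
  proof (rule inertI)
    show "nbhd E a \<noteq> {}" using la by auto
  next
    fix x v assume *: "nbhd E a = {x}" "nbhd E v = {x}" "v \<noteq> a"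
    with la have "l \<in> nbhd E v" by simp
    from sym[OF this] *(3) show False by simp
  next
    fix y u v z assume *: "nbhd E a = {y}" "nbhd E u = {y, z}" "nbhd E v = {y, z}" "u \<noteq> v"
    with la have "l \<in> nbhd E u" "l \<in> nbhd E v" by simp_all
    then have "u = a \<and> v = a" using sym by blast
    with *(4) show False by simp
  next
    fix l' y z v assume *: "nbhd E a = {y, z}" "nbhd E v = {y, z}" "v \<noteq> a"
    with la have "l \<in> nbhd E v" by simp
    from sym[OF this] *(3) show False by simp
  next
    fix b c assume *: "nbhd E a = {b, c}" "nbhd E b = {a, c}" "nbhd E c = {a, b}"
    with la have "l = b \<or> l = c" by simp
    with * l have "{a, c} = {a} \<or> {a, b} = {a}" by auto
    then have "c = a \<or> b = a" by auto
    with *(1) nbhd_irrefl[OF G, of a] show False by auto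
  next
    fix b c' d assume "nbhd E a = {b, c', d}" "nbhd E b = {a, c', d}" "nbhd E c' = {a, b, d}" "nbhd E d = {a, b, c'}"
    from tetra_card[OF G this] c show False by simp
  next
    fix v w assume *: "nbhd E v = nbhd E a" "distinct [a, v, w]"
    with la have "l \<in> nbhd E v" by simp
    from sym[OF this] *(2) show False by simp
  qed
qed

lemma inert_leaf:
  assumes G: "graph V E" and a: "nbhd E a = {b}"
    and 1: "\<And>v. nbhd E v = {b} \<Longrightarrow> v = a"
    and 2: "\<And>u v z. nbhd E u = {b, z} \<Longrightarrow> nbhd E v = {b, z} \<Longrightarrow> u = v"
  shows "inert V E a"
proof (rule inertI)
  show "nbhd E a \<noteq> {}" using a by auto
next
  fix x v assume "nbhd E a = {x}" "nbhd E v = {x}" "v \<noteq> a" then show False using 1[of v] a by metis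
next
  fix y u v z assume "nbhd E a = {y}" "nbhd E u = {y, z}" "nbhd E v = {y, z}" "u \<noteq> v"
  with a have "u = v" by (intro 2[of u z v]) simp_all
  with \<open>u \<noteq> v\<close> show False by simp
next
  fix l' y z v assume *: "nbhd E a = {y, z}" "nbhd E v = {y, z}" "v \<noteq> a"
  with a have "v = a" by (intro 1) simp
  with *(3) show False by simp
next
  fix b' c assume *: "nbhd E a = {b', c}" "nbhd E b' = {a, c}" "nbhd E c = {a, b'}"
  then have "b' = b" "c = b" using a by simp_all
  with * have "b \<in> nbhd E b" by simp
  with nbhd_irrefl[OF G] show False by blast
next
  fix b c' d assume "nbhd E a = {b, c', d}" "nbhd E b = {a, c', d}" "nbhd E c' = {a, b, d}" "nbhd E d = {a, b, c'}"
  from tetra_card[OF G this] a show False by simp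
next
  fix v w assume *: "nbhd E v = nbhd E a" "distinct [a, v, w]"
  with a have "v = a" by (intro 1) simp
  with *(2) show False by simp
qed

lemma inert2:
  assumes G: "graph V E" and a: "nbhd E a = {b, c}" "b \<noteq> c"
    and 1: "\<And>v. nbhd E v = {b, c} \<Longrightarrow> v = a"
    and 2: "nbhd E b = {a, c} \<Longrightarrow> nbhd E c = {a, b} \<Longrightarrow> False"
  shows "inert V E a"
proof (rule inertI)
  show "nbhd E a \<noteq> {}" using a by auto
next
  fix x v assume "nbhd E a = {x}" "nbhd E v = {x}" "v \<noteq> a" then show False using 1[of v] a by metis
next
  fix y u v z assume "nbhd E a = {y}"
  then show False using a by (metis doubleton_eq_iff insert_absorb2)
next
  fix l' y z v assume *: "nbhd E a = {y, z}" "nbhd E v = {y, z}" "v \<noteq> a"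
  with a have "v = a" by (intro 1) simp
  with *(3) show False by simp
next
  fix b' c' assume *: "nbhd E a = {b', c'}" "nbhd E b' = {a, c'}" "nbhd E c' = {a, b'}"
  then consider "b' = b" "c' = c" | "b' = c" "c' = b" using a by (auto simp: doubleton_eq_iff)
  then show False by cases (use * 2 in simp_all)
next
  fix b' c' d assume "nbhd E a = {b', c', d}" "nbhd E b' = {a, c', d}" "nbhd E c' = {a, b', d}" "nbhd E d = {a, b', c'}"
  from tetra_card[OF G this] a show False by (simp add: card_insert_if split: if_splits)
next
  fix v w assume *: "nbhd E v = nbhd E a" "distinct [a, v, w]"
  with a have "v = a" by (intro 1) simp
  with *(2) show False by simp
qed

text \<open>Only \<open>a\<close> and \<open>z\<close> are adjacent to \<open>u\<close> or
  \<open>v\<close>, so \<open>a\<close> has at most one twin. Twins of degree two need a leaf at a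
  common neighbour to be a violation, and a leaf at \<open>u\<close> or \<open>v\<close> would have
  to be \<open>a\<close> or \<open>z\<close>, which both have two neighbours.\<close>

lemma inert_gadget:
  assumes G: "graph V E" and a: "nbhd E a = {u, v}" and u: "nbhd E u = {a, z}" and v: "nbhd E v = {a, z}"
    and ne: "u \<noteq> v" "a \<noteq> z"
  shows "inert V E a"
proof -
  have uz: "u \<in> nbhd E z" "v \<in> nbhd E z"
    using nbhd_sym[OF G, of u z] nbhd_sym[OF G, of v z] u v by simp_all
  have through: "w = a \<or> w = z" if "u \<in> nbhd E w \<or> v \<in> nbhd E w" for w
    using nbhd_sym[OF G, of u w] nbhd_sym[OF G, of v w] u v that by auto
  show ?thesis
  proof (rule inertI)
    show "nbhd E a \<noteq> {}" using a by simp
  next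
    fix x assume "nbhd E a = {x}"
    with a ne show False by (auto simp: doubleton_eq_iff)
  next
    fix y assume "nbhd E a = {y}"
    with a ne show False by (auto simp: doubleton_eq_iff)
  next
    fix l y q assume *: "nbhd E l = {y}" "nbhd E a = {y, q}"
    then have "l \<in> nbhd E y" "y = u \<or> y = v" using nbhd_sym[OF G, of l y] a by auto
    then have "l = a \<or> l = z" using u v by auto
    then show False
    proof
      assume "l = a" with * a ne show False by (auto simp: doubleton_eq_iff)
    next
      assume "l = z" with * uz ne show False by auto
    qed
  next
    fix b c assume *: "nbhd E a = {b, c}" "nbhd E b = {a, c}" "nbhd E c = {a, b}"
    then consider "b = u" "c = v" | "b = v" "c = u" using a by (auto simp: doubleton_eq_iff)
    then have "v \<in> nbhd E u" by cases (use * in simp_all)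
    with u v ne nbhd_irrefl[OF G, of v] nbhd_irrefl[OF G, of a] show False by auto
  next
    fix b c d assume "nbhd E a = {b, c, d}" "nbhd E b = {a, c, d}" "nbhd E c = {a, b, d}" "nbhd E d = {a, b, c}"
    from tetra_card[OF G this] a show False by (simp add: card_insert_if split: if_splits)
  next
    fix p q assume *: "nbhd E p = nbhd E a" "nbhd E q = nbhd E a" "distinct [a, p, q]"
    then show False using through[of p] through[of q] a by auto
  qed
qed

lemma card_del_le2:
  assumes "graph V E" "subcubic V E" "b \<in> nbhd E a" "a \<in> W" "b \<notin> W"
  shows "card (nbhd (del W E) b) \<le> 2"
proof -
  have "card (nbhd (del W E) b) \<le> card (nbhd E b - {a})"
    by (rule card_mono) (use assms finite_nbhd[OF assms(1)] in \<open>auto simp: nbhd_del\<close>)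
  also have "\<dots> = card (nbhd E b) - 1"
    using nbhd_sym[OF assms(1), of a b] assms(3) by (subst card_Diff_singleton) simp_all
  finally show ?thesis using subcubic_card[OF assms(1,2), of b] by linarith
qed

lemma leaf_ne:
  assumes G: "graph V E" and "nbhd E l = {y}" shows "l \<noteq> y" "l \<in> nbhd E y"
  using nbhd_irrefl[OF G, of l] nbhd_sym[OF G, of l y] assms(2) by auto

text \<open>What remains of the violation protects \<open>b\<close>. The second of two leaves stays
  as a leaf at \<open>b\<close>; the twins left over from a triplet, or from a gadget without its
  leaf, give the situation of \<open>inert_gadget\<close>; a triangle shrinks to an edge whose ends
  support each other. A tetrahedron contradicts the degree bound.\<close>

lemma viol_del_inert:
  assumes G: "graph V E" and S: "subcubic V E" and X: "viol V E X" "a \<in> X"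
    and c: "card (nbhd E a) \<le> 2" and b: "b \<in> nbhd E a"
  shows "inert (V - {a}) (del {a} E) b"
proof -
  let ?N = "nbhd (del {a} E)"
  have G': "graph (V - {a}) (del {a} E)" using G by (rule graph_del)
  have N: "?N v = nbhd E v - {a}" if "v \<noteq> a" for v using that by (simp add: nbhd_del)
  have ab: "a \<noteq> b" "a \<in> nbhd E b" using nbhd_irrefl[OF G, of a] nbhd_sym[OF G, of a b] b by auto
  have c2: "card (?N v) \<le> 2" if "v \<in> nbhd E a" for v
    using card_del_le2[OF G S that, of "{a}"] nbhd_irrefl[OF G, of a] that by auto
  have leaf: ?thesis if "nbhd E l = {b}" "l \<noteq> a" for l
    by (rule inert_support[OF G', of l]) (use that N[of l] c2[OF b] ab in auto)
  from X(1) show ?thesis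
  proof cases
    case (isolated v) with X(2) b show ?thesis by simp
  next
    case (leaf_twins u v x)
    with X(2) b leaf[of u] leaf[of v] show ?thesis by auto
  next
    case (leaf_gadget u v l y z)
    show ?thesis
    proof (cases "y = z")
      case True
      have "u \<noteq> a \<or> v \<noteq> a" using leaf_gadget(2) by auto
      with True leaf_gadget X(2) b leaf[of u] leaf[of v] show ?thesis by (auto simp: insert_commute)
    next
      case yz: False
      have ly: "l \<noteq> y" "l \<in> nbhd E y" using leaf_ne[OF G leaf_gadget(3)] by auto
      have luv: "l \<noteq> u" "l \<noteq> v" using leaf_gadget yz by (auto simp: doubleton_eq_iff)
      have uvy: "u \<in> nbhd E y" "v \<in> nbhd E y" "u \<in> nbhd E z" "v \<in> nbhd E z"
        using nbhd_sym[OF G, of u y] nbhd_sym[OF G, of v y] nbhd_sym[OF G, of u z] nbhd_sym[OF G, of v z] leaf_gadget by auto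
      have lz: "l \<noteq> z" using leaf_gadget uvy nbhd_irrefl[OF G] by (metis empty_iff insert_iff)
      \<comment> \<open>Here \<open>a\<close> is one twin of the gadget and \<open>v\<close> the
        other. At \<open>y\<close> the leaf \<open>l\<close> remains. At \<open>z\<close> the
        remaining degree is one or two, and the only vertex that could share its neighbourhood is
        \<open>y\<close>, which is told apart by \<open>l\<close>.\<close>
      have rest: ?thesis if v: "nbhd E v = {y, z}" "v \<noteq> a" "nbhd E a = {y, z}" and al: "a \<noteq> l" for v
      proof (cases "b = y")
        case True with leaf[of l] leaf_gadget(3) al show ?thesis by auto
      next
        case False
        with b v have bz: "b = z" by auto
        have az: "a \<noteq> y" "a \<noteq> z" using v nbhd_irrefl[OF G, of a] by auto
        have Nv: "?N v = {y, z}" using N[of v] v az by auto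
        have Nl: "?N l = {y}" using N[of l] leaf_gadget(3) al az by auto
        have vz: "v \<in> ?N z" "v \<in> ?N y" "l \<in> ?N y"
          using nbhd_sym[OF G', of v z] nbhd_sym[OF G', of v y] nbhd_sym[OF G', of l y] Nv Nl by auto
        have thr: "w = y \<or> w = z" if "v \<in> ?N w" for w using nbhd_sym[OF G', of w v] that Nv by auto
        have lv: "l \<noteq> v" using Nl Nv yz by (auto simp: doubleton_eq_iff)
        have "card (?N z) \<le> 2" using c2 v by auto
        with vz(1) consider (one) "?N z = {v}" | (two) c where "c \<noteq> v" "?N z = {v, c}"
        proof -
          have f: "finite (?N z)" by (rule finite_nbhd[OF G'])
          have "card (?N z - {v}) \<le> 1" using f vz(1) \<open>card (?N z) \<le> 2\<close> by simp
          then have "?N z - {v} = {} \<or> (\<exists>c. ?N z - {v} = {c})"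
            using f by (metis card_1_singletonE card_0_eq finite_Diff le_Suc_eq le_zero_eq One_nat_def)
          then show ?thesis using vz(1) that by auto
        qed
        then have "inert (V - {a}) (del {a} E) z"
        proof cases
          case z1: one
          have only: "w = z" if w: "?N w = {v}" for w
          proof (rule ccontr)
            assume "w \<noteq> z"
            moreover from w thr[of w] have "w = y \<or> w = z" by simp
            ultimately show False using w vz lv by auto
          qed
          show ?thesis
          proof (rule inert_leaf[OF G' z1])
            fix w assume "?N w = {v}" then show "w = z" by (rule only)
          next
            fix p r q assume *: "?N p = {v, q}" "?N r = {v, q}"
            then have "p = y \<or> p = z" "r = y \<or> r = z" using thr[of p] thr[of r] by auto
            moreover have "p = z \<and> r = z" if "p = z \<or> r = z"
            proof -
              have "q = v" using that * z1 by auto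
              with * have "?N p = {v}" "?N r = {v}" by simp_all
              then show ?thesis using only by blast
            qed
            ultimately show "p = r" by blast
          qed
        next
          case (two c)
          note cv = two(1) and zc = two(2)
          have lc: "l \<noteq> c" using nbhd_sym[OF G', of l z] zc Nl yz by auto
          show ?thesis
          proof (rule inert2[OF G' zc cv[symmetric]])
            fix w assume w: "?N w = {v, c}"
            with thr[of w] have "w = y \<or> w = z" by auto
            moreover have "w \<noteq> y" using w vz(3) lv lc by auto
            ultimately show "w = z" by simp
          next
            assume 1: "?N v = {z, c}" and 2: "?N c = {z, v}"
            from 1 Nv yz have "c = y" by (auto simp: doubleton_eq_iff)
            with 2 vz(3) lv lz show False by auto
          qed
        qed
        then show ?thesis using bz by simp
      qed
      from X(2) leaf_gadget(1) consider "a = l" | "a \<noteq> l" "a = u" | "a \<noteq> l" "a = v" by auto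
      then show ?thesis
      proof cases
        case 1
        with b leaf_gadget have by': "b = y" by simp
        have "{l, u, v} \<subseteq> nbhd E y" using ly uvy by simp
        moreover have "card {l, u, v} = 3" using luv leaf_gadget(2) by simp
        ultimately have "nbhd E y = {l, u, v}"
          using subcubic_card[OF G S, of y] finite_nbhd[OF G, of y] by (metis card_seteq)
        then have "?N y = {u, v}" using 1 N[of y] ly luv by auto
        moreover have "?N u = {y, z}" "?N v = {y, z}"
          using leaf_gadget 1 N[of u] N[of v] luv lz ly by auto
        ultimately show ?thesis unfolding by' using inert_gadget[OF G', of y u v z] leaf_gadget(2) yz by simp
      next
        case 2 with rest[of v] leaf_gadget show ?thesis by auto
      next
        case 3 with rest[of u] leaf_gadget show ?thesis by auto
      qed
    qed
  next
    case (triangle p q r)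
    have tri: ?thesis if "nbhd E a = {b', c'}" "nbhd E b' = {a, c'}" "nbhd E c' = {a, b'}" for b' c'
    proof -
      have ne: "b' \<noteq> a" "c' \<noteq> a" "b' \<noteq> c'"
        using nbhd_irrefl[OF G, of a] nbhd_irrefl[OF G, of b'] that by auto
      have "?N b' = {c'}" "?N c' = {b'}" using N[of b'] N[of c'] ne that by auto
      then have "inert (V - {a}) (del {a} E) b'" "inert (V - {a}) (del {a} E) c'"
        using inert_support[OF G', of c' b'] inert_support[OF G', of b' c'] by auto
      then show ?thesis using b that(1) by auto
    qed
    from triangle(1) X(2) consider "a = p" | "a = q" | "a = r" by auto
    then show ?thesis
    proof cases
      case 1 show ?thesis by (rule tri[of q r]) (use triangle 1 in simp_all)
    next
      case 2 show ?thesis by (rule tri[of p r]) (use triangle 2 in \<open>simp_all add: insert_commute\<close>)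
    next
      case 3 show ?thesis by (rule tri[of p q]) (use triangle 3 in \<open>simp_all add: insert_commute\<close>)
    qed
  next
    case (tetrahedron p q r s)
    have tet: False if "nbhd E a = {b', c', d'}" "nbhd E b' = {a, c', d'}" "nbhd E c' = {a, b', d'}"
      "nbhd E d' = {a, b', c'}" for b' c' d'
      using tetra_card[OF G that] c by simp
    from tetrahedron(1) X(2) consider "a = p" | "a = q" | "a = r" | "a = s" by auto
    then have False
    proof cases
      case 1 show ?thesis by (rule tet[of q r s]) (use tetrahedron 1 in simp_all)
    next
      case 2 show ?thesis by (rule tet[of p r s]) (use tetrahedron 2 in \<open>simp_all add: insert_commute\<close>)
    next
      case 3 show ?thesis by (rule tet[of p q s]) (use tetrahedron 3 in \<open>simp_all add: insert_commute\<close>)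
    next
      case 4 show ?thesis by (rule tet[of p q r]) (use tetrahedron 4 in \<open>simp_all add: insert_commute\<close>)
    qed
    then show ?thesis ..
  next
    case (triplets u v w Y)
    have trip: ?thesis if d: "distinct [a, p, q]" and pq: "nbhd E p = nbhd E a" "nbhd E q = nbhd E a" for p q
    proof (cases "nbhd E a = {b}")
      case True with leaf[of p] d pq show ?thesis by auto
    next
      case False
      have f: "finite (nbhd E a)" by (rule finite_nbhd[OF G])
      have "card (nbhd E a - {b}) \<le> 1" using f b c by simp
      then have "nbhd E a - {b} = {} \<or> (\<exists>c. nbhd E a - {b} = {c})"
        using f by (metis card_1_singletonE card_0_eq finite_Diff le_Suc_eq le_zero_eq One_nat_def)
      with False b obtain z where z: "nbhd E a = {b, z}" "z \<noteq> b" by auto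
      have az: "a \<noteq> z" using nbhd_irrefl[OF G, of a] z by auto
      have "{a, p, q} \<subseteq> nbhd E b"
        using nbhd_sym[OF G, of _ b] pq b by auto
      moreover have "card {a, p, q} = 3" using d by simp
      ultimately have "nbhd E b = {a, p, q}"
        using subcubic_card[OF G S, of b] finite_nbhd[OF G, of b] by (metis card_seteq)
      then have "?N b = {p, q}" using N[of b] ab d by auto
      moreover have "?N p = {b, z}" "?N q = {b, z}" using N[of p] N[of q] d pq z ab az by auto
      ultimately show ?thesis using inert_gadget[OF G', of b p q z] d z by auto
    qed
    from triplets(1) X(2) consider "a = u" | "a = v" | "a = w" by auto
    then show ?thesis
    proof cases
      case 1 show ?thesis by (rule trip[of v w]) (use triplets 1 in simp_all)
    next
      case 2 show ?thesis by (rule trip[of u w]) (use triplets 2 in auto)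
    next
      case 3 show ?thesis by (rule trip[of u v]) (use triplets 3 in auto)
    qed
  qed
qed

text \<open>Deleting a vertex of degree at most two from a violation leaves its neighbours inert, so it
  repairs the violation without creating another one.\<close>

lemma ex_tame_del:
  assumes "finite A" "graph V E" "subcubic V E"
    and "\<And>X. viol V E X \<Longrightarrow> X \<inter> A \<noteq> {}" "\<And>a. a \<in> A \<Longrightarrow> card (nbhd E a) \<le> 2"
  shows "\<exists>B\<subseteq>A. tame (V - B) (del B E)"
  using assms
proof (induction "card A" arbitrary: A V E)
  case 0
  then have "tame V E" unfolding tame_def by auto
  moreover have "del {} E = E" unfolding del_def by (simp add: fun_eq_iff)
  ultimately show ?case by (intro exI[of _ "{}"]) simp
next
  case (Suc n)
  show ?case
  proof (cases "tame V E")
    case True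
    moreover have "del {} E = E" unfolding del_def by (simp add: fun_eq_iff)
    ultimately show ?thesis by (intro exI[of _ "{}"]) simp
  next
    case False
    then obtain X where X: "viol V E X" using Suc.prems unfolding tame_def by auto
    with Suc.prems(4) obtain a where a: "a \<in> X" "a \<in> A" by blast
    have inert: "inert (V - {a}) (del {a} E) b" if "b \<in> nbhd E a" for b
      using viol_del_inert[OF Suc.prems(2,3) X a(1) Suc.prems(5)[OF a(2)] that] .
    have "\<exists>B\<subseteq>A - {a}. tame (V - {a} - B) (del B (del {a} E))"
    proof (rule Suc.hyps(1))
      show "n = card (A - {a})" using Suc.hyps(2) a(2) Suc.prems(1) by simp
      show "finite (A - {a})" using Suc.prems(1) by simp
      show G': "graph (V - {a}) (del {a} E)" using Suc.prems(2) by (rule graph_del)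
      show "subcubic (V - {a}) (del {a} E)" using Suc.prems(2,3) by (rule subcubic_del)
      show "card (nbhd (del {a} E) v) \<le> 2" if "v \<in> A - {a}" for v
      proof -
        have "card (nbhd (del {a} E) v) \<le> card (nbhd E v)"
          by (rule card_mono) (use finite_nbhd[OF Suc.prems(2)] in \<open>auto simp: nbhd_del\<close>)
        with Suc.prems(5)[of v] that show ?thesis by auto
      qed
      fix Y assume Y: "viol (V - {a}) (del {a} E) Y"
      have YV: "Y \<subseteq> V - {a}" using viol_subset[OF G' Y] .
      \<comment> \<open>The neighbours of \<open>a\<close> are inert now, so \<open>Y\<close>
        contains none of them and was a violation before; by hypothesis it meets \<open>A\<close>,
        and it does so outside \<open>a\<close>.\<close>
      have "viol V E Y"
      proof (rule viol_transfer[OF Y])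
        fix v assume v: "v \<in> Y"
        with inert[of v] Y have "v \<notin> nbhd E a" unfolding inert_def by blast
        then have "a \<notin> nbhd E v" using nbhd_sym[OF Suc.prems(2), of a v] by simp
        then show "nbhd (del {a} E) v = nbhd E v" using v YV by (auto simp: nbhd_del)
      qed (use YV in auto)
      with Suc.prems(4) YV show "Y \<inter> (A - {a}) \<noteq> {}" by blast
    qed
    then obtain B where "B \<subseteq> A - {a}" "tame (V - {a} - B) (del B (del {a} E))" by blast
    moreover have "V - {a} - B = V - insert a B" "del B (del {a} E) = del (insert a B) E"
      by (auto simp: del_del)
    ultimately show ?thesis using a(2) by (intro exI[of _ "insert a B"]) auto
  qed
qed

subsection \<open>Extending locating-dominating sets\<close>

text \<open>For a vertex outside \<open>S\<close>, the open and the closed neighbourhood meet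
  \<open>S\<close> in the same set, so codes can be written with open neighbourhoods.\<close>

definition LD :: "'a set \<Rightarrow> ('a \<Rightarrow> 'a \<Rightarrow> bool) \<Rightarrow> 'a set \<Rightarrow> bool" where
  "LD V E S \<longleftrightarrow> S \<subseteq> V \<and> (\<forall>v\<in>V - S. nbhd E v \<inter> S \<noteq> {})
     \<and> (\<forall>u\<in>V - S. \<forall>v\<in>V - S. nbhd E u \<inter> S = nbhd E v \<inter> S \<longrightarrow> u = v)"

definition half :: "'a set \<Rightarrow> ('a \<Rightarrow> 'a \<Rightarrow> bool) \<Rightarrow> bool" where
  "half V E \<longleftrightarrow> (\<exists>S. LD V E S \<and> 2 * card S \<le> card V)"

lemma LD_sub: "LD V E S \<Longrightarrow> S \<subseteq> V"
  unfolding LD_def by (elim conjE)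

lemma LD_dom: "LD V E S \<Longrightarrow> v \<in> V \<Longrightarrow> v \<notin> S \<Longrightarrow> nbhd E v \<inter> S \<noteq> {}"
  unfolding LD_def by blast

lemma LD_loc:
  assumes "LD V E S" "u \<in> V" "u \<notin> S" "v \<in> V" "v \<notin> S" "nbhd E u \<inter> S = nbhd E v \<inter> S"
  shows "u = v"
  using assms unfolding LD_def by (metis DiffI)

lemma LD_locating_dominating: "LD V E S \<Longrightarrow> locating_dominating V E S"
  unfolding LD_def locating_dominating_def cnbhd_def
  by (auto simp: Int_insert_left)

text \<open>Two vertices outside \<open>W\<close> stay separated by their codes in
  \<open>S1\<close>, so only pairs that involve \<open>W\<close> are left to the hypotheses. The
  last premise of \<open>cross\<close> is available because \<open>S1\<close> dominates
  \<open>v\<close> in the smaller graph.\<close>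

lemma LD_extend:
  assumes G: "graph V E" and WV: "W \<subseteq> V" and DW: "D \<subseteq> W" and S1: "LD (V - W) (del W E) S1"
    and dom: "\<And>w. w \<in> W - D \<Longrightarrow> nbhd E w \<inter> (D \<union> S1) \<noteq> {}"
    and loc: "\<And>w w'. w \<in> W - D \<Longrightarrow> w' \<in> W - D \<Longrightarrow> nbhd E w \<inter> (D \<union> S1) = nbhd E w' \<inter> (D \<union> S1) \<Longrightarrow> w = w'"
    and cross: "\<And>w v. w \<in> W - D \<Longrightarrow> v \<in> V - W \<Longrightarrow> v \<notin> S1 \<Longrightarrow> nbhd E w \<inter> (D \<union> S1) = nbhd E v \<inter> (D \<union> S1)
      \<Longrightarrow> nbhd E v \<inter> S1 \<noteq> {} \<Longrightarrow> False"
  shows "LD V E (D \<union> S1)"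
proof -
  have S1V: "S1 \<subseteq> V - W" using S1 unfolding LD_def by simp
  have N: "nbhd (del W E) v \<inter> S1 = nbhd E v \<inter> S1" if "v \<notin> W" for v
    using S1V that by (auto simp: nbhd_del)
  have ne: "nbhd E v \<inter> S1 \<noteq> {}" if "v \<in> V - W" "v \<notin> S1" for v
    using S1 that N[of v] unfolding LD_def by auto
  have out: "u = v" if "u \<in> V - W" "u \<notin> S1" "v \<in> V - W" "v \<notin> S1" "nbhd E u \<inter> (D \<union> S1) = nbhd E v \<inter> (D \<union> S1)" for u v
  proof -
    have "nbhd E u \<inter> S1 = nbhd E v \<inter> S1" using that(5) by blast
    then show ?thesis using S1 that N[of u] N[of v] unfolding LD_def by auto
  qed
  show ?thesis
    unfolding LD_def
  proof (intro conjI ballI impI)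
    show "D \<union> S1 \<subseteq> V" using S1V DW WV by blast
    show "nbhd E v \<inter> (D \<union> S1) \<noteq> {}" if "v \<in> V - (D \<union> S1)" for v
      using dom[of v] ne[of v] that by (cases "v \<in> W") auto
    fix u v assume uv: "u \<in> V - (D \<union> S1)" "v \<in> V - (D \<union> S1)" "nbhd E u \<inter> (D \<union> S1) = nbhd E v \<inter> (D \<union> S1)"
    consider "u \<in> W" "v \<in> W" | "u \<in> W" "v \<notin> W" | "u \<notin> W" "v \<in> W" | "u \<notin> W" "v \<notin> W" by blast
    then show "u = v"
    proof cases
      case 1 with loc[of u v] uv show ?thesis by blast
    next
      case 2 with cross[of u v] ne[of v] uv show ?thesis by blast
    next
      case 3 with cross[of v u] ne[of u] uv show ?thesis by blast
    next
      case 4 with out[of u v] uv show ?thesis by blast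
    qed
  qed
qed

lemma half_extendI:
  assumes G: "graph V E" and WV: "W \<subseteq> V" and D: "2 * card D \<le> card W"
    and S: "2 * card S1 \<le> card (V - W)" and L: "LD V E (D \<union> S1)"
  shows "half V E"
proof -
  have f: "finite V" using G unfolding graph_def by simp
  have "card (D \<union> S1) \<le> card D + card S1" by (rule card_Un_le)
  moreover have "card (V - W) = card V - card W" using f WV by (simp add: card_Diff_subset finite_subset)
  moreover have "card W \<le> card V" using f WV by (rule card_mono)
  ultimately have "2 * card (D \<union> S1) \<le> card V" using D S by linarith
  with L show ?thesis unfolding half_def by blast
qed

text \<open>A criterion that does not mention the unknown set of the smaller graph: the codes within
  \<open>D\<close> alone dominate and separate \<open>W - D\<close>. Against an outside vertex
  \<open>v\<close>, either all neighbours of \<open>w\<close> lie in \<open>W\<close>, and its code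
  misses the element that dominates \<open>v\<close>; or \<open>w\<close> sees some \<open>d\<close>
  in \<open>D\<close> that no outside vertex sees.\<close>

lemma half_extend:
  assumes G: "graph V E" and WV: "W \<subseteq> V" and DW: "D \<subseteq> W" and card: "2 * card D \<le> card W"
    and h: "half (V - W) (del W E)"
    and dom: "\<And>w. w \<in> W - D \<Longrightarrow> nbhd E w \<inter> D \<noteq> {}"
    and loc: "\<And>w w'. w \<in> W - D \<Longrightarrow> w' \<in> W - D \<Longrightarrow> nbhd E w \<inter> D = nbhd E w' \<inter> D \<Longrightarrow> w = w'"
    and cross: "\<And>w. w \<in> W - D \<Longrightarrow> nbhd E w \<subseteq> W \<or> (\<exists>d\<in>nbhd E w \<inter> D. nbhd E d \<subseteq> W)"
  shows "half V E"
proof -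
  from h obtain S1 where S1: "LD (V - W) (del W E) S1" "2 * card S1 \<le> card (V - W)" unfolding half_def by blast
  have S1V: "S1 \<subseteq> V - W" using S1 unfolding LD_def by simp
  have "LD V E (D \<union> S1)"
  proof (rule LD_extend[OF G WV DW S1(1)])
    show "nbhd E w \<inter> (D \<union> S1) \<noteq> {}" if "w \<in> W - D" for w using dom[OF that] by blast
    show "w = w'" if "w \<in> W - D" "w' \<in> W - D" "nbhd E w \<inter> (D \<union> S1) = nbhd E w' \<inter> (D \<union> S1)" for w w'
    proof -
      have "(nbhd E w \<inter> (D \<union> S1)) \<inter> D = (nbhd E w' \<inter> (D \<union> S1)) \<inter> D" using that(3) by simp
      then have "nbhd E w \<inter> D = nbhd E w' \<inter> D" by blast
      with loc that show ?thesis by blast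
    qed
    fix w v assume wv: "w \<in> W - D" "v \<in> V - W" "v \<notin> S1"
      "nbhd E w \<inter> (D \<union> S1) = nbhd E v \<inter> (D \<union> S1)" "nbhd E v \<inter> S1 \<noteq> {}"
    from cross[OF wv(1)] show False
    proof
      assume "nbhd E w \<subseteq> W" with wv(4,5) S1V show False by blast
    next
      assume "\<exists>d\<in>nbhd E w \<inter> D. nbhd E d \<subseteq> W"
      then obtain d where d: "d \<in> nbhd E w" "d \<in> D" "nbhd E d \<subseteq> W" by blast
      with wv(4) have "d \<in> nbhd E v" by blast
      then have "v \<in> nbhd E d" using nbhd_sym[OF G, of v d] by simp
      with d wv(2) show False by blast
    qed
  qed
  from half_extendI[OF G WV card S1(2) this] show ?thesis .
qed

text \<open>Let S be the set of the smaller graph. Adding w fails only if x has the same neighbours as some y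
  adjacent to w; they share some v in S. Adding x fails only if w has the same neighbours as some t
  adjacent to x; they share some z in S. This gives two squares on the edge wx, with y, t outside S
  and z, v in S.\<close>

lemma half_del_edge_ends:
  assumes G: "graph V E" and wx: "x \<in> nbhd E w"
    and sq: "\<And>y z t v. y \<in> nbhd E w \<Longrightarrow> z \<in> nbhd E w \<Longrightarrow> distinct [x, y, z] \<Longrightarrow> t \<in> nbhd E x \<Longrightarrow> v \<in> nbhd E x
      \<Longrightarrow> distinct [w, t, v] \<Longrightarrow> t \<in> nbhd E z \<Longrightarrow> v \<in> nbhd E y \<Longrightarrow> False"
    and h: "half (V - {w, x}) (del {w, x} E)"
  shows "half V E"
proof -
  from h obtain S1 where S1: "LD (V - {w, x}) (del {w, x} E) S1" "2 * card S1 \<le> card (V - {w, x})"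
    unfolding half_def by blast
  have S1V: "S1 \<subseteq> V - {w, x}" using S1 unfolding LD_def by simp
  have xw: "w \<in> nbhd E x" "w \<noteq> x" using wx nbhd_sym[OF G, of w x] nbhd_irrefl[OF G, of x] by auto
  have WV: "{w, x} \<subseteq> V" using nbhd_subset[OF G, of w] nbhd_subset[OF G, of x] wx xw by auto
  have useD: "half V E" if "D = {w} \<or> D = {x}" "LD V E (D \<union> S1)" for D
    by (rule half_extendI[OF G WV _ S1(2) that(2)]) (use that(1) xw in auto)
  have addx: "half V E" if "\<And>v. v \<in> V - {w, x} \<Longrightarrow> v \<notin> S1 \<Longrightarrow> x \<in> nbhd E v \<Longrightarrow>
      nbhd E w \<inter> S1 = nbhd E v \<inter> S1 \<Longrightarrow> nbhd E v \<inter> S1 \<noteq> {} \<Longrightarrow> False"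
  proof (rule useD[of "{x}"])
    show "LD V E ({x} \<union> S1)"
    proof (rule LD_extend[OF G WV _ S1(1)])
      fix u v assume *: "u \<in> {w, x} - {x}" "v \<in> V - {w, x}" "v \<notin> S1" "nbhd E u \<inter> ({x} \<union> S1) = nbhd E v \<inter> ({x} \<union> S1)"
        "nbhd E v \<inter> S1 \<noteq> {}"
      then have "x \<in> nbhd E v" using wx by auto
      moreover have "nbhd E w \<inter> S1 = nbhd E v \<inter> S1" using * S1V by auto
      ultimately show False using * that by blast
    qed (use wx in auto)
  qed simp
  have addw: "half V E" if "\<And>v. v \<in> V - {w, x} \<Longrightarrow> v \<notin> S1 \<Longrightarrow> v \<in> nbhd E w \<Longrightarrow>
      nbhd E x \<inter> S1 = nbhd E v \<inter> S1 \<Longrightarrow> nbhd E v \<inter> S1 \<noteq> {} \<Longrightarrow> False"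
  proof (rule useD[of "{w}"])
    show "LD V E ({w} \<union> S1)"
    proof (rule LD_extend[OF G WV _ S1(1)])
      fix u v assume *: "u \<in> {w, x} - {w}" "v \<in> V - {w, x}" "v \<notin> S1" "nbhd E u \<inter> ({w} \<union> S1) = nbhd E v \<inter> ({w} \<union> S1)"
        "nbhd E v \<inter> S1 \<noteq> {}"
      then have "w \<in> nbhd E v" using xw by auto
      then have "v \<in> nbhd E w" using nbhd_sym[OF G, of v w] by simp
      moreover have "nbhd E x \<inter> S1 = nbhd E v \<inter> S1" using * S1V by auto
      ultimately show False using * that by blast
    qed (use xw in auto)
  qed simp
  show ?thesis
  \<comment> \<open>The pair \<open>z\<close>, \<open>t\<close> is an obstruction to adding
    \<open>w\<close>, and \<open>v\<close>, \<open>y\<close> is an obstruction to adding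
    \<open>x\<close>. They exclude each other by \<open>sq\<close>, so \<open>x\<close> is added if
    the former occurs, and \<open>w\<close> otherwise.\<close>
  proof (cases "\<exists>y z t v. y \<in> nbhd E w \<inter> S1 \<and> z \<in> nbhd E w - S1 \<and> z \<noteq> x \<and> t \<in> S1 \<inter> nbhd E x \<inter> nbhd E z
      \<and> v \<in> V - {w, x} - S1 \<and> v \<in> nbhd E x \<inter> nbhd E y")
    case True
    then obtain y z t v where *: "y \<in> nbhd E w \<inter> S1" "z \<in> nbhd E w - S1" "z \<noteq> x" "t \<in> S1 \<inter> nbhd E x \<inter> nbhd E z"
      "v \<in> V - {w, x} - S1" "v \<in> nbhd E x \<inter> nbhd E y" by blast
    have "False" by (rule sq[of y z t v]) (use * S1V in auto)
    then show ?thesis ..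
  next
    case False
    show ?thesis
    proof (cases "\<exists>z\<in>nbhd E w - S1. z \<noteq> x \<and> S1 \<inter> nbhd E x \<inter> nbhd E z \<noteq> {}")
      case True
      then obtain z where z: "z \<in> nbhd E w" "z \<notin> S1" "z \<noteq> x" "S1 \<inter> nbhd E x \<inter> nbhd E z \<noteq> {}" by blast
      show ?thesis
      proof (rule addx)
        fix v assume v: "v \<in> V - {w, x}" "v \<notin> S1" "x \<in> nbhd E v" "nbhd E w \<inter> S1 = nbhd E v \<inter> S1" "nbhd E v \<inter> S1 \<noteq> {}"
        then obtain y where y: "y \<in> nbhd E w" "y \<in> S1" "y \<in> nbhd E v" by blast
        have "v \<in> nbhd E x" "v \<in> nbhd E y" using nbhd_sym[OF G, of v x] nbhd_sym[OF G, of v y] v y by auto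
        with False z v y show False by blast
      qed
    next
      case no: False
      show ?thesis
      proof (rule addw)
        fix v assume v: "v \<in> V - {w, x}" "v \<notin> S1" "v \<in> nbhd E w" "nbhd E x \<inter> S1 = nbhd E v \<inter> S1" "nbhd E v \<inter> S1 \<noteq> {}"
        with no show False by blast
      qed
    qed
  qed
qed

text \<open>Restoring the edge uv makes a vertex v outside S clash with some t only if u is in S and adjacent
  to t. As v was dominated before, they share a second neighbour s in S, and uvst is a square.\<close>

lemma half_del_edge:
  assumes G: "graph V E" and G': "graph V E'"
    and E': "\<And>a. nbhd E' a = (if a = u then nbhd E a - {v} else if a = v then nbhd E a - {u} else nbhd E a)"
    and sq: "\<And>s t. s \<in> nbhd E v \<Longrightarrow> s \<noteq> u \<Longrightarrow> t \<in> nbhd E s \<Longrightarrow> t \<noteq> v \<Longrightarrow> u \<in> nbhd E t \<Longrightarrow> False"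
    and h: "half V E'"
  shows "half V E"
proof -
  from h obtain S where S: "LD V E' S" "2 * card S \<le> card V" unfolding half_def by blast
  have sq': "False" if "s \<in> nbhd E u" "s \<noteq> v" "t \<in> nbhd E s" "t \<noteq> u" "v \<in> nbhd E t" for s t
    using sq[of t s] that nbhd_sym[OF G, of s u] nbhd_sym[OF G, of t s] nbhd_sym[OF G, of v t] by auto
  have ne: "\<exists>s. s \<in> nbhd E' a \<and> s \<in> S" if "a \<in> V" "a \<notin> S" for a using S(1) that unfolding LD_def by blast
  have sub: "nbhd E' a \<subseteq> nbhd E a" for a using E'[of a] by auto
  have key: "a = b" if ab: "a \<in> V - S" "b \<in> V - S" "nbhd E a \<inter> S = nbhd E b \<inter> S" for a b
  proof (rule ccontr)
    assume "a \<noteq> b"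
    with ab S(1) have "nbhd E' a \<inter> S \<noteq> nbhd E' b \<inter> S" unfolding LD_def by blast
    with ab(3) have "nbhd E' a \<noteq> nbhd E a \<and> nbhd E' a \<inter> S \<noteq> nbhd E a \<inter> S \<or> nbhd E' b \<noteq> nbhd E b \<and> nbhd E' b \<inter> S \<noteq> nbhd E b \<inter> S" by auto
    moreover have False if *: "c \<in> V - S" "d \<in> V - S" "c \<noteq> d" "nbhd E c \<inter> S = nbhd E d \<inter> S" "nbhd E' c \<inter> S \<noteq> nbhd E c \<inter> S" for c d
    proof -
      from * ne[of c] obtain s where s: "s \<in> nbhd E' c" "s \<in> S" by blast
      with *(4) sub[of c] have sc: "s \<in> nbhd E c" and sd: "s \<in> nbhd E d" by auto
      have ds: "d \<in> nbhd E s" using nbhd_sym[OF G, of d s] sd by simp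
      from *(5) E'[of c] consider "c = u" "v \<in> nbhd E c" "v \<in> S" | "c = v" "u \<in> nbhd E c" "u \<in> S" "u \<noteq> v"
        by (auto split: if_splits)
      then show False
      proof cases
        case 1
        with *(4) have "v \<in> nbhd E d" by blast
        moreover have "s \<noteq> v" using s 1 E'[of c] by auto
        ultimately show False using sq'[of s d] 1 sc ds * by auto
      next
        case 2
        with *(4) have "u \<in> nbhd E d" by blast
        moreover have "s \<noteq> u" using s 2 E'[of c] by auto
        ultimately show False using sq[of s d] 2 sc ds * by auto
      qed
    qed
    ultimately show False using ab \<open>a \<noteq> b\<close> by metis
  qed
  have "LD V E S" unfolding LD_def using key ne sub S(1) unfolding LD_def by blast
  with S(2) show ?thesis unfolding half_def by blast
qed

text \<open>If removing the leaf from S creates a clash, the clashing vertex takes its place.\<close>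

lemma LD_support:
  assumes G: "graph V E" and L: "LD V E S" and l: "nbhd E l = {t}"
  obtains S' where "LD V E S'" "card S' \<le> card S" "t \<in> S'" "l \<notin> S'" "S - {l} \<subseteq> S'"
proof -
  have fin: "finite S" using LD_sub[OF L] G finite_subset unfolding graph_def by blast
  have lt: "l \<noteq> t" "l \<in> nbhd E t" using leaf_ne[OF G l] by auto
  have lV: "l \<in> V" "t \<in> V" using nbhd_subset[OF G, of t] nbhd_subset[OF G, of l] lt l by auto
  have only: "a = t" if "l \<in> nbhd E a" for a using nbhd_sym[OF G, of l a] that l by auto
  show thesis
  proof (cases "l \<in> S")
    case False
    with LD_dom[OF L lV(1)] l have "t \<in> S" by auto
    from that[OF L order_refl \<open>t \<in> S\<close> False] show thesis by blast
  next
    case lS: True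
    have loc: "a = b" if "a \<in> V - S" "b \<in> V - S" "nbhd E a \<inter> S = nbhd E b \<inter> S" for a b
      using LD_loc[OF L, of a b] that by blast
    have dom: "nbhd E a \<inter> S \<noteq> {}" if "a \<in> V - S" for a using LD_dom[OF L, of a] that by blast
    have main: "LD V E (insert k (S - {l}))" if k: "k \<in> V" "k \<noteq> l" "t = k \<or> t \<in> S"
      "\<And>v. v \<in> V - S \<Longrightarrow> v \<noteq> k \<Longrightarrow> nbhd E v \<inter> S = {t} \<Longrightarrow> False" for k
    proof -
      let ?S = "insert k (S - {l})"
      have tS: "t \<in> ?S" using k(3) lt(1) by auto
      then have lc: "nbhd E l \<inter> ?S = {t}" unfolding l by blast
      \<comment> \<open>Only \<open>t\<close> sees \<open>l\<close>, and \<open>t\<close> lies in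
        the new set, so no other vertex outside it loses an element of its code.\<close>
      have vc: "nbhd E v \<inter> ?S \<inter> S = nbhd E v \<inter> S" if "v \<in> V - ?S" "v \<noteq> l" for v
      proof -
        have "v \<noteq> t" using that(1) tS by auto
        then have "l \<notin> nbhd E v" using only[of v] by auto
        then show ?thesis by blast
      qed
      have vS: "v \<in> V - S" if "v \<in> V - ?S" "v \<noteq> l" for v using that by blast
      have lv: "nbhd E v \<inter> ?S \<noteq> {t}" if "v \<in> V - ?S" "v \<noteq> l" for v
      proof
        assume eq: "nbhd E v \<inter> ?S = {t}"
        have eq': "nbhd E v \<inter> S = {t} \<inter> S" using vc[OF that] unfolding eq by (rule sym)
        with dom[OF vS[OF that]] have "t \<in> S" by auto
        with eq' have "nbhd E v \<inter> S = {t}" by simp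
        from k(4)[OF vS[OF that] _ this] that(1) show False by simp
      qed
      show ?thesis
        unfolding LD_def
      proof (intro conjI ballI impI)
        show "?S \<subseteq> V" using LD_sub[OF L] k(1) by (simp add: subset_iff)
        show "nbhd E v \<inter> ?S \<noteq> {}" if "v \<in> V - ?S" for v
        proof (cases "v = l")
          case False
          from vc[OF that False] dom[OF vS[OF that False]] show ?thesis by blast
        qed (use lc in simp)
        fix a b assume ab: "a \<in> V - ?S" "b \<in> V - ?S" "nbhd E a \<inter> ?S = nbhd E b \<inter> ?S"
        show "a = b"
        proof (cases "a = l")
          case True
          with lv[OF ab(2)] ab(3) lc show ?thesis by (cases "b = l") simp_all
        next
          case al: False
          show ?thesis
          proof (cases "b = l")
            case True
            with lv[OF ab(1) al] ab(3) lc show ?thesis by simp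
          next
            case bl: False
            have "nbhd E a \<inter> S = nbhd E b \<inter> S"
              using vc[OF ab(1) al] vc[OF ab(2) bl] ab(3) by simp
            from loc[OF vS[OF ab(1) al] vS[OF ab(2) bl] this] show ?thesis .
          qed
        qed
      qed
    qed
    have card: "card (insert k (S - {l})) \<le> card S" for k
    proof -
      have "card (insert k (S - {l})) \<le> Suc (card (S - {l}))" using fin by (simp add: card_insert_if)
      also have "\<dots> = card S" using fin lS by (rule card_Suc_Diff1)
      finally show ?thesis .
    qed
    show thesis
    proof (cases "\<exists>k\<in>V - S. t \<in> S \<and> nbhd E k \<inter> S = {t}")
      case True
      then obtain k where k: "k \<in> V - S" "t \<in> S" "nbhd E k \<inter> S = {t}" by blast
      have kl: "k \<noteq> l" using k(1) lS by blast
      have "LD V E (insert k (S - {l}))"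
      proof (rule main)
        show "k \<in> V" using k(1) by blast
        show "k \<noteq> l" by (rule kl)
        show "t = k \<or> t \<in> S" using k(2) by blast
        fix v assume v: "v \<in> V - S" "v \<noteq> k" "nbhd E v \<inter> S = {t}"
        have "nbhd E v \<inter> S = nbhd E k \<inter> S" unfolding v(3) k(3) ..
        from loc[OF v(1) k(1) this] v(2) show False by contradiction
      qed
      from that[OF this card] kl k lt show thesis by auto
    next
      case False
      have "LD V E (insert t (S - {l}))"
      proof (rule main)
        show "t \<in> V" by (rule lV(2))
        show "t \<noteq> l" using lt(1) by simp
        show "t = t \<or> t \<in> S" by simp
        fix v assume v: "v \<in> V - S" "nbhd E v \<inter> S = {t}"
        then have "t \<in> nbhd E v \<inter> S" by simp
        then have "t \<in> S" by simp
        with v False show False by simp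
      qed
      from that[OF this card] lt show thesis by auto
    qed
  qed
qed

section \<open>Extensions at links between supported vertices and at pendant triangles\<close>

lemma half_link:
  assumes G: "graph V E" and l: "nbhd E l = {a}" and v: "nbhd E v = {a, b}" and b': "nbhd E b' = {b}"
    and ab: "a \<noteq> b" and h: "half (V - {l, a, v}) (del {l, a, v} E)"
  shows "half V E"
proof -
  let ?W = "{l, a, v}" let ?H = "del ?W E"
  have va: "v \<noteq> a" "v \<noteq> b" "v \<in> nbhd E a" "v \<in> nbhd E b"
    using nbhd_irrefl[OF G, of v] nbhd_sym[OF G, of v a] nbhd_sym[OF G, of v b] v by auto
  have la: "l \<noteq> a" "l \<in> nbhd E a" using leaf_ne[OF G l] .
  have bb': "b' \<noteq> b" "b' \<in> nbhd E b" using leaf_ne[OF G b'] .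
  have lv: "l \<noteq> v" using l v ab by auto
  have lb: "l \<noteq> b" using va l by auto
  have b'v: "b' \<noteq> v" using b' v ab by auto
  have b'a: "b' \<noteq> a" using va b' by auto
  have b'l: "b' \<noteq> l" using b' l ab by auto
  have WV: "?W \<subseteq> V" using nbhd_subset[OF G, of a] nbhd_subset[OF G, of l] l va la by auto
  have G': "graph (V - ?W) ?H" using G by (rule graph_del)
  have Hb': "nbhd ?H b' = {b}" using b' b'a b'l b'v lb va ab by (auto simp: nbhd_del)
  from h obtain S0 where S0: "LD (V - ?W) ?H S0" "2 * card S0 \<le> card (V - ?W)" unfolding half_def by blast
  \<comment> \<open>The leaf \<open>b'\<close> survives the deletion, so its support
    \<open>b\<close> may be assumed to lie in the set. Then \<open>b\<close> separates
    \<open>v\<close> from \<open>l\<close>, and \<open>a\<close> is the only new vertex.\<close>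
  obtain S1 where S1: "LD (V - ?W) ?H S1" "card S1 \<le> card S0" "b \<in> S1" "b' \<notin> S1"
    by (rule LD_support[OF G' S0(1) Hb']) blast
  have S1V: "S1 \<subseteq> V - ?W" using LD_sub[OF S1(1)] .
  have b'V: "b' \<in> V - ?W" using nbhd_subset[OF G, of b] bb' b'a b'l b'v by auto
  have L: "LD V E ({a} \<union> S1)"
  proof (rule LD_extend[OF G WV _ S1(1)])
    fix w w' assume *: "w \<in> ?W - {a}" "w' \<in> ?W - {a}" "nbhd E w \<inter> ({a} \<union> S1) = nbhd E w' \<inter> ({a} \<union> S1)"
    have "b \<in> nbhd E v \<inter> ({a} \<union> S1)" "b \<notin> nbhd E l \<inter> ({a} \<union> S1)" using v l S1(3) ab by auto
    with * show "w = w'" by auto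
  next
    fix w z assume z: "w \<in> ?W - {a}" "z \<in> V - ?W" "z \<notin> S1"
      "nbhd E w \<inter> ({a} \<union> S1) = nbhd E z \<inter> ({a} \<union> S1)" "nbhd E z \<inter> S1 \<noteq> {}"
    have aS: "a \<notin> S1" using S1V by blast
    have "w = l \<or> w = v" using z(1) by blast
    then show False
    proof
      assume "w = l"
      then have "nbhd E w \<inter> S1 = {}" using l aS by auto
      with z(4,5) show False by blast
    next
      assume wv: "w = v"
      then have "nbhd E z \<inter> ({a} \<union> S1) = {a, b}" using z(4) v S1(3) by auto
      then have za: "a \<in> nbhd E z" "nbhd E z \<inter> S1 = {b}" using aS ab by auto
      \<comment> \<open>An outside vertex with the code \<open>{a, b}\<close> has the code
        \<open>{b}\<close> in the smaller graph, as \<open>b'\<close> does; so it is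
        \<open>b'\<close>, which is not adjacent to \<open>a\<close>.\<close>
      have "nbhd ?H z \<inter> S1 = nbhd ?H b' \<inter> S1"
        using za(2) Hb' S1(3) S1V z(2) by (auto simp: nbhd_del)
      from LD_loc[OF S1(1) z(2,3) b'V S1(4) this] za(1) b' ab show False by simp
    qed
  qed (use l v in auto)
  have "2 * card S1 \<le> card (V - ?W)" using S0(2) S1(2) by linarith
  from half_extendI[OF G WV _ this L] la lv va show ?thesis by simp
qed

text \<open>The single new vertex \<open>x\<close> pays for four deleted ones: with \<open>t\<close>
  and \<open>t'\<close> in the set, the codes of \<open>w\<close>, \<open>p\<close>,
  \<open>q\<close> are \<open>{x}\<close>, \<open>{x, t}\<close>, \<open>{x, t'}\<close>. All
  neighbours of \<open>x\<close> are deleted, so no outside code contains \<open>x\<close>.\<close>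

lemma half_two_links:
  assumes G: "graph V E" and w: "nbhd E w = {x}" and x: "nbhd E x = {w, p, q}" and p: "nbhd E p = {x, t}"
    and q: "nbhd E q = {x, t'}" and l: "nbhd E l = {t}" and l': "nbhd E l' = {t'}"
    and ne: "t \<noteq> t'" "t \<noteq> x" "t' \<noteq> x" and h: "half (V - {w, x, p, q}) (del {w, x, p, q} E)"
  shows "half V E"
proof -
  let ?W = "{w, x, p, q}" let ?H = "del ?W E"
  have pq: "p \<noteq> q" using p q ne by (auto simp: doubleton_eq_iff)
  have wp: "w \<noteq> p" "w \<noteq> q" using w p q ne by (auto simp: doubleton_eq_iff)
  have wx: "w \<noteq> x" "p \<noteq> x" "q \<noteq> x" using nbhd_irrefl[OF G, of x] x by auto
  have pt: "p \<in> nbhd E t" "q \<in> nbhd E t'" using nbhd_sym[OF G, of p t] nbhd_sym[OF G, of q t'] p q by auto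
  have lt: "l \<in> nbhd E t" "l' \<in> nbhd E t'" using leaf_ne[OF G l] leaf_ne[OF G l'] by auto
  have tp: "t \<noteq> p" "t' \<noteq> q" using nbhd_irrefl[OF G] p q by auto
  have xw: "w \<in> nbhd E x" using x by simp
  have tq: "t \<noteq> q"
  proof
    assume tq: "t = q"
    with lt(1) q have "l = x \<or> l = t'" by simp
    then show False
    proof
      assume "l = x" with l tq xw wp show False by simp
    next
      assume "l = t'"
      with l tq lt(2) have "l' = q" by simp
      with l' q ne show False by (simp add: doubleton_eq_iff)
    qed
  qed
  have t'p: "t' \<noteq> p"
  proof
    assume t'p: "t' = p"
    with lt(2) p have "l' = x \<or> l' = t" by simp
    then show False
    proof
      assume "l' = x" with l' t'p xw wp show False by simp
    next
      assume "l' = t"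
      with l' t'p lt(1) have "l = p" by simp
      with l p ne show False by (simp add: doubleton_eq_iff)
    qed
  qed
  have tw: "t \<noteq> w" "t' \<noteq> w" using pt w wx by auto
  have "nbhd E l \<noteq> nbhd E w" "nbhd E l \<noteq> nbhd E x" "nbhd E l \<noteq> nbhd E p" "nbhd E l \<noteq> nbhd E q"
    "nbhd E l' \<noteq> nbhd E w" "nbhd E l' \<noteq> nbhd E x" "nbhd E l' \<noteq> nbhd E p" "nbhd E l' \<noteq> nbhd E q"
    unfolding l l' w x p q using ne pq by auto
  then have lW: "l \<notin> ?W" "l' \<notin> ?W" by auto
  have WV: "?W \<subseteq> V" using nbhd_subset[OF G, of x] nbhd_subset[OF G, of w] x w by auto
  have G': "graph (V - ?W) ?H" using G by (rule graph_del)
  have Hl: "nbhd ?H l = {t}" "nbhd ?H l' = {t'}" using l l' lW tp tq t'p tw ne by (auto simp: nbhd_del)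
  from h obtain S0 where S0: "LD (V - ?W) ?H S0" "2 * card S0 \<le> card (V - ?W)" unfolding half_def by blast
  obtain S1 where S1: "LD (V - ?W) ?H S1" "card S1 \<le> card S0" "t \<in> S1"
    by (rule LD_support[OF G' S0(1) Hl(1)]) blast
  have tl': "t \<noteq> l'"
  proof
    assume "t = l'" with pt l' tp have "p = t'" by auto with t'p show False by simp
  qed
  \<comment> \<open>The second exchange drops at most \<open>l'\<close>, so \<open>t\<close> stays
    in the set.\<close>
  obtain S2 where S2: "LD (V - ?W) ?H S2" "card S2 \<le> card S1" "t' \<in> S2" "S1 - {l'} \<subseteq> S2"
    by (rule LD_support[OF G' S1(1) Hl(2)]) blast
  have tS: "t \<in> S2" using S1(3) S2(4) tl' by blast
  have S2V: "S2 \<subseteq> V - ?W" using LD_sub[OF S2(1)] .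
  have code: "nbhd E w \<inter> ({x} \<union> S2) = {x}" "nbhd E p \<inter> ({x} \<union> S2) = {x, t}" "nbhd E q \<inter> ({x} \<union> S2) = {x, t'}"
    using w p q tS S2(3) by auto
  have L: "LD V E ({x} \<union> S2)"
  proof (rule LD_extend[OF G WV _ S2(1)])
    fix u u' assume *: "u \<in> ?W - {x}" "u' \<in> ?W - {x}" "nbhd E u \<inter> ({x} \<union> S2) = nbhd E u' \<inter> ({x} \<union> S2)"
    have neq: "{x} \<noteq> {x, t}" "{x} \<noteq> {x, t'}" "{x, t} \<noteq> {x, t'}" using ne by (auto simp: doubleton_eq_iff)
    have "u = w \<or> u = p \<or> u = q" "u' = w \<or> u' = p \<or> u' = q" using *(1,2) by auto
    then show "u = u'" using *(3) neq code by (elim disjE) metis+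
  next
    fix u z assume z: "u \<in> ?W - {x}" "z \<in> V - ?W" "z \<notin> S2"
      "nbhd E u \<inter> ({x} \<union> S2) = nbhd E z \<inter> ({x} \<union> S2)" "nbhd E z \<inter> S2 \<noteq> {}"
    from z(1) have "u = w \<or> u = p \<or> u = q" by auto
    then have "x \<in> nbhd E u \<inter> ({x} \<union> S2)" using code by auto
    then have "x \<in> nbhd E z" unfolding z(4) by simp
    then have "z \<in> nbhd E x" using nbhd_sym[OF G, of z x] by simp
    with x z(2) show False by auto
  qed (use code in auto)
  have "2 * card S2 \<le> card (V - ?W)" using S0(2) S1(2) S2(2) by linarith
  from half_extendI[OF G WV _ this L] wx wp pq show ?thesis by simp
qed

text \<open>After adding \<open>u\<close>, the only outside vertex that can be confused with
  \<open>v\<close> is \<open>x\<close>. If \<open>x\<close> is not in the set, the code of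
  \<open>v\<close> is just \<open>{u}\<close>, whereas \<open>x\<close> is also dominated from the
  smaller graph.\<close>

lemma half_pendant_triangle:
  assumes G: "graph V E" and u: "nbhd E u = {v, x}" and v: "nbhd E v = {u, x}" and x: "nbhd E x = {u, v, y}"
    and y: "y \<noteq> u" "y \<noteq> v" and h: "half (V - {u, v}) (del {u, v} E)"
  shows "half V E"
proof -
  let ?W = "{u, v}" let ?H = "del ?W E"
  have uvx: "u \<noteq> v" "u \<noteq> x" "v \<noteq> x" using nbhd_irrefl[OF G] u v x by auto
  have WV: "?W \<subseteq> V" using nbhd_subset[OF G, of x] x by auto
  from h obtain S1 where S1: "LD (V - ?W) ?H S1" "2 * card S1 \<le> card (V - ?W)" unfolding half_def by blast
  have S1V: "S1 \<subseteq> V - ?W" using LD_sub[OF S1(1)] .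
  have L: "LD V E ({u} \<union> S1)"
  proof (rule LD_extend[OF G WV _ S1(1)])
    fix w z assume z: "w \<in> ?W - {u}" "z \<in> V - ?W" "z \<notin> S1"
      "nbhd E w \<inter> ({u} \<union> S1) = nbhd E z \<inter> ({u} \<union> S1)" "nbhd E z \<inter> S1 \<noteq> {}"
    then have wv: "w = v" by blast
    have "u \<in> nbhd E z" using z(4) v unfolding wv by auto
    then have "z \<in> {v, x}" using nbhd_sym[OF G, of z u] u by simp
    then have "z = x" using z(2) by blast
    then have "nbhd E w \<inter> S1 = {}" using v S1V z(3) unfolding wv by auto
    with z(4,5) show False by blast
  qed (use v in auto)
  from half_extendI[OF G WV _ S1(2) L] uvx show ?thesis by simp
qed

text \<open>Deleting the whole triangle costs only \<open>u\<close>: the leaf at \<open>y\<close>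
  allows \<open>y\<close> to be in the set, where it separates \<open>x\<close> from
  \<open>v\<close>.\<close>

lemma half_pendant_triangle_at_support:
  assumes G: "graph V E" and u: "nbhd E u = {v, x}" and v: "nbhd E v = {u, x}" and x: "nbhd E x = {u, v, y}"
    and l: "nbhd E l = {y}" and y: "y \<noteq> u" "y \<noteq> v" and h: "half (V - {u, v, x}) (del {u, v, x} E)"
  shows "half V E"
proof -
  let ?W = "{u, v, x}" let ?H = "del ?W E"
  have uvx: "u \<noteq> v" "u \<noteq> x" "v \<noteq> x" "y \<noteq> x" using nbhd_irrefl[OF G] u v x by auto
  have "nbhd E l \<noteq> nbhd E u" "nbhd E l \<noteq> nbhd E v" "nbhd E l \<noteq> nbhd E x"
    unfolding l u v x using uvx y by auto
  then have lW: "l \<notin> ?W" by auto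
  have WV: "?W \<subseteq> V" using nbhd_subset[OF G, of x] nbhd_subset[OF G, of u] x u by auto
  have G': "graph (V - ?W) ?H" using G by (rule graph_del)
  have Hl: "nbhd ?H l = {y}" using l lW uvx y by (auto simp: nbhd_del)
  from h obtain S0 where S0: "LD (V - ?W) ?H S0" "2 * card S0 \<le> card (V - ?W)" unfolding half_def by blast
  obtain S1 where S1: "LD (V - ?W) ?H S1" "card S1 \<le> card S0" "y \<in> S1"
    by (rule LD_support[OF G' S0(1) Hl]) blast
  have S1V: "S1 \<subseteq> V - ?W" using LD_sub[OF S1(1)] .
  have code: "nbhd E v \<inter> ({u} \<union> S1) = {u}" "nbhd E x \<inter> ({u} \<union> S1) = {u, y}"
    using v x S1(3) S1V by auto
  have L: "LD V E ({u} \<union> S1)"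
  proof (rule LD_extend[OF G WV _ S1(1)])
    fix w w' assume *: "w \<in> ?W - {u}" "w' \<in> ?W - {u}" "nbhd E w \<inter> ({u} \<union> S1) = nbhd E w' \<inter> ({u} \<union> S1)"
    have "{u} \<noteq> {u, y}" using y by auto
    with * code show "w = w'" by auto
  next
    fix w z assume z: "w \<in> ?W - {u}" "z \<in> V - ?W" "z \<notin> S1"
      "nbhd E w \<inter> ({u} \<union> S1) = nbhd E z \<inter> ({u} \<union> S1)" "nbhd E z \<inter> S1 \<noteq> {}"
    from z(1) have "w = v \<or> w = x" by auto
    then have "u \<in> nbhd E w \<inter> ({u} \<union> S1)" using code by auto
    then have "u \<in> nbhd E z" unfolding z(4) by simp
    then have "z \<in> nbhd E u" using nbhd_sym[OF G, of z u] by simp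
    with u z(2) show False by auto
  qed (use code in auto)
  have "2 * card S1 \<le> card (V - ?W)" using S0(2) S1(2) by linarith
  from half_extendI[OF G WV _ this L] uvx show ?thesis by simp
qed

text \<open>Triangles and tetrahedra have no outer neighbours, and in the other violations each
  outer neighbour is shared: in the gadget, \<open>y\<close> belongs to all three members and
  \<open>z\<close> to both twins.\<close>

lemma viol_partner:
  assumes "graph V E" "viol V E X" "s \<in> X" "b \<in> nbhd E s" "b \<notin> X"
  shows "\<exists>s'\<in>X. s' \<noteq> s \<and> b \<in> nbhd E s'"
  using assms(2)
proof cases
  case (isolated v) with assms show ?thesis by auto
next
  case (leaf_twins u v x)
  then have "b = x" using assms by auto
  with leaf_twins assms(3) show ?thesis by (cases "s = u") auto
next
  case (leaf_gadget u v l y z)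
  consider "s = u" | "s = v" "s \<noteq> u" | "s = l" "s \<noteq> u" "s \<noteq> v" using assms(3) leaf_gadget(1) by auto
  then show ?thesis
  proof cases
    case 1
    then have "b \<in> nbhd E v" using leaf_gadget assms(4) by simp
    with 1 leaf_gadget show ?thesis by auto
  next
    case 2
    then have "b \<in> nbhd E u" using leaf_gadget assms(4) by simp
    with 2 leaf_gadget show ?thesis by auto
  next
    case 3
    then have "b \<in> nbhd E u" using leaf_gadget assms(4) by simp
    with 3 leaf_gadget show ?thesis by auto
  qed
next
  case (triangle a b' c) with assms show ?thesis by auto
next
  case (tetrahedron a b' c d) with assms show ?thesis by auto
next
  case (triplets u v w Y)
  consider "s = u" | "s = v" | "s = w" using assms(3) triplets(1) by auto
  then show ?thesis
  proof cases
    case 1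
    then have "b \<in> nbhd E v" using triplets assms(4) by simp
    with 1 triplets show ?thesis by auto
  next
    case 2
    then have "b \<in> nbhd E u" using triplets assms(4) by simp
    with 2 triplets show ?thesis by auto
  next
    case 3
    then have "b \<in> nbhd E u" using triplets assms(4) by simp
    with 3 triplets show ?thesis by auto
  qed
qed

text \<open>Members of \<open>A\<close> have lost a neighbour, hence have degree at most two, and
  \<open>ex_tame_del\<close> can repair with them. It stays open which of them are deleted, so
  applications distinguish the possible sets \<open>B\<close>.\<close>

lemma tame_del_repair:
  assumes T: "tame V E" and A: "finite A" "A \<subseteq> V - W"
    and aff: "\<And>a. a \<in> A \<Longrightarrow> nbhd E a \<inter> W \<noteq> {}"
    and inert: "\<And>a. a \<in> V - W \<Longrightarrow> nbhd E a \<inter> W \<noteq> {} \<Longrightarrow> a \<notin> A \<Longrightarrow> inert (V - W) (del W E) a"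
  shows "\<exists>B\<subseteq>A. tame (V - (W \<union> B)) (del (W \<union> B) E)"
proof -
  have G: "graph V E" and S: "subcubic V E" using T unfolding tame_def by auto
  have G': "graph (V - W) (del W E)" using G by (rule graph_del)
  have "\<exists>B\<subseteq>A. tame (V - W - B) (del B (del W E))"
  proof (rule ex_tame_del[OF A(1) G' subcubic_del[OF G S]])
    fix X assume X: "viol (V - W) (del W E) X"
    from viol_changed[OF T X _ G'] obtain a where a: "a \<in> X" "nbhd (del W E) a \<noteq> nbhd E a" by auto
    have "a \<in> V - W" using viol_subset[OF G' X] a(1) by auto
    moreover from this a(2) have "nbhd E a \<inter> W \<noteq> {}" by (auto simp: nbhd_del split: if_splits)
    ultimately have "a \<in> A" using inert[of a] viol_not_inert[OF X a(1)] by argo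
    with a(1) show "X \<inter> A \<noteq> {}" by blast
  next
    fix a assume a: "a \<in> A"
    then obtain b where b: "b \<in> nbhd E a" "b \<in> W" using aff by blast
    have "a \<in> nbhd E b" using nbhd_sym[OF G, of a b] b by simp
    then show "card (nbhd (del W E) a) \<le> 2" using card_del_le2[OF G S _ b(2)] a A(2) by blast
  qed
  then obtain B where B: "B \<subseteq> A" "tame (V - W - B) (del B (del W E))" by blast
  have "V - W - B = V - (W \<union> B)" by blast
  moreover have "del B (del W E) = del (W \<union> B) E" unfolding del_del by (simp add: Un_commute)
  ultimately have "tame (V - (W \<union> B)) (del (W \<union> B) E)" using B(2) by metis
  with B(1) show ?thesis by blast
qed

subsection \<open>Minimal counterexamples\<close>

text \<open>Adjacent pairs are counted along with the vertices, so that deleting a single edge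
  descends as well. All reductions are deletions, hence minimality among graphs over the same type
  is enough.\<close>

locale mincex =
  fixes V :: "'a set" and E :: "'a \<Rightarrow> 'a \<Rightarrow> bool"
  assumes tame: "tame V E" and no_half: "\<not> half V E"
    and minimal: "\<And>(V' :: 'a set) E'. tame V' E' \<Longrightarrow> card V' + card {(a, b). E' a b} < card V + card {(a, b). E a b} \<Longrightarrow> half V' E'"
begin

abbreviation N where "N \<equiv> nbhd E"

lemma G: "graph V E" and subc: "subcubic V E"
  using tame unfolding tame_def by auto

lemma sym: "a \<in> N b \<longleftrightarrow> b \<in> N a" using nbhd_sym[OF G] .
lemma irr: "a \<notin> N a" using nbhd_irrefl[OF G] .
lemma finV: "finite V" using G unfolding graph_def by simp
lemma finN: "finite (N a)" using finite_nbhd[OF G] .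
lemma card3: "card (N a) \<le> 3" using subcubic_card[OF G subc] .
lemma no_viol: "\<not> viol V E X" using tame unfolding tame_def by simp
lemma inV: "N w \<noteq> {} \<Longrightarrow> w \<in> V" using nbhd_outside[OF G] by blast
lemma inV': "b \<in> N a \<Longrightarrow> b \<in> V" using nbhd_subset[OF G] by blast

lemma no_leaf_twins: "N u = {x} \<Longrightarrow> N v = {x} \<Longrightarrow> u = v"
  using viol.leaf_twins[of u v E x V] no_viol by metis

lemma no_leaf_gadget: "N l = {y} \<Longrightarrow> N u = {y, z} \<Longrightarrow> N v = {y, z} \<Longrightarrow> u = v"
  using viol.leaf_gadget[of u v E l y z V] no_viol by metis

lemma no_triangle: "N a = {b, c} \<Longrightarrow> N b = {a, c} \<Longrightarrow> N c = {a, b} \<Longrightarrow> False"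
  using viol.triangle[of E a b c V] no_viol by metis

lemma no_tetrahedron: "N a = {b, c, d} \<Longrightarrow> N b = {a, c, d} \<Longrightarrow> N c = {a, b, d} \<Longrightarrow> N d = {a, b, c} \<Longrightarrow> False"
  using viol.tetrahedron[of E a b c d V] no_viol by metis

lemma no_triplets: "distinct [u, v, w] \<Longrightarrow> N u = X \<Longrightarrow> N v = X \<Longrightarrow> N w = X \<Longrightarrow> X \<noteq> {} \<Longrightarrow> False"
  using viol.triplets[of u v w E X V] no_viol by metis

lemma N3:
  assumes "distinct [a, b, c]" "a \<in> N v" "b \<in> N v" "c \<in> N v" shows "N v = {a, b, c}"
proof -
  have "{a, b, c} \<subseteq> N v" using assms by simp
  moreover have "card {a, b, c} = 3" using assms(1) by simp
  ultimately show ?thesis using card3[of v] finN[of v] card_seteq by metis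
qed

lemma N2:
  assumes "a \<noteq> b" "a \<in> N v" "b \<in> N v"
  obtains "N v = {a, b}" | c where "c \<noteq> a" "c \<noteq> b" "c \<noteq> v" "N v = {a, b, c}"
proof (cases "N v = {a, b}")
  case False
  then obtain c where c: "c \<in> N v" "c \<noteq> a" "c \<noteq> b" using assms by blast
  with N3[of a b c v] assms irr[of v] that(2)[of c] show thesis by auto
qed (use that in simp)

lemma N1:
  assumes "a \<in> N v"
  obtains "N v = {a}" | b where "b \<noteq> a" "b \<noteq> v" "N v = {a, b}"
  | b c where "b \<noteq> a" "c \<noteq> a" "b \<noteq> c" "b \<noteq> v" "c \<noteq> v" "N v = {a, b, c}"
proof (cases "N v = {a}")
  case False
  then obtain b where b: "b \<in> N v" "b \<noteq> a" using assms by blast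
  then have bv: "b \<noteq> v" using irr[of v] by auto
  have ab: "a \<noteq> b" using b by simp
  from N2[OF ab assms b(1)] show thesis
  proof cases
    case 1 with that(2) b bv show thesis by blast
  next
    case (2 c) with that(3) b bv show thesis by blast
  qed
qed (use that in simp)

lemma fin_pairs: "finite {(a, b). E a b}"
  by (rule finite_subset[of _ "V \<times> V"]) (use G finV in \<open>auto simp: graph_def\<close>)

lemma half_smaller:
  assumes "tame (V - W) (del W E)" "W \<subseteq> V" "W \<noteq> {}"
  shows "half (V - W) (del W E)"
proof (rule minimal[OF assms(1)])
  have "card (V - W) < card V" by (rule psubset_card_mono) (use assms finV in auto)
  moreover have "card {(a, b). del W E a b} \<le> card {(a, b). E a b}"
    by (rule card_mono[OF fin_pairs]) (auto simp: del_def)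
  ultimately show "card (V - W) + card {(a, b). del W E a b} < card V + card {(a, b). E a b}" by linarith
qed

lemma not_tame_extend:
  assumes T: "tame (V - W) (del W E)" and W: "W \<noteq> {}" "\<And>w. w \<in> W \<Longrightarrow> N w \<noteq> {}"
    and DW: "D \<subseteq> W" and card: "2 * card D \<le> card W"
    and dom: "\<And>w. w \<in> W - D \<Longrightarrow> N w \<inter> D \<noteq> {}"
    and loc: "\<And>w w'. w \<in> W - D \<Longrightarrow> w' \<in> W - D \<Longrightarrow> N w \<inter> D = N w' \<inter> D \<Longrightarrow> w = w'"
    and cross: "\<And>w. w \<in> W - D \<Longrightarrow> N w \<subseteq> W \<or> (\<exists>d\<in>N w \<inter> D. N d \<subseteq> W)"
  shows False
proof -
  have WV: "W \<subseteq> V" using W(2) inV by blast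
  have "half V E"
    by (rule half_extend[OF G WV DW card half_smaller[OF T WV W(1)]]) (fact dom, fact loc, fact cross)
  with no_half show False ..
qed

text \<open>No edge leaves \<open>W\<close>, so its deletion changes no other neighbourhood. This
  settles the small components into which several case distinctions close up, by an explicit
  \<open>D\<close>.\<close>

lemma not_closed:
  assumes W: "W \<noteq> {}" "\<And>w. w \<in> W \<Longrightarrow> N w \<noteq> {}" and cl: "\<And>w. w \<in> W \<Longrightarrow> N w \<subseteq> W"
    and DW: "D \<subseteq> W" and card: "2 * card D \<le> card W"
    and dom: "\<And>w. w \<in> W - D \<Longrightarrow> N w \<inter> D \<noteq> {}"
    and loc: "\<And>w w'. w \<in> W - D \<Longrightarrow> w' \<in> W - D \<Longrightarrow> N w \<inter> D = N w' \<inter> D \<Longrightarrow> w = w'"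
  shows False
proof (rule not_tame_extend[OF _ W DW card dom loc])
  show "tame (V - W) (del W E)"
  proof (rule tame_delI[OF tame])
    fix a assume a: "a \<in> V - W" "N a \<inter> W \<noteq> {}"
    then obtain w where "w \<in> N a" "w \<in> W" by blast
    then have "a \<in> N w" using sym by blast
    with cl[of w] \<open>w \<in> W\<close> a show "inert (V - W) (del W E) a" by blast
  qed
qed (use cl in auto)

lemma not_tame_edge:
  assumes wx: "x \<in> N w"
    and sq: "\<And>y z t v. y \<in> N w \<Longrightarrow> z \<in> N w \<Longrightarrow> distinct [x, y, z] \<Longrightarrow> t \<in> N x \<Longrightarrow> v \<in> N x
      \<Longrightarrow> distinct [w, t, v] \<Longrightarrow> t \<in> N z \<Longrightarrow> v \<in> N y \<Longrightarrow> False"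
    and T: "tame (V - {w, x}) (del {w, x} E)"
  shows False
proof -
  have "w \<in> N x" using wx sym by blast
  then have WV: "{w, x} \<subseteq> V" using wx inV' by blast
  have "half V E"
    by (rule half_del_edge_ends[OF G wx _ half_smaller[OF T WV]]) (fact sq, simp)
  with no_half show False ..
qed

lemma not_tame_leaf: "N w = {x} \<Longrightarrow> tame (V - {w, x}) (del {w, x} E) \<Longrightarrow> False"
  by (rule not_tame_edge[of x w]) auto

text \<open>The two squares on the edge \<open>wx\<close> would need two neighbours of
  \<open>w\<close> besides \<open>x\<close>.\<close>

lemma not_tame_deg2: "N w = {x, y} \<Longrightarrow> tame (V - {w, x}) (del {w, x} E) \<Longrightarrow> False"
  by (rule not_tame_edge[of x w]) auto

subsection \<open>Twins\<close>

text \<open>Deleting \<open>u\<close> and \<open>x\<close> makes the twin \<open>v\<close> a leaf at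
  \<open>y\<close>. Another leaf at \<open>y\<close> would come from a leaf gadget or a triplet
  around \<open>u\<close> and \<open>v\<close>, and \<open>y\<close> has room for only one further
  neighbour; so \<open>v\<close> and its support \<open>y\<close> are inert. The deletion can thus
  fail only at a third neighbour \<open>x'\<close> of \<open>x\<close>, and it must fail
  there.\<close>

lemma gadget_side:
  assumes u: "N u = {x, y}" and v: "N v = {x, y}" and uv: "u \<noteq> v" and xy: "x \<notin> N y"
  shows "inert (V - {u, x}) (del {u, x} E) v" "inert (V - {u, x}) (del {u, x} E) y"
    "\<exists>x'. N x = {u, v, x'} \<and> x' \<notin> {u, v, x, y} \<and> x' \<notin> N y
      \<and> tame (V - {u, x, x'}) (del {u, x, x'} E)
      \<and> \<not> inert (V - {u, x}) (del {u, x} E) x'" (is "\<exists>x'. ?P x'")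
proof -
  let ?W = "{u, x}" let ?H = "del ?W E"
  let ?M = "nbhd ?H"
  have G': "graph (V - ?W) ?H" using G by (rule graph_del)
  have ne: "x \<noteq> y" using no_leaf_twins[of u x v] u v uv by auto
  have in_N: "u \<in> N x" "v \<in> N x" "u \<in> N y" "v \<in> N y" using sym u v by auto
  have ne2: "u \<noteq> x" "v \<noteq> x" "u \<noteq> y" "v \<noteq> y" using in_N irr by metis+
  have Mv: "?M v = {y}" using v uv ne ne2 by (auto simp: nbhd_del)
  have vy: "w = v" if w: "?M w = {y}" for w
  proof (rule ccontr)
    assume wv: "w \<noteq> v"
    have wW: "w \<noteq> u" "w \<noteq> x" using w by (auto simp: nbhd_del)
    then have Nw: "N w - {u, x} = {y}" using w by (simp add: nbhd_del)
    have "w \<in> N y" using Nw sym[of y w] by blast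
    then have "w \<noteq> y" using irr by blast
    have "u \<notin> N w" using sym[of u w] u wW \<open>w \<noteq> y\<close> by auto
    then have "N w = {y} \<or> N w = {x, y}" using Nw by auto
    then show False
    proof
      assume "N w = {y}"
      with no_leaf_gadget[of w y u x v] u v uv show False by (simp add: insert_commute)
    next
      assume "N w = {x, y}"
      with no_triplets[of u v w "{x, y}"] u v uv wv wW show False by simp
    qed
  qed
  have v_inert: "inert (V - ?W) ?H v"
  proof (rule inert_leaf[OF G' Mv vy])
    fix p q z assume pq: "?M p = {y, z}" "?M q = {y, z}"
    show "p = q"
    proof (cases "z = y")
      case True
      with pq vy[of p] vy[of q] show ?thesis by simp
    next
      case False
      have pv: "p \<noteq> v" "q \<noteq> v" using Mv pq False by auto
      have puy: "p \<noteq> u" "q \<noteq> u" using pq by (auto simp: nbhd_del)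
      have "p \<in> ?M y" "q \<in> ?M y" using nbhd_sym[OF G', of p y] nbhd_sym[OF G', of q y] pq by auto
      then have "p \<in> N y" "q \<in> N y" by (auto simp: nbhd_del split: if_splits)
      then show ?thesis using in_N(3,4) N3[of u v p y] uv pv puy by auto
    qed
  qed
  have y_inert: "inert (V - ?W) ?H y"
    by (rule inert_support[OF G' Mv card_del_le2[OF G subc, of y u]]) (use u ne ne2 in auto)
  have aff: "a = v \<or> a = y \<or> a \<in> N x" if "a \<in> V - ?W" "N a \<inter> ?W \<noteq> {}" for a
    using that sym[of u a] sym[of x a] u by auto
  have "N x \<noteq> {u, v}"
  proof
    assume Nx: "N x = {u, v}"
    have "tame (V - ?W) ?H"
    proof (rule tame_delI[OF tame])
      fix a assume a: "a \<in> V - ?W" "N a \<inter> ?W \<noteq> {}"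
      from aff[OF this] Nx a have "a = v \<or> a = y" by auto
      then show "inert (V - ?W) ?H a" using v_inert y_inert by auto
    qed
    with not_tame_deg2[OF u] show False by simp
  qed
  then obtain x' where x': "x' \<noteq> u" "x' \<noteq> v" "x' \<noteq> x" "N x = {u, v, x'}"
    using N2[OF uv in_N(1,2)] by metis
  have x'y: "x' \<noteq> y" using x' xy sym[of x y] by auto
  have x'_bad: "\<not> inert (V - ?W) ?H x'"
  proof
    assume i: "inert (V - ?W) ?H x'"
    have "tame (V - ?W) ?H"
    proof (rule tame_delI[OF tame])
      fix a assume a: "a \<in> V - ?W" "N a \<inter> ?W \<noteq> {}"
      from aff[OF this] x' a have "a = v \<or> a = y \<or> a = x'" by auto
      then show "inert (V - ?W) ?H a" using v_inert y_inert i by auto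
    qed
    with not_tame_deg2[OF u] show False by simp
  qed
  have x'N: "x \<in> N x'" using x'(4) sym[of x x'] by simp
  \<comment> \<open>If \<open>x'\<close> is adjacent to \<open>y\<close>, then either
    \<open>x'\<close> completes a triplet with \<open>u\<close> and \<open>v\<close>, or it has a
    third neighbour \<open>k\<close> and is inert: after the deletion the only other neighbour of
    \<open>y\<close> is the leaf \<open>v\<close>.\<close>
  have x'Ny: "x' \<notin> N y"
  proof
    assume x'y2: "x' \<in> N y"
    then have yx': "y \<in> N x'" using sym by blast
    have Ny: "N y = {u, v, x'}" using N3[of u v x' y] in_N x'y2 uv x' by auto
    from N2[OF ne x'N yx'] show False
    proof cases
      case 1
      with no_triplets[of u v x' "{x, y}"] u v uv x' show False by simp
    next
      case (2 k)
      have ku: "k \<noteq> u" "k \<noteq> v"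
        using 2 u v sym[of u x'] sym[of v x'] x' x'y by auto
      have Mx': "?M x' = {y, k}" using 2 x' x'y ne ku ne2 by (auto simp: nbhd_del)
      have My: "?M y = {v, x'}" using Ny x' xy ne ne2 uv by (auto simp: nbhd_del)
      have "inert (V - ?W) ?H x'"
      proof (rule inert2[OF G' Mx'])
        show "y \<noteq> k" using 2 by simp
        fix w assume w: "?M w = {y, k}"
        then have "w \<in> ?M y" using nbhd_sym[OF G', of w y] by simp
        then have "w = v \<or> w = x'" using My by simp
        moreover have "w \<noteq> v" using w Mv 2(2) by auto
        ultimately show "w = x'" by simp
      next
        assume "?M y = {x', k}"
        with My ku x' show False by auto
      qed
      with x'_bad show False by simp
    qed
  qed
  have "\<exists>B\<subseteq>{x'}. tame (V - (?W \<union> B)) (del (?W \<union> B) E)"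
  proof (rule tame_del_repair[OF tame])
    show "{x'} \<subseteq> V - ?W" using x' inV'[of x' x] by simp
    show "N a \<inter> ?W \<noteq> {}" if "a \<in> {x'}" for a using that x'N by auto
    fix a assume a: "a \<in> V - ?W" "N a \<inter> ?W \<noteq> {}" "a \<notin> {x'}"
    from aff[OF a(1,2)] x' a have "a = v \<or> a = y" by auto
    then show "inert (V - ?W) ?H a" using v_inert y_inert by auto
  qed simp
  then obtain B where B: "B \<subseteq> {x'}" "tame (V - (?W \<union> B)) (del (?W \<union> B) E)" by blast
  have "B \<noteq> {}" using B(2) not_tame_deg2[OF u] by auto
  then have "B = {x'}" using B(1) by blast
  then have "tame (V - {u, x, x'}) (del {u, x, x'} E)" using B(2) by (simp add: insert_commute)
  then have "?P x'" using x' x'y x'Ny x'_bad by simp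
  then show "\<exists>x'. ?P x'" ..
  show "inert (V - {u, x}) (del {u, x} E) v" "inert (V - {u, x}) (del {u, x} E) y"
    by (fact v_inert, fact y_inert)
qed

text \<open>If \<open>x\<close> and \<open>y\<close> are adjacent, four vertices form a component.
  Otherwise \<open>gadget_side\<close> applies at both. Deleting \<open>v\<close> and
  \<open>y\<close> after \<open>u\<close>, \<open>x\<close>, \<open>x'\<close> requires at most
  \<open>y'\<close> in addition. If \<open>y'\<close> goes too, three of six vertices suffice. If it
  stays, the violation that blocks the deletion of \<open>u\<close> and \<open>y\<close> must have
  been destroyed by removing \<open>x'\<close>, so it has two members adjacent to \<open>x'\<close>;
  but these make \<open>x'\<close> inert for the deletion of \<open>u\<close> and \<open>x\<close>,
  contrary to its choice.\<close>

lemma no_gadget: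
  assumes u: "N u = {x, y}" and v: "N v = {x, y}"
  shows "u = v"
proof (rule ccontr)
  assume uv: "u \<noteq> v"
  have xy: "x \<noteq> y" using no_leaf_twins[of u x v] u v uv by auto
  have in_N: "u \<in> N x" "v \<in> N x" "u \<in> N y" "v \<in> N y" using sym u v by auto
  have ne: "u \<noteq> x" "v \<noteq> x" "u \<noteq> y" "v \<noteq> y" using in_N irr by metis+
  show False
  proof (cases "x \<in> N y")
    case True
    then have "y \<in> N x" using sym by blast
    have Nx: "N x = {u, v, y}" and Ny: "N y = {u, v, x}"
      using N3[of u v y x] N3[of u v x y] in_N \<open>y \<in> N x\<close> True uv ne by auto
    show False
      by (rule not_closed[of "{u, v, x, y}" "{u, x}"]) (use u v Nx Ny uv ne xy in auto)
  next
    case xNy: False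
    then have yNx: "y \<notin> N x" using sym by blast
    note side = gadget_side[OF u v uv xNy]
    have u': "N u = {y, x}" and v': "N v = {y, x}" using u v by auto
    note side' = gadget_side[OF u' v' uv yNx]
    from side(3) obtain x' where x': "N x = {u, v, x'}" "x' \<notin> {u, v, x, y}" "x' \<notin> N y"
      "tame (V - {u, x, x'}) (del {u, x, x'} E)" "\<not> inert (V - {u, x}) (del {u, x} E) x'" by blast
    from side'(3) obtain y' where y': "N y = {u, v, y'}" "y' \<notin> {u, v, x, y}" "y' \<notin> N x"
      "\<not> inert (V - {u, y}) (del {u, y} E) y'" by blast
    have xy': "x' \<noteq> y'" using x'(3) y'(1) by auto
    have x'N: "x \<in> N x'" "y \<in> N y'" using x'(1) y'(1) sym[of x x'] sym[of y y'] by auto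
    let ?V1 = "V - {u, x, x'}" let ?E1 = "del {u, x, x'} E"
    have "\<exists>B\<subseteq>{y'}. tame (?V1 - ({v, y} \<union> B)) (del ({v, y} \<union> B) ?E1)"
    proof (rule tame_del_repair[OF x'(4)])
      show "{y'} \<subseteq> ?V1 - {v, y}" using y' xy' inV'[of y' y] x' by auto
      show "nbhd ?E1 a \<inter> {v, y} \<noteq> {}" if "a \<in> {y'}" for a
        using that x'N(2) y'(2) xy' x'(2) ne xy by (auto simp: nbhd_del)
      fix a assume a: "a \<in> ?V1 - {v, y}" "nbhd ?E1 a \<inter> {v, y} \<noteq> {}" "a \<notin> {y'}"
      then have "v \<in> N a \<or> y \<in> N a" by (auto simp: nbhd_del split: if_splits)
      then have "a \<in> N v \<or> a \<in> N y" using sym by blast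
      with a v y'(1) show "inert (?V1 - {v, y}) (del {v, y} ?E1) a" by auto
    qed simp
    then obtain B where B: "B \<subseteq> {y'}" "tame (?V1 - ({v, y} \<union> B)) (del ({v, y} \<union> B) ?E1)" by blast
    have eq: "?V1 - ({v, y} \<union> B) = V - ({u, x, x', v, y} \<union> B)"
      "del ({v, y} \<union> B) ?E1 = del ({u, x, x', v, y} \<union> B) E"
      by (auto simp: del_del intro: arg_cong2[where f = del])
    note B2 = B(2)[unfolded eq]
    from B(1) consider "B = {y'}" | "B = {}" by blast
    then show False
    proof cases
      case 1
      have T: "tame (V - {x', x, u, v, y, y'}) (del {x', x, u, v, y, y'} E)"
        using B2 unfolding 1 by (simp add: insert_commute)
      have code: "N v \<inter> {x, y, u} = {x, y}" "N x' \<inter> {x, y, u} = {x}" "N y' \<inter> {x, y, u} = {y}"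
        using v x'N x' y' sym[of u x'] sym[of u y'] sym[of y x'] sym[of x y'] u by auto
      show False
      proof (rule not_tame_extend[OF T, of "{x, y, u}"])
        show "2 * card {x, y, u} \<le> card {x', x, u, v, y, y'}" using x'(2) y'(2) uv ne xy xy' by auto
        fix w assume w: "w \<in> {x', x, u, v, y, y'} - {x, y, u}"
        then have wc: "w = v \<or> w = x' \<or> w = y'" by auto
        show "N w \<inter> {x, y, u} \<noteq> {}" using wc code by auto
        show "N w \<subseteq> {x', x, u, v, y, y'} \<or> (\<exists>d\<in>N w \<inter> {x, y, u}. N d \<subseteq> {x', x, u, v, y, y'})"
          using wc code v x'(1) y'(1) x'N by auto
        fix w' assume w': "w' \<in> {x', x, u, v, y, y'} - {x, y, u}" and c: "N w \<inter> {x, y, u} = N w' \<inter> {x, y, u}"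
        then have "w' = v \<or> w' = x' \<or> w' = y'" by auto
        moreover have "{x, y} \<noteq> {x}" "{x, y} \<noteq> {y}" "{x} \<noteq> {y}" using xy by auto
        ultimately show "w = w'" using wc c code by (elim disjE) metis+
      qed (use u v x' y' x'N in auto)
    next
      case 2
      have T: "tame (V - {u, x, x', v, y}) (del {u, x, x', v, y} E)"
        using B2 unfolding 2 by simp
      let ?Hy = "del {u, y} E" let ?M = "nbhd ?Hy"
      have Gy: "graph (V - {u, y}) ?Hy" using G by (rule graph_del)
      from y'(4) obtain X where X: "viol (V - {u, y}) ?Hy X" "y' \<in> X" unfolding inert_def by blast
      have XV: "X \<subseteq> V - {u, y}" using viol_subset[OF Gy X(1)] .
      have vX: "v \<notin> X" and xX: "x \<notin> X" using side'(1,2) X(1) unfolding inert_def by auto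
      have MN: "?M a = N a - {u, y}" if "a \<in> X" for a using that XV by (auto simp: nbhd_del)
      have x'X: "x' \<notin> X"
      proof
        assume "x' \<in> X"
        moreover from this have "x \<in> ?M x'" using MN[of x'] x'N ne xy by auto
        ultimately obtain s' where s': "s' \<in> X" "s' \<noteq> x'" "x \<in> ?M s'" using viol_partner[OF Gy X(1) _ _ xX] by blast
        then have "s' \<in> N x" using MN[of s'] sym[of x s'] by auto
        with x'(1) s' vX XV show False by auto
      qed
      show False
      proof (cases "\<exists>s\<in>X. x' \<in> N s")
        case False
        have "viol (V - {u, x, x', v, y}) (del {u, x, x', v, y} E) X"
        proof (rule viol_transfer[OF X(1)])
          show "X \<subseteq> V - {u, x, x', v, y}" using XV xX x'X vX by auto
          fix s assume s: "s \<in> X"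
          have "s \<notin> N x" using x'(1) s XV vX x'X by auto
          then have "x \<notin> N s" using sym by blast
          moreover have "v \<notin> N s" using sym[of v s] v s xX XV by auto
          ultimately show "?M s = nbhd (del {u, x, x', v, y} E) s"
            using MN[OF s] False s XV xX x'X vX by (auto simp: nbhd_del)
        qed
        with T show False unfolding tame_def by blast
      next
        case True
        then obtain s where s: "s \<in> X" "x' \<in> N s" by blast
        have x'u: "x' \<notin> {u, y}" using x'(2) by auto
        then have "x' \<in> ?M s" using MN[OF s(1)] s(2) by auto
        then obtain s' where s': "s' \<in> X" "s' \<noteq> s" "x' \<in> N s'"
          using viol_partner[OF Gy X(1) s(1) _ x'X] MN by blast
        have sx': "s \<in> N x'" "s' \<in> N x'" using s s' sym by blast+
        have Nx': "N x' = {x, s, s'}" using N3[of x s s' x'] x'N(1) sx' s s' xX by auto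
        let ?Hx = "del {u, x} E" let ?L = "nbhd ?Hx"
        have Gx: "graph (V - {u, x}) ?Hx" using G by (rule graph_del)
        have LN: "?L a = N a - {u, x}" if "a \<in> X \<or> a = x'" for a using that XV xX x'(2) by (auto simp: nbhd_del)
        have Lx': "?L x' = {s, s'}" using LN[of x'] Nx' s s' xX XV by auto
        \<comment> \<open>Within \<open>X\<close>, only \<open>y'\<close> can be adjacent to
          \<open>u\<close> or \<open>y\<close>, so all other members have their original
          neighbourhoods.\<close>
        have full: "N a = ?M a" if "a \<in> X" "a \<noteq> y'" for a
        proof -
          have "a \<notin> N y" using y'(1) that XV vX by auto
          then have "y \<notin> N a" using sym by blast
          moreover have "u \<notin> N a" using sym[of u a] u that XV xX by auto
          ultimately show ?thesis using MN[OF that(1)] by auto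
        qed
        have leaf: False if "l \<in> X" "l \<noteq> y'" "?M l = {x'}" for l
        proof -
          have "?L l = {x'}" using LN[of l] full[of l] that x'(2) by auto
          then have "inert (V - {u, x}) ?Hx x'"
            by (rule inert_support[OF Gx _ card_del_le2[OF G subc, of x' x]]) (use x' in auto)
          with x'(5) show False by simp
        qed
        from X(1) show False
        proof cases
          case (isolated w) with s s' show False by auto
        next
          case (leaf_twins a b t)
          with \<open>x' \<in> ?M s\<close> s(1) have "t = x'" by auto
          with leaf[of a] leaf[of b] leaf_twins show False by auto
        next
          case (leaf_gadget a b l p q)
          show False
          proof (cases "p = q")
            case True
            with \<open>x' \<in> ?M s\<close> s(1) leaf_gadget have "p = x'" by auto
            with True leaf[of a] leaf[of b] leaf_gadget show False by auto
          next
            case pq: False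
            have lab: "l \<noteq> a" "l \<noteq> b" using leaf_gadget pq by (auto simp: doubleton_eq_iff)
            have "x' = p \<or> x' = q" using \<open>x' \<in> ?M s\<close> s(1) leaf_gadget by auto
            then show False
            proof
              assume "x' = p"
              then have "x' \<in> N l" "x' \<in> N a" "x' \<in> N b" using leaf_gadget MN[of l] MN[of a] MN[of b] by auto
              then have "l \<in> N x'" "a \<in> N x'" "b \<in> N x'" using sym by blast+
              with N3[of l a b x'] lab leaf_gadget(1,2) x'N(1) xX show False by auto
            next
              assume q: "x' = q"
              have "x' \<in> N a" "x' \<in> N b" using leaf_gadget MN[of a] MN[of b] q by auto
              then have "a \<in> N x'" "b \<in> N x'" using sym by blast+
              then have "a \<in> {s, s'}" "b \<in> {s, s'}" using Nx' xX leaf_gadget(1) by auto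
              with Lx' leaf_gadget(2) have Lab: "?L x' = {a, b}" by auto
              have lp: "l \<in> N p" using leaf_gadget(3) MN[of l] leaf_gadget(1) sym[of p l] by auto
              have no: "b' \<noteq> p" if "b' \<in> X" "?M b' = {p, q}" for b'
                using that irr[of p] MN[of b'] by auto
              \<comment> \<open>At least one of \<open>a\<close>, \<open>b\<close> has kept its
                neighbourhood \<open>{p, q}\<close>, so only \<open>p\<close> could be a twin of
                \<open>x' = q\<close>; the leaf \<open>l\<close> at \<open>p\<close> prevents
                this.\<close>
              have "inert (V - {u, x}) ?Hx x'"
              proof (rule inert2[OF Gx Lab leaf_gadget(2)])
                fix w assume w: "?L w = {a, b}"
                obtain c where c: "c \<in> X" "c = a \<or> c = b" "c \<noteq> y'" using leaf_gadget(1,2) by auto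
                have "c \<in> ?L w" using w c by auto
                then have "w \<in> N c" and wL: "?L w = N w - {u, x}" using sym[of c w] by (auto simp: nbhd_del split: if_splits)
                then have "w = p \<or> w = x'" using full[OF c(1,3)] c leaf_gadget q by auto
                moreover have "w \<noteq> p"
                proof
                  assume "w = p"
                  with lp wL have "l \<in> ?L w" using XV xX leaf_gadget(1) by auto
                  with w lab show False by auto
                qed
                ultimately show "w = x'" by simp
              next
                assume L: "?L a = {x', b}" "?L b = {x', a}"
                then have "b \<in> N a" "a \<in> N b" by (auto simp: nbhd_del split: if_splits)
                moreover have "a \<noteq> y' \<or> b \<noteq> y'" using leaf_gadget(2) by auto
                ultimately have "b \<in> {p, q} \<or> a \<in> {p, q}" using full[of a] full[of b] leaf_gadget by auto
                then show False using no[of a] no[of b] leaf_gadget x'X q by auto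
              qed
              with x'(5) show False by simp
            qed
          qed
        next
          case (triangle a b c) with \<open>x' \<in> ?M s\<close> s(1) x'X show False by auto
        next
          case (tetrahedron a b c d) with \<open>x' \<in> ?M s\<close> s(1) x'X show False by auto
        next
          case (triplets a b c Y)
          with \<open>x' \<in> ?M s\<close> s(1) have "x' \<in> Y" by auto
          then have "x' \<in> N a" "x' \<in> N b" "x' \<in> N c" using triplets MN[of a] MN[of b] MN[of c] by auto
          then have "a \<in> N x'" "b \<in> N x'" "c \<in> N x'" using sym by blast+
          with N3[of a b c x'] triplets(1,2) x'N(1) xX show False by auto
        qed
      qed
    qed
  qed
qed

text \<open>The square \<open>p a v b\<close> with a leaf at \<open>a\<close> is reduced according
  to what happens at \<open>b\<close> and \<open>x\<close>. A leaf at \<open>b\<close> makes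
  \<open>v\<close> a link, as in \<open>half_link\<close>. Otherwise \<open>l\<close> and
  \<open>a\<close> can be deleted unless a second vertex \<open>q\<close> joins \<open>x\<close> to
  \<open>b\<close>. In that case a leaf at \<open>x\<close> closes up a component of eight vertices,
  and without one \<open>v\<close> and \<open>b\<close> can be deleted.\<close>

lemma no_leaf_square:
  assumes p: "N p = {x, a, b}" and v: "N v = {a, b}" and l: "N l = {a}" and d: "distinct [x, a, b]"
  shows False
proof -
  have pv: "p \<noteq> v" "l \<noteq> p" "l \<noteq> v" using p v l d by auto
  have na: "p \<in> N a" "v \<in> N a" "l \<in> N a" "p \<in> N b" "v \<in> N b" "p \<in> N x"
    using p v l sym[of p a] sym[of v a] sym[of l a] sym[of p b] sym[of v b] sym[of p x] by auto
  have Na: "N a = {l, p, v}" using N3[of l p v a] na pv by simp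
  have ne: "p \<noteq> a" "v \<noteq> a" "l \<noteq> a" "p \<noteq> b" "v \<noteq> b" "p \<noteq> x" using na irr by metis+
  have lb: "l \<noteq> b" using na(4) l ne by auto
  have lx: "l \<noteq> x" using na(6) l ne by auto
  have vx: "v \<noteq> x" using na(6) v ne by auto
  have bNa: "b \<notin> N a" using Na lb ne by auto
  show False
  proof (cases "\<exists>c. N c = {b}")
    case True
    then obtain c where c: "N c = {b}" by blast
    let ?W = "{l, a, v}" let ?H = "del ?W E" let ?L = "nbhd ?H"
    have G': "graph (V - ?W) ?H" using G by (rule graph_del)
    have cb: "c \<in> N b" using c sym[of c b] by simp
    have cne: "c \<noteq> l" "c \<noteq> a" "c \<noteq> v" "c \<noteq> p" "c \<noteq> x"
      using c l v p d na ne bNa by auto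
    have Nb: "N b = {p, v, c}" using N3[of p v c b] na cb pv cne by simp
    have Lc: "?L c = {b}" using c cne lb ne d by (auto simp: nbhd_del)
    have Lp: "?L p = {x, b}" using p d pv ne lx lb vx by (auto simp: nbhd_del)
    have Lb: "?L b = {p, c}" using Nb d pv ne lb cne by (auto simp: nbhd_del)
    have "tame (V - ?W) ?H"
    proof (rule tame_delI[OF tame])
      fix e assume e: "e \<in> V - ?W" "N e \<inter> ?W \<noteq> {}"
      then have "e \<in> N l \<or> e \<in> N a \<or> e \<in> N v" using sym by blast
      with e l Na v have "e = p \<or> e = b" by auto
      then show "inert (V - ?W) ?H e"
      proof
        assume "e = b"
        moreover have "card (?L b) \<le> 2" using Lb cne by simp
        ultimately show ?thesis using inert_support[OF G' Lc] by simp
      next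
        assume "e = p"
        moreover have "inert (V - ?W) ?H p"
        proof (rule inert2[OF G' Lp])
          show "x \<noteq> b" using d by simp
          fix w assume w: "?L w = {x, b}"
          then have "w \<in> ?L b" using nbhd_sym[OF G', of w b] by simp
          moreover have "w \<noteq> c" using w Lc d by auto
          ultimately show "w = p" using Lb by simp
        next
          assume "?L b = {p, x}"
          with Lb cne ne show False by (auto simp: doubleton_eq_iff)
        qed
        ultimately show ?thesis by simp
      qed
    qed
    then have "half (V - ?W) ?H" by (rule half_smaller) (use na inV' l v inV[of l] inV[of v] in auto)
    with half_link[OF G l v c] d no_half show False by simp
  next
    case A1: False
    show False
    proof (cases "\<exists>q. q \<noteq> p \<and> N q = {x, b}")
      case False
      let ?W = "{l, a}" let ?H = "del ?W E" let ?L = "nbhd ?H"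
      have G': "graph (V - ?W) ?H" using G by (rule graph_del)
      have Lp: "?L p = {x, b}" using p d pv ne lx lb by (auto simp: nbhd_del)
      have Lv: "?L v = {b}" using v d pv ne lb by (auto simp: nbhd_del)
      have aff: "e = p \<or> e = v" if "e \<notin> ?W" "N e \<inter> ?W \<noteq> {}" for e
      proof -
        have "e \<in> N l \<or> e \<in> N a" using sym that by blast
        with l Na that(1) show ?thesis by auto
      qed
      have same: "?L e = N e" if "e \<noteq> p" "e \<noteq> v" "?L e \<noteq> {}" for e
        using aff[of e] that by (auto simp: nbhd_del split: if_splits)
      have leafb: "w = v" if "?L w = {b}" for w
      proof (rule ccontr)
        assume "w \<noteq> v"
        moreover have "w \<noteq> p" using that Lp d by auto
        ultimately have "N w = {b}" using same[of w] that by simp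
        with A1 show False by blast
      qed
      have linkb: "w = p" if "?L w = {x, b}" for w
      proof (rule ccontr)
        assume wp: "w \<noteq> p"
        moreover have "w \<noteq> v" using that Lv d by auto
        ultimately have "N w = {x, b}" using same[of w] that by simp
        with False wp show False by blast
      qed
      have "tame (V - ?W) ?H"
      proof (rule tame_delI[OF tame])
        fix e assume e: "e \<in> V - ?W" "N e \<inter> ?W \<noteq> {}"
        have "inert (V - ?W) ?H v"
        proof (rule inert_leaf[OF G' Lv leafb])
          fix g h z assume gh: "?L g = {b, z}" "?L h = {b, z}"
          show "g = h"
          proof (cases "z = b")
            case True with gh leafb[of g] leafb[of h] show ?thesis by simp
          next
            case zb: False
            show ?thesis
            proof (cases "z = x")
              case True with gh linkb[of g] linkb[of h] show ?thesis by (simp add: insert_commute)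
            next
              case False
              have "g \<noteq> v" "h \<noteq> v" "g \<noteq> p" "h \<noteq> p" using gh Lv Lp zb False d by (auto simp: doubleton_eq_iff)
              then have "N g = {b, z}" "N h = {b, z}" using same[of g] same[of h] gh by (metis insert_not_empty)+
              then show ?thesis by (rule no_gadget)
            qed
          qed
        qed
        moreover have "inert (V - ?W) ?H p"
        proof (rule inert2[OF G' Lp _ linkb])
          show "x \<noteq> b" using d by simp
          assume "?L b = {p, x}"
          moreover have "v \<in> ?L b" using nbhd_sym[OF G', of v b] Lv by simp
          ultimately show False using pv vx by simp
        qed
        ultimately show "inert (V - ?W) ?H e" using aff[of e] e by auto
      qed
      with not_tame_leaf[OF l] show False .
    next
      case True
      then obtain q where q: "q \<noteq> p" "N q = {x, b}" by blast
      have qb: "q \<in> N b" "q \<in> N x" using q sym[of q b] sym[of q x] by auto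
      have qv: "q \<noteq> v" using q v d by (auto simp: doubleton_eq_iff)
      have Nb: "N b = {p, v, q}" using N3[of p v q b] na qb pv qv q by simp
      have qne: "q \<noteq> b" "q \<noteq> x" using qb irr by metis+
      have ql: "q \<noteq> l" "q \<noteq> a" using q l Na d na bNa by auto
      show False
      proof (cases "\<exists>c. N c = {x}")
        case True
        then obtain c where c: "N c = {x}" by blast
        have cx: "c \<in> N x" using c sym[of c x] by simp
        have cne: "c \<noteq> p" "c \<noteq> q" using c p q d by auto
        have Nx: "N x = {p, q, c}" using N3[of p q c x] na qb cx q cne by auto
        have "c \<noteq> x" using cx irr by metis
        have more: "c \<noteq> l" "c \<noteq> v" "c \<noteq> a" "c \<noteq> b" using c l v d na ne Na Nb q by auto
        show False
        proof (rule not_closed[of "{l, a, p, v, b, q, x, c}" "{a, b, x}"])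
          show "2 * card {a, b, x} \<le> card {l, a, p, v, b, q, x, c}"
            using d pv ne lb lx vx q qv qne ql cne more \<open>c \<noteq> x\<close> by (auto simp: card_insert_if)
          fix w w' assume w: "w \<in> {l, a, p, v, b, q, x, c} - {a, b, x}" "w' \<in> {l, a, p, v, b, q, x, c} - {a, b, x}"
            "N w \<inter> {a, b, x} = N w' \<inter> {a, b, x}"
          have code: "N l \<inter> {a, b, x} = {a}" "N p \<inter> {a, b, x} = {a, b, x}" "N v \<inter> {a, b, x} = {a, b}"
            "N q \<inter> {a, b, x} = {b, x}" "N c \<inter> {a, b, x} = {x}"
            using l p v q c d by auto
          have neq: "{a} \<noteq> {a, b, x}" "{a} \<noteq> {a, b}" "{a} \<noteq> {b, x}" "{a} \<noteq> {x}" "{a, b, x} \<noteq> {a, b}" "{a, b, x} \<noteq> {b, x}"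
            "{a, b, x} \<noteq> {x}" "{a, b} \<noteq> {b, x}" "{a, b} \<noteq> {x}" "{b, x} \<noteq> {x}" using d by auto
          have "w = l \<or> w = p \<or> w = v \<or> w = q \<or> w = c" "w' = l \<or> w' = p \<or> w' = v \<or> w' = q \<or> w' = c"
            using w(1,2) by auto
          with w(3) show "w = w'" using code neq by (elim disjE) metis+
        qed (use l p v q(2) c Na Nb Nx in auto)
      next
        case A3: False
        let ?W = "{v, b}" let ?H = "del ?W E" let ?L = "nbhd ?H"
        have G': "graph (V - ?W) ?H" using G by (rule graph_del)
        have Lp: "?L p = {x, a}" using p d pv ne vx by (auto simp: nbhd_del)
        have La: "?L a = {l, p}" using Na d pv ne lb by (auto simp: nbhd_del)
        have Ll: "?L l = {a}" using l d pv ne lb by (auto simp: nbhd_del)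
        have Lq: "?L q = {x}" using q d qv qne vx by (auto simp: nbhd_del)
        have aff: "e = p \<or> e = q \<or> e = a" if "e \<notin> ?W" "N e \<inter> ?W \<noteq> {}" for e
        proof -
          have "e \<in> N v \<or> e \<in> N b" using sym that by blast
          with v Nb that(1) show ?thesis by auto
        qed
        have same: "?L e = N e" if "e \<noteq> p" "e \<noteq> q" "e \<noteq> a" "?L e \<noteq> {}" for e
          using aff[of e] that by (auto simp: nbhd_del split: if_splits)
        have leafx: "w = q" if "?L w = {x}" for w
        proof (rule ccontr)
          assume "w \<noteq> q"
          moreover have "w \<noteq> p" "w \<noteq> a" using that Lp La d pv ne by auto
          ultimately have "N w = {x}" using same[of w] that by simp
          with A3 show False by blast
        qed
        have linkx: "w = p" if "?L w = {x, a}" for w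
        proof -
          have "w \<in> ?L a" using nbhd_sym[OF G', of w a] that by simp
          moreover have "w \<noteq> l" using that Ll d by auto
          ultimately show ?thesis using La by simp
        qed
        have "tame (V - ?W) ?H"
        proof (rule tame_delI[OF tame])
          fix e assume e: "e \<in> V - ?W" "N e \<inter> ?W \<noteq> {}"
          have "inert (V - ?W) ?H q"
          proof (rule inert_leaf[OF G' Lq leafx])
            fix g h z assume gh: "?L g = {x, z}" "?L h = {x, z}"
            show "g = h"
            proof (cases "z = x")
              case True with gh leafx[of g] leafx[of h] show ?thesis by simp
            next
              case zx: False
              show ?thesis
              proof (cases "z = a")
                case True with gh linkx[of g] linkx[of h] show ?thesis by simp
              next
                case False
                have "{x, z} \<noteq> {x}" "{x, z} \<noteq> {x, a}" "{x, z} \<noteq> {l, p}"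
                  using zx False lx ne by (auto simp: doubleton_eq_iff)
                then have "g \<noteq> q" "h \<noteq> q" "g \<noteq> p" "h \<noteq> p" "g \<noteq> a" "h \<noteq> a"
                  using gh Lq Lp La by metis+
                then have "N g = {x, z}" "N h = {x, z}" using same[of g] same[of h] gh by (metis insert_not_empty)+
                then show ?thesis by (rule no_gadget)
              qed
            qed
          qed
          moreover have "inert (V - ?W) ?H p"
          proof (rule inert2[OF G' Lp _ linkx])
            show "x \<noteq> a" using d by simp
            assume "?L a = {p, x}"
            with La lx pv ne show False by (auto simp: doubleton_eq_iff)
          qed
          moreover have "inert (V - ?W) ?H a"
            by (rule inert_support[OF G' Ll]) (use La pv in simp)
          ultimately show "inert (V - ?W) ?H e" using aff[of e] e by auto
        qed
        moreover have "N v = {b, a}" using v by auto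
        ultimately show False using not_tame_deg2 by blast
      qed
    qed
  qed
qed

text \<open>Once \<open>u\<close> and \<open>v\<close> are gone, \<open>x\<close> is a leaf at
  \<open>y\<close>. Twins of degree two are already excluded, so the only danger is another leaf at
  \<open>y\<close>; then the whole triangle is deleted.\<close>

lemma no_pendant_triangle:
  assumes u: "N u = {v, x}" and v: "N v = {u, x}"
  shows False
proof -
  have uv: "u \<noteq> v" "u \<noteq> x" "v \<noteq> x" using irr[of u] irr[of v] u v by auto
  have "u \<in> N x" "v \<in> N x" using u v sym[of u x] sym[of v x] by auto
  from N2[OF uv(1) this] show False
  proof cases
    case 1 with u v no_triangle[of u v x] show False by simp
  next
    case (2 y)
    note x = 2(4)
    show False
    proof (cases "\<exists>c. N c = {y}")
      case True
      then obtain c where c: "N c = {y}" by blast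
      let ?W = "{u, v, x}" let ?H = "del ?W E"
      have G': "graph (V - ?W) ?H" using G by (rule graph_del)
      have "N c \<noteq> N u" "N c \<noteq> N v" "N c \<noteq> N x" unfolding c u v x using uv 2 by auto
      then have cW: "c \<notin> ?W" by auto
      then have Lc: "nbhd ?H c = {y}" using c 2 uv by (auto simp: nbhd_del)
      have "tame (V - ?W) ?H"
      proof (rule tame_delI[OF tame])
        fix e assume e: "e \<in> V - ?W" "N e \<inter> ?W \<noteq> {}"
        then have "e \<in> N u \<or> e \<in> N v \<or> e \<in> N x" using sym by blast
        with e u v x have "e = y" by auto
        moreover have "inert (V - ?W) ?H y"
          by (rule inert_support[OF G' Lc card_del_le2[OF G subc, of y x]]) (use x 2 in auto)
        ultimately show "inert (V - ?W) ?H e" by simp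
      qed
      then have "half (V - ?W) ?H" by (rule half_smaller) (use u v x inV[of u] inV[of v] inV[of x] in auto)
      with half_pendant_triangle_at_support[OF G u v x c] 2 no_half show False by simp
    next
      case A1: False
      let ?W = "{u, v}" let ?H = "del ?W E" let ?L = "nbhd ?H"
      have G': "graph (V - ?W) ?H" using G by (rule graph_del)
      have Lx: "?L x = {y}" using x 2 uv by (auto simp: nbhd_del)
      have aff: "e = x" if "e \<notin> ?W" "N e \<inter> ?W \<noteq> {}" for e
      proof -
        have "e \<in> N u \<or> e \<in> N v" using sym that by blast
        with u v that(1) show ?thesis by auto
      qed
      have same: "?L e = N e" if "e \<noteq> x" "?L e \<noteq> {}" for e
        using aff[of e] that by (auto simp: nbhd_del split: if_splits)
      have leafy: "w = x" if "?L w = {y}" for w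
      proof (rule ccontr)
        assume "w \<noteq> x"
        then have "N w = {y}" using same[of w] that by simp
        with A1 show False by blast
      qed
      have "tame (V - ?W) ?H"
      proof (rule tame_delI[OF tame])
        fix e assume e: "e \<in> V - ?W" "N e \<inter> ?W \<noteq> {}"
        have "inert (V - ?W) ?H x"
        proof (rule inert_leaf[OF G' Lx leafy])
          fix g h z assume gh: "?L g = {y, z}" "?L h = {y, z}"
          show "g = h"
          proof (cases "z = y")
            case True with gh leafy[of g] leafy[of h] show ?thesis by simp
          next
            case False
            then have "g \<noteq> x" "h \<noteq> x" using gh Lx by (auto simp: doubleton_eq_iff)
            then have "N g = {y, z}" "N h = {y, z}" using same[of g] same[of h] gh by (metis insert_not_empty)+
            then show ?thesis by (rule no_gadget)
          qed
        qed
        then show "inert (V - ?W) ?H e" using aff[of e] e by auto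
      qed
      then have "half (V - ?W) ?H" by (rule half_smaller) (use u v inV[of u] inV[of v] in auto)
      with half_pendant_triangle[OF G u v x] 2 no_half show False by simp
    qed
  qed
qed

section \<open>Twins of degree three\<close>

lemma twins_adjacent:
  assumes u: "N u = {x, v, z}" and u': "N u' = {x, v, z}" and uu: "u \<noteq> u'" and d: "distinct [x, v, z]"
    and xv: "x \<in> N v"
  shows False
proof -
  have i: "u \<in> N x" "u \<in> N v" "u \<in> N z" "u' \<in> N x" "u' \<in> N v" "u' \<in> N z" "v \<in> N x"
    using sym u u' xv by auto
  have ne: "u \<noteq> x" "u \<noteq> v" "u \<noteq> z" "u' \<noteq> x" "u' \<noteq> v" "u' \<noteq> z" using i irr by metis+
  have x: "N x = {u, u', v}" and v: "N v = {u, u', x}"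
    using N3[of u u' v x] N3[of u u' x v] i xv uu ne by auto
  \<comment> \<open>Only \<open>z\<close> can have a neighbour outside this set, and at most one,
    \<open>z'\<close>. The codes are taken in \<open>{u, x}\<close>, and in \<open>{u, x, z}\<close>
    if \<open>z'\<close> has to be deleted as well.\<close>
  let ?W = "{u, u', x, v, z}"
  have zx: "x \<notin> N z" using sym[of x z] x ne d by auto
  from N2[OF uu i(3,6)] show False
  proof cases
    case 1
    show False
    proof (rule not_closed[of ?W "{u, x}"])
      have cl: "N u \<subseteq> ?W" "N u' \<subseteq> ?W" "N x \<subseteq> ?W" "N v \<subseteq> ?W" "N z \<subseteq> ?W"
        unfolding u u' x v 1 by simp_all
      show "N w \<subseteq> ?W" if "w \<in> ?W" for w
        using that by (elim insertE emptyE) (simp_all only: cl)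
      show "2 * card {u, x} \<le> card ?W" using uu ne d by (auto simp: card_insert_if)
      fix w assume w: "w \<in> ?W - {u, x}"
      then have wc: "w = u' \<or> w = v \<or> w = z" by auto
      show "N w \<inter> {u, x} \<noteq> {}" using wc u' v i by auto
      fix w' assume w': "w' \<in> ?W - {u, x}" and c: "N w \<inter> {u, x} = N w' \<inter> {u, x}"
      then have wc': "w' = u' \<or> w' = v \<or> w' = z" by auto
      have m: "(u \<in> N w) = (u \<in> N w')" "(x \<in> N w) = (x \<in> N w')" using c by blast+
      have "x \<in> N u'" "u \<notin> N u'" "x \<notin> N z" using u' ne d zx by auto
      then show "w = w'" using wc wc' m i xv by metis
    qed (use u u' x v i in auto)
  next
    case (2 z')
    have zz': "z \<in> N z'" using 2 sym[of z z'] by simp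
    have z': "z' \<noteq> x" "z' \<noteq> v" using zz' x v ne d by auto
    have un: "u \<notin> N z'" "x \<notin> N z'" using sym[of u z'] sym[of x z'] u x 2 z' d by auto
    have "\<exists>B\<subseteq>{z'}. tame (V - (?W \<union> B)) (del (?W \<union> B) E)"
    proof (rule tame_del_repair[OF tame])
      show "{z'} \<subseteq> V - ?W" using inV'[of z' z] 2 z' by auto
      show "N e \<inter> ?W \<noteq> {}" if "e \<in> {z'}" for e using that zz' by auto
      fix e assume e: "e \<in> V - ?W" "N e \<inter> ?W \<noteq> {}" "e \<notin> {z'}"
      then have "e \<in> N u \<or> e \<in> N u' \<or> e \<in> N x \<or> e \<in> N v \<or> e \<in> N z" using sym by blast
      with e u u' x v 2 show "inert (V - ?W) (del ?W E) e" by auto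
    qed simp
    then obtain B where B: "B \<subseteq> {z'}" "tame (V - (?W \<union> B)) (del (?W \<union> B) E)" by blast
    from B(1) consider "B = {}" | "B = {z'}" by blast
    then show False
    proof cases
      case B0: 1
      have T: "tame (V - ?W) (del ?W E)" using B(2) unfolding B0 by simp
      show False
    proof (rule not_tame_extend[OF T, of "{u, x}"])
      show "2 * card {u, x} \<le> card ?W" using uu ne d by (auto simp: card_insert_if)
      fix w assume w: "w \<in> ?W - {u, x}"
      then have wc: "w = u' \<or> w = v \<or> w = z" by auto
      show "N w \<inter> {u, x} \<noteq> {}" using wc u' v i by auto
      show "N w \<subseteq> ?W \<or> (\<exists>d\<in>N w \<inter> {u, x}. N d \<subseteq> ?W)" using wc u u' v i by auto
      fix w' assume w': "w' \<in> ?W - {u, x}" and c: "N w \<inter> {u, x} = N w' \<inter> {u, x}"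
      then have wc': "w' = u' \<or> w' = v \<or> w' = z" by auto
      have m: "(u \<in> N w) = (u \<in> N w')" "(x \<in> N w) = (x \<in> N w')" using c by blast+
      have "x \<in> N u'" "u \<notin> N u'" "x \<notin> N z" using u' ne d zx by auto
      then show "w = w'" using wc wc' m i xv by metis
    qed (use u u' x v i in auto)
    next
      case B1: 2
      let ?X = "{u, u', x, v, z, z'}" and ?D = "{u, x, z}"
      have T: "tame (V - ?X) (del ?X E)" using B(2) unfolding B1 by (simp add: insert_commute)
      have code: "N u' \<inter> ?D = {x, z}" "N v \<inter> ?D = {u, x}" "N z' \<inter> ?D = {z}"
        using u' v zz' un ne uu d by auto
      show False
      proof (rule not_tame_extend[OF T, of ?D])
        show "2 * card ?D \<le> card ?X" using uu ne d 2 z' by (auto simp: card_insert_if)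
        fix w assume w: "w \<in> ?X - ?D"
        then have wc: "w = u' \<or> w = v \<or> w = z'" by auto
        show "N w \<inter> ?D \<noteq> {}" using wc code by auto
        show "N w \<subseteq> ?X \<or> (\<exists>d\<in>N w \<inter> ?D. N d \<subseteq> ?X)" using wc u' v 2 zz' by auto
        fix w' assume w': "w' \<in> ?X - ?D" and c: "N w \<inter> ?D = N w' \<inter> ?D"
        then have "w' = u' \<or> w' = v \<or> w' = z'" by auto
        moreover have "{x, z} \<noteq> {u, x}" "{x, z} \<noteq> {z}" "{u, x} \<noteq> {z}" using ne d by auto
        ultimately show "w = w'" using wc c code by (elim disjE) metis+
      qed (use u u' x v 2 zz' in auto)
    qed
  qed
qed

text \<open>The six vertices \<open>u\<close>, \<open>u'\<close>, \<open>x\<close>,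
  \<open>v\<close>, \<open>z\<close>, \<open>t\<close> are joined to the rest through
  \<open>z\<close> and \<open>t\<close> only, each with at most one outside neighbour. The set
  \<open>D\<close> always contains \<open>u\<close> and \<open>x\<close>; in addition it contains
  \<open>t\<close> or \<open>z\<close> so as to dominate an outside neighbour that is deleted too,
  and both if two are deleted.\<close>

lemma twins_common_nbr:
  assumes u: "N u = {x, v, z}" and u': "N u' = {x, v, z}" and uu: "u \<noteq> u'" and d: "distinct [x, v, z]"
    and adj: "x \<notin> N v" "x \<notin> N z" "v \<notin> N z" and t: "t \<in> N x" "t \<in> N v" "t \<noteq> u" "t \<noteq> u'"
  shows False
proof -
  have i: "u \<in> N x" "u \<in> N v" "u \<in> N z" "u' \<in> N x" "u' \<in> N v" "u' \<in> N z" "x \<in> N t" "v \<in> N t"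
    using sym u u' t by auto
  have ne: "u \<noteq> x" "u \<noteq> v" "u \<noteq> z" "u' \<noteq> x" "u' \<noteq> v" "u' \<noteq> z" "t \<noteq> x" "t \<noteq> v" using i irr by metis+
  have x: "N x = {u, u', t}" and v: "N v = {u, u', t}"
    using N3[of u u' t x] N3[of u u' t v] i t uu ne by auto
  have tz: "t \<noteq> z" using t(1) adj(2) sym[of x z] by auto
  have ztN: "z \<notin> N t"
  proof
    assume "z \<in> N t"
    then have "t \<in> N z" using sym by blast
    then have "N z = {u, u', t}" using N3[of u u' t z] i uu t by simp
    with no_triplets[of x v z "{u, u', t}"] x v d show False by simp
  qed
  let ?W = "{u, u', x, v, z, t}"
  let ?A = "(N z \<union> N t) - ?W"
  have "\<exists>B\<subseteq>?A. tame (V - (?W \<union> B)) (del (?W \<union> B) E)"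
  proof (rule tame_del_repair[OF tame])
    show "finite ?A" using finN by simp
    show "?A \<subseteq> V - ?W" using inV' by blast
    show "N e \<inter> ?W \<noteq> {}" if "e \<in> ?A" for e using that sym[of e z] sym[of e t] by auto
    fix e assume e: "e \<in> V - ?W" "N e \<inter> ?W \<noteq> {}" "e \<notin> ?A"
    then have "e \<in> N u \<or> e \<in> N u' \<or> e \<in> N x \<or> e \<in> N v \<or> e \<in> N z \<or> e \<in> N t" using sym by blast
    with e u u' x v show "inert (V - ?W) (del ?W E) e" by auto
  qed
  then obtain B where B: "B \<subseteq> ?A" "tame (V - (?W \<union> B)) (del (?W \<union> B) E)" by blast
  have mem: "(a \<in> N w) = (a \<in> N w')" if "N w \<inter> D = N w' \<inter> D" "a \<in> D" for a w w' D
    using that by blast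
  have nu: "u \<notin> N e" "x \<notin> N e" if "e \<in> ?A" for e
    using that sym[of u e] sym[of x e] u x by auto
  obtain Z where Z: "N z = {u, u'} \<union> Z" "Z = {} \<or> (\<exists>z'. Z = {z'} \<and> z' \<notin> ?W)"
  proof (rule N2[OF uu i(3,6)])
    assume "N z = {u, u'}" then show thesis using that[of "{}"] by simp
  next
    fix c assume c: "c \<noteq> u" "c \<noteq> u'" "c \<noteq> z" "N z = {u, u', c}"
    have "c \<noteq> x" "c \<noteq> v" "c \<noteq> t" using c(4) adj ztN sym[of z t] by auto
    with c that[of "{c}"] show thesis by auto
  qed
  have xv: "x \<noteq> v" using d by simp
  obtain T where T: "N t = {x, v} \<union> T" "T = {} \<or> (\<exists>t'. T = {t'} \<and> t' \<notin> ?W)"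
  proof (rule N2[OF xv i(7,8)])
    assume "N t = {x, v}" then show thesis using that[of "{}"] by simp
  next
    fix c assume c: "c \<noteq> x" "c \<noteq> v" "c \<noteq> t" "N t = {x, v, c}"
    have "c \<noteq> z" using c(4) ztN by auto
    moreover have "c \<noteq> u" "c \<noteq> u'" using c(4) sym[of u t] sym[of u' t] u u' ne tz by auto
    ultimately show thesis using c that[of "{c}"] by auto
  qed
  have BZT: "B \<subseteq> Z \<union> T" using B(1) Z(1) T(1) by blast
  have in_t: "t \<in> N e" if "e \<in> T" for e using that T(1) sym[of t e] by simp
  have in_z: "z \<in> N e" if "e \<in> Z" for e using that Z(1) sym[of z e] by simp
  have BW: "e \<notin> ?W" if "e \<in> B" for e using that B(1) by blast
  have nuB: "u \<notin> N e" "x \<notin> N e" if "e \<in> B" for e using nu[of e] that B(1) by blast+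
  have Tne: "N e \<noteq> {}" if "e \<in> ?W \<union> B" for e using that u u' x v Z(1) T(1) BZT in_t[of e] in_z[of e] by auto
  have cW: "card ?W = 6" using uu ne d tz t by (auto simp: card_insert_if)
  have finB: "finite B" by (rule finite_subset[OF B(1)]) (simp add: finN)
  have "?W \<inter> B = {}" using BW by blast
  from card_Un_disjoint[OF _ finB this] have cWB: "card (?W \<union> B) = 6 + card B" unfolding cW by simp
  show False
  \<comment> \<open>The outside neighbours of \<open>z\<close> and \<open>t\<close> may coincide; if
    that vertex is deleted, it is treated as the one of \<open>z\<close>.\<close>
  proof (cases "Z \<subseteq> B \<and> Z \<noteq> {}")
    case False
    then have BT: "B \<subseteq> T" using BZT Z(2) by auto
    let ?D = "{u, x, t}"
    show False
    proof (rule not_tame_extend[OF B(2), of ?D])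
      show "2 * card ?D \<le> card (?W \<union> B)" using cWB ne t by simp
      fix w assume w: "w \<in> ?W \<union> B - ?D"
      then have wc: "w = u' \<or> w = v \<or> w = z \<or> w \<in> B" by blast
      have tB: "t \<in> N w" if "w \<in> B" using that BT in_t by blast
      show "N w \<inter> ?D \<noteq> {}" using wc u' v Z(1) tB by auto
      show "N w \<subseteq> ?W \<union> B \<or> (\<exists>d\<in>N w \<inter> ?D. N d \<subseteq> ?W \<union> B)"
      proof (cases "w \<in> B")
        case True
        then have "T \<subseteq> B" using BT T(2) by auto
        then have "N t \<subseteq> ?W \<union> B" using T(1) by blast
        with tB True show ?thesis by blast
      next
        case False
        then show ?thesis using wc u u' v Z(1) by auto
      qed
      fix w' assume w': "w' \<in> ?W \<union> B - ?D" and c: "N w \<inter> ?D = N w' \<inter> ?D"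
      then have wc': "w' = u' \<or> w' = v \<or> w' = z \<or> w' \<in> B" by blast
      have tB': "t \<in> N w'" if "w' \<in> B" using that BT in_t by blast
      have m: "(u \<in> N w) = (u \<in> N w')" "(x \<in> N w) = (x \<in> N w')" "(t \<in> N w) = (t \<in> N w')"
        using mem[OF c] by auto
      have f: "x \<in> N u'" "u \<notin> N u'" "t \<notin> N u'" "u \<in> N v" "x \<notin> N v" "t \<in> N v" "u \<in> N z" "x \<notin> N z" "t \<notin> N z"
        using u' v uu ne d tz adj ztN sym[of z t] i by auto
      have BB: "w = w'" if "w \<in> B" "w' \<in> B" using that BT T(2) by auto
      show "w = w'" using wc wc' m f BB tB tB' nuB by metis
    qed (use Tne in auto)
  next
    case True
    then obtain z' where z': "Z = {z'}" "z' \<in> B" "z' \<notin> ?W" using Z(2) by auto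
    show False
    proof (cases "B \<subseteq> {z'}")
      case True
      then have Bz: "B = {z'}" using z' by blast
      let ?D = "{u, x, z}"
      show False
      proof (rule not_tame_extend[OF B(2), of ?D])
        show "2 * card ?D \<le> card (?W \<union> B)" using cWB ne d by simp
        fix w assume w: "w \<in> ?W \<union> B - ?D"
        then have wc: "w = u' \<or> w = v \<or> w = t \<or> w = z'" using Bz by blast
        have zz': "z \<in> N z'" using in_z z' by simp
        show "N w \<inter> ?D \<noteq> {}" using wc u' v i zz' by auto
        have Nz: "N z \<subseteq> ?W \<union> B" using Z(1) z' by auto
        have Nx: "N x \<subseteq> ?W \<union> B" using x by auto
        show "N w \<subseteq> ?W \<union> B \<or> (\<exists>d\<in>N w \<inter> ?D. N d \<subseteq> ?W \<union> B)"
          using wc u u' v i zz' Nz Nx by auto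
        fix w' assume w': "w' \<in> ?W \<union> B - ?D" and c: "N w \<inter> ?D = N w' \<inter> ?D"
        then have wc': "w' = u' \<or> w' = v \<or> w' = t \<or> w' = z'" using Bz by blast
        have m: "(u \<in> N w) = (u \<in> N w')" "(x \<in> N w) = (x \<in> N w')" "(z \<in> N w) = (z \<in> N w')"
          using mem[OF c] by auto
        have f: "x \<in> N u'" "z \<in> N u'" "u \<in> N v" "u \<notin> N u'" "x \<in> N t" "z \<notin> N t" "u \<notin> N t" "z \<in> N z'" "x \<notin> N z'" "u \<notin> N z'"
          using u' uu ne i ztN sym[of u t] u tz zz' nuB[OF z'(2)] by auto
        show "w = w'" using wc wc' m f by metis
      qed (use Tne in auto)
    next
      case False
      then obtain t' where t': "T = {t'}" "t' \<in> B" "t' \<noteq> z'" using BZT z'(1) T(2) by auto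
      then have Bzt: "B = {z', t'}" using BZT z' by auto
      have cB: "card B = 2" unfolding Bzt using t'(3) by simp
      let ?D = "{u, x, z, t}"
      show False
      proof (rule not_tame_extend[OF B(2), of ?D])
        show "2 * card ?D \<le> card (?W \<union> B)" using cWB cB ne d t tz by simp
        fix w assume w: "w \<in> ?W \<union> B - ?D"
        then have wc: "w = u' \<or> w = v \<or> w = t' \<or> w = z'" using Bzt by blast
        have zz': "z \<in> N z'" "t \<in> N t'" using in_z in_t z' t' by auto
        show "N w \<inter> ?D \<noteq> {}" using wc u' v i zz' by auto
        have Nz: "N z \<subseteq> ?W \<union> B" using Z(1) z' by auto
        have Nt: "N t \<subseteq> ?W \<union> B" using T(1) t' by auto
        show "N w \<subseteq> ?W \<union> B \<or> (\<exists>d\<in>N w \<inter> ?D. N d \<subseteq> ?W \<union> B)"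
          using wc u' v zz' Nz Nt by auto
        fix w' assume w': "w' \<in> ?W \<union> B - ?D" and c: "N w \<inter> ?D = N w' \<inter> ?D"
        then have wc': "w' = u' \<or> w' = v \<or> w' = t' \<or> w' = z'" using Bzt by blast
        have m: "(u \<in> N w) = (u \<in> N w')" "(x \<in> N w) = (x \<in> N w')" "(z \<in> N w) = (z \<in> N w')"
          using mem[OF c] by auto
        have t'z: "z \<notin> N t'"
        proof
          assume "z \<in> N t'"
          then have "t' \<in> N z" using sym by blast
          with Z(1) z' t'(3) BW[OF t'(2)] show False by auto
        qed
        have f: "x \<in> N u'" "u \<in> N v" "u \<notin> N u'" "x \<notin> N z'" "u \<notin> N z'" "x \<notin> N t'" "u \<notin> N t'"
          using u' uu ne i nuB[OF z'(2)] nuB[OF t'(2)] by auto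
        show "w = w'" using wc wc' m f zz' t'z by metis
      qed (use Tne in auto)
    qed
  qed
qed

text \<open>Both squares on the edge \<open>u'x\<close> demanded by \<open>not_tame_edge\<close>
  would have to pass through \<open>u\<close>, so deleting \<open>u'\<close> and \<open>x\<close>
  cannot be tame. All affected vertices except a third neighbour of \<open>x\<close> turn out inert;
  hence that neighbour exists and must be deleted as well.\<close>

lemma twins_tail:
  assumes u: "N u = {x, v, z}" and u': "N u' = {x, v, z}" and uu: "u \<noteq> u'" and d: "distinct [x, v, z]"
    and adj: "x \<notin> N v" "x \<notin> N z" "v \<notin> N z"
    and com: "\<And>c. c \<in> N x \<Longrightarrow> c \<in> N v \<Longrightarrow> c = u \<or> c = u'" "\<And>c. c \<in> N x \<Longrightarrow> c \<in> N z \<Longrightarrow> c = u \<or> c = u'"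
      "\<And>c. c \<in> N v \<Longrightarrow> c \<in> N z \<Longrightarrow> c = u \<or> c = u'"
  obtains x' where "N x = {u, u', x'}" "x' \<notin> {u, u', x, v, z}" "tame (V - {u', x, x'}) (del {u', x, x'} E)"
proof -
  let ?W = "{u', x}" let ?H = "del ?W E" let ?L = "nbhd ?H"
  have G': "graph (V - ?W) ?H" using G by (rule graph_del)
  have i: "u \<in> N x" "u \<in> N v" "u \<in> N z" "u' \<in> N x" "u' \<in> N v" "u' \<in> N z"
    using sym u u' by auto
  have ne: "u \<noteq> x" "u \<noteq> v" "u \<noteq> z" "u' \<noteq> x" "u' \<noteq> v" "u' \<noteq> z" using i irr by metis+
  have adj': "v \<notin> N x" "z \<notin> N x" "z \<notin> N v" using adj sym by auto
  have Lu: "?L u = {v, z}" using u uu ne d by (auto simp: nbhd_del)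
  have Lv: "?L v = N v - {u'}" "?L z = N z - {u'}" using ne d adj by (auto simp: nbhd_del)
  \<comment> \<open>If they were equal, \<open>v\<close> and \<open>z\<close> would have only common
    neighbours, that is \<open>u\<close> and \<open>u'\<close>, and would be twins of degree
    two.\<close>
  have Lvz: "?L v \<noteq> ?L z"
  proof
    assume "?L v = ?L z"
    then have eq: "N v = N z" using Lv i by blast
    then have "c = u \<or> c = u'" if "c \<in> N v" for c using com(3)[of c] that by simp
    then have "N v = {u, u'}" using i by blast
    with no_gadget[of v u u' z] eq d show False by simp
  qed
  have near: "w = v \<or> w = z" if "u \<in> ?L w" for w
    using nbhd_sym[OF G', of u w] that Lu by simp
  \<comment> \<open>In the smaller graph \<open>v\<close> and \<open>z\<close> are the only
    neighbours of \<open>u\<close> and have different neighbourhoods, so neither has a twin.\<close>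
  have side: "inert (V - ?W) ?H a" if ab: "a = v \<and> b = z \<or> a = z \<and> b = v" for a b
  proof -
    have La: "?L a = N a - {u'}" and Lab: "?L a \<noteq> ?L b" and ia: "u \<in> N a" "u' \<in> N a" and ba: "b \<notin> N a"
      and nr: "\<And>w. u \<in> ?L w \<Longrightarrow> w = a \<or> w = b" and Lu': "?L u = {a, b}"
      using ab Lv Lvz i adj adj' near Lu by auto
    have only: "w = a" if "?L w = ?L a" for w
    proof -
      have "u \<in> ?L w" using that La ia uu by auto
      with nr[of w] that Lab show ?thesis by auto
    qed
    from N2[OF uu ia] show ?thesis
    proof cases
      case 1
      then have La1: "?L a = {u}" using La uu by auto
      show ?thesis
      proof (rule inert_leaf[OF G' La1])
        show "w = a" if "?L w = {u}" for w using only[of w] La1 that by simp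
        fix g h q assume gh: "?L g = {u, q}" "?L h = {u, q}"
        then have gh': "g = a \<or> g = b" "h = a \<or> h = b" using nr[of g] nr[of h] by auto
        show "g = h"
        proof (rule ccontr)
          assume "g \<noteq> h"
          with gh' gh Lab show False by auto
        qed
      qed
    next
      case (2 c)
      then have La2: "?L a = {u, c}" using La uu by auto
      show ?thesis
      proof (rule inert2[OF G' La2])
        show "u \<noteq> c" using 2 by simp
        show "w = a" if "?L w = {u, c}" for w using only[of w] La2 that by simp
        assume "?L u = {a, c}"
        then have "b = c" using Lu' 2 d ab by (auto simp: doubleton_eq_iff)
        with ba 2 show False by simp
      qed
    qed
  qed
  have u_inert: "inert (V - ?W) ?H u"
  proof (rule inert2[OF G' Lu])
    show "v \<noteq> z" using d by simp
    fix w assume w: "?L w = {v, z}"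
    then have "v \<in> ?L w" "z \<in> ?L w" by auto
    then have "v \<in> N w" "z \<in> N w" "w \<noteq> u'" by (auto simp: nbhd_del split: if_splits)
    then show "w = u" using com(3)[of w] sym by blast
  next
    assume "?L v = {u, z}"
    then have "z \<in> ?L v" by simp
    then have "z \<in> N v" by (simp add: nbhd_del split: if_splits)
    with adj' show False by simp
  qed
  have v_inert: "inert (V - ?W) ?H v" "inert (V - ?W) ?H z" using side[of v z] side[of z v] by simp_all
  have aff: "e = u \<or> e = v \<or> e = z \<or> e \<in> N x" if "e \<in> V - ?W" "N e \<inter> ?W \<noteq> {}" for e
  proof -
    have "e \<in> N u' \<or> e \<in> N x" using sym that by blast
    with u' that(1) show ?thesis by auto
  qed
  have nt: "tame (V - ?W) ?H \<Longrightarrow> False"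
  proof (rule not_tame_edge[of x u'])
    show "x \<in> N u'" using u' by simp
    fix y w t s assume *: "y \<in> N u'" "w \<in> N u'" "distinct [x, y, w]" "t \<in> N x" "s \<in> N x" "distinct [u', t, s]" "t \<in> N w" "s \<in> N y"
    have yw: "y = v \<or> y = z" "w = v \<or> w = z" using * u' by auto
    have "s = u" using yw(1) com(1,2)[of s] * by auto
    moreover have "t = u" using yw(2) com(1,2)[of t] * by auto
    ultimately show False using * by simp
  qed
  have "N x \<noteq> {u, u'}"
  proof
    assume Nx: "N x = {u, u'}"
    have "tame (V - ?W) ?H"
    proof (rule tame_delI[OF tame])
      fix e assume e: "e \<in> V - ?W" "N e \<inter> ?W \<noteq> {}"
      from aff[OF this] Nx e have "e = u \<or> e = v \<or> e = z" by auto
      then show "inert (V - ?W) ?H e" using v_inert u_inert by auto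
    qed
    with nt show False by simp
  qed
  then obtain x' where x': "x' \<noteq> u" "x' \<noteq> u'" "x' \<noteq> x" "N x = {u, u', x'}"
    using N2[OF uu i(1,4)] by metis
  have x'ne: "x' \<notin> {u, u', x, v, z}" using x' adj' by auto
  have "\<exists>B\<subseteq>{x'}. tame (V - (?W \<union> B)) (del (?W \<union> B) E)"
  proof (rule tame_del_repair[OF tame])
    show "{x'} \<subseteq> V - ?W" using x' inV'[of x' x] by simp
    show "N e \<inter> ?W \<noteq> {}" if "e \<in> {x'}" for e using that x'(4) sym[of x x'] by auto
    fix e assume e: "e \<in> V - ?W" "N e \<inter> ?W \<noteq> {}" "e \<notin> {x'}"
    from aff[OF e(1,2)] x' e have "e = u \<or> e = v \<or> e = z" by auto
    then show "inert (V - ?W) ?H e" using v_inert u_inert by auto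
  qed simp
  then obtain B where B: "B \<subseteq> {x'}" "tame (V - (?W \<union> B)) (del (?W \<union> B) E)" by blast
  have "B \<noteq> {}" using B(2) nt by auto
  then have "B = {x'}" using B(1) by blast
  then have "tame (V - {u', x, x'}) (del {u', x, x'} E)" using B(2) by (simp add: insert_commute)
  with that x' x'ne show thesis by blast
qed

text \<open>What is left is the case where \<open>x\<close>, \<open>v\<close>, \<open>z\<close> have
  distinct private tails \<open>x'\<close>, \<open>v'\<close>, \<open>z'\<close>. Starting from the
  tame graph without \<open>u'\<close>, \<open>x\<close>, \<open>x'\<close>, the further deletion of
  \<open>u\<close>, \<open>v\<close>, \<open>z\<close> affects only \<open>v'\<close> and
  \<open>z'\<close>. So six, seven or eight vertices are deleted, and \<open>D\<close> depends on
  which tails are among them.\<close>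

lemma no_twins3:
  assumes u: "N u = {x, v, z}" and u': "N u' = {x, v, z}" and d: "distinct [x, v, z]"
  shows "u = u'"
proof (rule ccontr)
  assume uu: "u \<noteq> u'"
  have p1: "N u = {v, z, x}" "N u' = {v, z, x}" and p2: "N u = {z, x, v}" "N u' = {z, x, v}" using u u' by auto
  have d': "distinct [v, z, x]" "distinct [z, x, v]" "distinct [x, z, v]" using d by auto
  have adj: "x \<notin> N v" "v \<notin> N z" "z \<notin> N x"
    using twins_adjacent[OF u u' uu d] twins_adjacent[OF p1 uu d'(1)] twins_adjacent[OF p2 uu d'(2)] by blast+
  have adj': "v \<notin> N x" "z \<notin> N v" "x \<notin> N z" using adj sym by auto
  have com: "c = u \<or> c = u'" if "c \<in> N x" "c \<in> N v" for c
    using twins_common_nbr[OF u u' uu d adj(1) adj'(3) adj(2)] that by blast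
  have com1: "c = u \<or> c = u'" if "c \<in> N v" "c \<in> N z" for c
    using twins_common_nbr[OF p1 uu d'(1) adj(2) adj'(1) adj(3)] that by blast
  have com2: "c = u \<or> c = u'" if "c \<in> N z" "c \<in> N x" for c
    using twins_common_nbr[OF p2 uu d'(2) adj(3) adj'(2) adj(1)] that by blast
  obtain x' where x': "N x = {u, u', x'}" "x' \<notin> {u, u', x, v, z}" "tame (V - {u', x, x'}) (del {u', x, x'} E)"
    by (rule twins_tail[OF u u' uu d adj(1) adj'(3) adj(2)]) (use com com1 com2 in blast)+
  obtain v' where v': "N v = {u, u', v'}" "v' \<notin> {u, u', x, v, z}"
    by (rule twins_tail[OF p1 uu d'(1) adj(2) adj'(1) adj(3)]) (use com com1 com2 in blast)+
  obtain z' where z': "N z = {u, u', z'}" "z' \<notin> {u, u', x, v, z}"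
    by (rule twins_tail[OF p2 uu d'(2) adj(3) adj'(2) adj(1)]) (use com com1 com2 in blast)+
  have ne3: "x' \<noteq> v'" "x' \<noteq> z'" "v' \<noteq> z'"
    using com[of x'] com1[of v'] com2[of z'] x' v' z' by auto
  have i: "u \<in> N x" "u \<in> N v" "u \<in> N z" "u' \<in> N x" "u' \<in> N v" "u' \<in> N z" "x \<in> N x'" "v \<in> N v'" "z \<in> N z'"
    using x' v' z' sym by auto
  have ne: "u \<noteq> x" "u \<noteq> v" "u \<noteq> z" "u' \<noteq> x" "u' \<noteq> v" "u' \<noteq> z" using i irr by metis+
  let ?V1 = "V - {u', x, x'}" let ?E1 = "del {u', x, x'} E" let ?W = "{u, v, z}"
  have "\<exists>B\<subseteq>{v', z'}. tame (?V1 - (?W \<union> B)) (del (?W \<union> B) ?E1)"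
  proof (rule tame_del_repair[OF x'(3)])
    show "{v', z'} \<subseteq> ?V1 - ?W" using v' z' ne3 inV'[of v' v] inV'[of z' z] by auto
    show "nbhd ?E1 e \<inter> ?W \<noteq> {}" if "e \<in> {v', z'}" for e
      using that v' z' ne3 i ne d x'(2) by (auto simp: nbhd_del)
    fix e assume e: "e \<in> ?V1 - ?W" "nbhd ?E1 e \<inter> ?W \<noteq> {}" "e \<notin> {v', z'}"
    then have "u \<in> N e \<or> v \<in> N e \<or> z \<in> N e" by (auto simp: nbhd_del split: if_splits)
    then have "e \<in> N u \<or> e \<in> N v \<or> e \<in> N z" using sym by blast
    with e u v'(1) z'(1) show "inert (?V1 - ?W) (del ?W ?E1) e" by auto
  qed simp
  then obtain B where B: "B \<subseteq> {v', z'}" "tame (?V1 - (?W \<union> B)) (del (?W \<union> B) ?E1)" by blast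
  let ?X = "{u, u', x, v, z, x'} \<union> B"
  have eq: "?V1 - (?W \<union> B) = V - ?X" "del (?W \<union> B) ?E1 = del ?X E"
    by (auto simp: del_del intro: arg_cong2[where f = del])
  note T = B(2)[unfolded eq]
  have BX: "e \<notin> {u, u', x, v, z, x'}" if "e \<in> B" for e using that B(1) v'(2) z'(2) ne3 by auto
  have "card {u, u', x, v, z, x'} = 6" using uu ne d x'(2) by (auto simp: card_insert_if)
  moreover have finB: "finite B" using B(1) finite_subset by blast
  moreover have "{u, u', x, v, z, x'} \<inter> B = {}" using BX by blast
  ultimately have cX: "card ?X = 6 + card B" using card_Un_disjoint[of "{u, u', x, v, z, x'}" B] by simp
  have mem: "(a \<in> N w) = (a \<in> N w')" if "N w \<inter> D = N w' \<inter> D" "a \<in> D" for a w w' D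
    using that by blast
  have Xne: "N e \<noteq> {}" if "e \<in> ?X" for e
  proof -
    have "N u \<noteq> {}" "N u' \<noteq> {}" unfolding u u' by simp_all
    moreover have "N x \<noteq> {}" "N v \<noteq> {}" "N z \<noteq> {}" "N x' \<noteq> {}" "N v' \<noteq> {}" "N z' \<noteq> {}" using i by blast+
    ultimately show ?thesis using that B(1) by blast
  qed
  have un: "u \<notin> N x'" "u \<notin> N v'" "u \<notin> N z'" "u' \<notin> N x'" "u' \<notin> N v'" "u' \<notin> N z'"
  proof -
    have "x' \<notin> N u" "v' \<notin> N u" "z' \<notin> N u" "x' \<notin> N u'" "v' \<notin> N u'" "z' \<notin> N u'"
      unfolding u u' using x'(2) v'(2) z'(2) by auto
    then show "u \<notin> N x'" "u \<notin> N v'" "u \<notin> N z'" "u' \<notin> N x'" "u' \<notin> N v'" "u' \<notin> N z'"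
      using sym by blast+
  qed
  have tn: "v \<notin> N x'" "z \<notin> N x'" "x \<notin> N v'" "z \<notin> N v'" "x \<notin> N z'" "v \<notin> N z'"
  proof -
    have "x' \<notin> N v" "x' \<notin> N z" "v' \<notin> N x" "v' \<notin> N z" "z' \<notin> N x" "z' \<notin> N v"
      unfolding x'(1) v'(1) z'(1) using x'(2) v'(2) z'(2) ne3 by auto
    then show "v \<notin> N x'" "z \<notin> N x'" "x \<notin> N v'" "z \<notin> N v'" "x \<notin> N z'" "v \<notin> N z'"
      using sym by blast+
  qed
  have Nx: "N x \<subseteq> ?X" using x' by auto
  show False
  proof (cases "z' \<in> B")
    case False
    let ?D = "{u, x, v}"
    show False
    proof (rule not_tame_extend[OF T, of ?D])
      show "2 * card ?D \<le> card ?X" using cX ne d by simp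
      fix w assume w: "w \<in> ?X - ?D"
      then have wc: "w = u' \<or> w = z \<or> w = x' \<or> w = v' \<and> v' \<in> B" using B(1) False by blast
      show "N w \<inter> ?D \<noteq> {}" using wc u' i by auto
      have Nv: "N v \<subseteq> ?X" if "v' \<in> B" using that v' by auto
      show "N w \<subseteq> ?X \<or> (\<exists>d\<in>N w \<inter> ?D. N d \<subseteq> ?X)" using wc u u' i Nx Nv by auto
      fix w' assume w': "w' \<in> ?X - ?D" and c: "N w \<inter> ?D = N w' \<inter> ?D"
      then have wc': "w' = u' \<or> w' = z \<or> w' = x' \<or> w' = v' \<and> v' \<in> B" using B(1) False by blast
      have m: "(u \<in> N w) = (u \<in> N w')" "(x \<in> N w) = (x \<in> N w')" "(v \<in> N w) = (v \<in> N w')"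
        using mem[OF c] by auto
      have "x \<in> N u'" "v \<in> N u'" "u \<notin> N u'" using u' ne uu by auto
      then show "w = w'" using wc wc' m i un tn by metis
    qed (use Xne in auto)
  next
    case zB: True
    have Nz: "N z \<subseteq> ?X" using zB z' by auto
    show False
    proof (cases "v' \<in> B")
      case False
      let ?D = "{u, x, z}"
      show False
      proof (rule not_tame_extend[OF T, of ?D])
        show "2 * card ?D \<le> card ?X" using cX ne d by simp
        fix w assume w: "w \<in> ?X - ?D"
        then have wc: "w = u' \<or> w = v \<or> w = x' \<or> w = z'" using B(1) False by blast
        show "N w \<inter> ?D \<noteq> {}" using wc u' i by auto
        show "N w \<subseteq> ?X \<or> (\<exists>d\<in>N w \<inter> ?D. N d \<subseteq> ?X)" using wc u u' i Nx Nz by auto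
        fix w' assume w': "w' \<in> ?X - ?D" and c: "N w \<inter> ?D = N w' \<inter> ?D"
        then have wc': "w' = u' \<or> w' = v \<or> w' = x' \<or> w' = z'" using B(1) False by blast
        have m: "(u \<in> N w) = (u \<in> N w')" "(x \<in> N w) = (x \<in> N w')" "(z \<in> N w) = (z \<in> N w')"
          using mem[OF c] by auto
        have "x \<in> N u'" "z \<in> N u'" "u \<notin> N u'" using u' ne uu by auto
        then show "w = w'" using wc wc' m i un tn by metis
      qed (use Xne in auto)
    next
      case True
      have Bvz: "B = {v', z'}" using B(1) True zB by blast
      have cB: "card B = 2" unfolding Bvz using ne3 by simp
      \<comment> \<open>Eight vertices allow a fourth element, and the tail \<open>z'\<close> itself
        is taken: \<open>u\<close> then tells \<open>z\<close> from the others, and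
        \<open>x\<close>, \<open>v\<close> separate \<open>u'\<close>, \<open>x'\<close> and
        \<open>v'\<close>.\<close>
      let ?D = "{u, x, v, z'}"
      have Nv: "N v \<subseteq> ?X" using True v' by auto
      show False
      proof (rule not_tame_extend[OF T, of ?D])
        show "2 * card ?D \<le> card ?X" using cX cB ne d z'(2) by (auto simp: card_insert_if)
        show "?D \<subseteq> ?X" using zB by auto
        fix w assume w: "w \<in> ?X - ?D"
        then have wc: "w = u' \<or> w = z \<or> w = x' \<or> w = v'" using Bvz by blast
        show "N w \<inter> ?D \<noteq> {}" using wc u' i by auto
        show "N w \<subseteq> ?X \<or> (\<exists>d\<in>N w \<inter> ?D. N d \<subseteq> ?X)" using wc u u' i Nx Nv by auto
        fix w' assume w': "w' \<in> ?X - ?D" and c: "N w \<inter> ?D = N w' \<inter> ?D"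
        then have wc': "w' = u' \<or> w' = z \<or> w' = x' \<or> w' = v'" using Bvz by blast
        have m: "(u \<in> N w) = (u \<in> N w')" "(x \<in> N w) = (x \<in> N w')" "(v \<in> N w) = (v \<in> N w')"
          using mem[OF c] by auto
        have "x \<in> N u'" "v \<in> N u'" "u \<notin> N u'" using u' ne uu by auto
        then show "w = w'" using wc wc' m i un tn by metis
      qed (use Xne in auto)
    qed
  qed
qed

end

subsection \<open>Leaves\<close>

lemma inert_degree2:
  assumes G: "graph V E" and a: "nbhd E a = {b, c}" "b \<noteq> c"
    and 1: "\<And>v l. v \<noteq> a \<Longrightarrow> nbhd E v = {b, c} \<Longrightarrow> nbhd E l = {b} \<or> nbhd E l = {c} \<Longrightarrow> False"
    and 2: "\<And>v w. v \<noteq> w \<Longrightarrow> v \<noteq> a \<Longrightarrow> w \<noteq> a \<Longrightarrow> nbhd E v = {b, c} \<Longrightarrow> nbhd E w = {b, c} \<Longrightarrow> False"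
    and 3: "nbhd E b = {a, c} \<Longrightarrow> nbhd E c = {a, b} \<Longrightarrow> False"
  shows "inert V E a"
proof (rule inertI)
  show "nbhd E a \<noteq> {}" using a by auto
next
  fix x v assume *: "nbhd E a = {x}" "nbhd E v = {x}"
  with a show False by (auto simp: doubleton_eq_iff)
next
  fix y assume "nbhd E a = {y}"
  with a show False by (auto simp: doubleton_eq_iff)
next
  fix l y z v assume *: "nbhd E l = {y}" "nbhd E a = {y, z}" "nbhd E v = {y, z}" "v \<noteq> a"
  then have "y = b \<or> y = c" using a by (auto simp: doubleton_eq_iff)
  with 1[of v l] * a show False by auto
next
  fix b' c' assume *: "nbhd E a = {b', c'}" "nbhd E b' = {a, c'}" "nbhd E c' = {a, b'}"
  then consider "b' = b" "c' = c" | "b' = c" "c' = b" using a by (auto simp: doubleton_eq_iff)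
  then show False by cases (use * 3 in simp_all)
next
  fix b' c' d assume "nbhd E a = {b', c', d}" "nbhd E b' = {a, c', d}" "nbhd E c' = {a, b', d}" "nbhd E d = {a, b', c'}"
  from tetra_card[OF G this] a show False by (simp add: card_insert_if split: if_splits)
next
  fix v w assume *: "nbhd E v = nbhd E a" "nbhd E w = nbhd E a" "distinct [a, v, w]"
  then have ne: "v \<noteq> w" "v \<noteq> a" "w \<noteq> a" by auto
  from 2[OF ne] * a show False by simp
qed

context mincex begin

text \<open>After the deletion a vertex other than \<open>p\<close> is unchanged, supports a leaf,
  or has lost exactly \<open>x\<close>. A vertex that supports a leaf shares its neighbourhood with
  no other, and two vertices that lost \<open>x\<close> and became equal were twins before. There
  remain pairs of an unchanged vertex and one that lost \<open>x\<close>, and \<open>nolink\<close>,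
  \<open>F4\<close>, \<open>K3\<close> and the earlier lemmas exclude the violations in which these
  occur.\<close>

lemma inert_affected:
  assumes x: "x \<in> W" and p: "p \<notin> W" "N p \<inter> W = {x}" "N p \<noteq> {x}"
    and nolink: "\<And>b l. N p = {x, b} \<Longrightarrow> N l = {b} \<Longrightarrow> False"
    and aff: "\<And>e. e \<notin> W \<Longrightarrow> N e \<inter> W \<noteq> {} \<Longrightarrow> e \<noteq> p \<Longrightarrow> (\<exists>l. N l = {e} \<and> l \<notin> W) \<or> N e \<inter> W = {x}"
    and F4: "\<And>p q b z h. N p = {x, b} \<Longrightarrow> N q = {x, b, z} \<Longrightarrow> N h = {b, z} \<Longrightarrow> distinct [x, b, z] \<Longrightarrow> False"
    and K3: "\<And>p q c. N p = {x, q, c} \<Longrightarrow> N q = {x, p, c} \<Longrightarrow> N c = {p, q} \<Longrightarrow> False"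
  shows "inert (V - W) (del W E) p"
proof -
  let ?L = "nbhd (del W E)"
  have G': "graph (V - W) (del W E)" using G by (rule graph_del)
  have xp: "x \<in> N p" "p \<in> N x" using p(2) sym[of x p] by blast+
  have Lp: "?L p = N p - {x}" using p by (auto simp: nbhd_del)
  have inL: "a \<in> N b" if "a \<in> ?L b" for a b using that by (simp add: nbhd_del split: if_splits)
  have cases: "?L e = N e \<or> (\<exists>l. N l = {e} \<and> ?L l = {e}) \<or> N e = insert x (?L e) \<and> x \<notin> ?L e" if "?L e \<noteq> {}" "e \<noteq> p" for e
  proof -
    have eW: "e \<notin> W" using that(1) by (auto simp: nbhd_del)
    then have Le: "?L e = N e - W" by (simp add: nbhd_del)
    show ?thesis
    proof (cases "N e \<inter> W = {}")
      case True then show ?thesis using Le by auto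
    next
      case False
      from aff[OF eW this that(2)] show ?thesis
      proof
        assume "\<exists>l. N l = {e} \<and> l \<notin> W"
        then obtain l where "N l = {e}" "l \<notin> W" by blast
        then have "N l = {e} \<and> ?L l = {e}" using eW by (auto simp: nbhd_del)
        then show ?thesis by blast
      next
        assume "N e \<inter> W = {x}"
        then have "N e = insert x (?L e)" "x \<notin> ?L e" using Le x by auto
        then show ?thesis by blast
      qed
    qed
  qed
  have supp: "h = e" if "N l = {e}" "?L l = {e}" "?L h = ?L e" for l e h
  proof -
    have "e \<in> ?L l" using that by simp
    then have "l \<in> ?L e" using nbhd_sym[OF G', of e l] by simp
    then have "l \<in> N h" using that(3) inL by auto
    then show ?thesis using sym[of l h] that(1) by simp
  qed
  have suppin: "l \<in> ?L e" if "?L l = {e}" for l e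
    using nbhd_sym[OF G', of e l] that by simp
  from N1[OF xp(1)] show ?thesis
  proof cases
    case 1 with p(3) show ?thesis by simp
  next
    case (2 b)
    have Lp1: "?L p = {b}" using Lp 2 by auto
    have one: "y = p" if y: "?L y = {b}" for y
    proof (rule ccontr)
      assume yp: "y \<noteq> p"
      from cases[OF _ yp] y consider "N y = {b}" | l where "N l = {y}" "?L l = {y}" | "N y = {x, b}" by auto
      then show False
      proof cases
        case 1 with nolink 2 show False by blast
      next
        case (2 l)
        from supp[OF this, of p] Lp1 y yp show False by simp
      next
        case 3
        have "y = p" by (rule no_gadget[OF 3 2(3)])
        with yp show False ..
      qed
    qed
    show ?thesis
    proof (rule inert_leaf[OF G' Lp1 one])
      fix g h z assume gh: "?L g = {b, z}" "?L h = {b, z}"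
      show "g = h"
      proof (cases "z = b")
        case True
        with gh have "?L g = {b}" "?L h = {b}" by simp_all
        from one[OF this(1)] one[OF this(2)] show ?thesis by simp
      next
        case zb: False
        have gp: "g \<noteq> p" "h \<noteq> p" using gh Lp1 zb by (auto simp: doubleton_eq_iff)
        have Lgh: "?L g = ?L h" "?L h = ?L g" using gh by simp_all
        from cases[of g] gh gp consider "N g = {b, z}" | "g = h" | "N g = {x, b, z}" "x \<notin> {b, z}"
          using supp[OF _ _ Lgh(2)] by auto
        then show ?thesis
        proof cases
          case g1: 1
          from cases[of h] gh gp consider "N h = {b, z}" | "g = h" | "N h = {x, b, z}" "x \<notin> {b, z}"
            using supp[OF _ _ Lgh(1)] by auto
          then show ?thesis
          proof cases
            case 1 show ?thesis by (rule no_gadget[OF g1 1])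
          next
            case h3: 3
            have "distinct [x, b, z]" using h3 zb by auto
            from F4[OF 2(3) h3(1) g1 this] show ?thesis ..
          qed
        next
          case g3: 3
          have d: "distinct [x, b, z]" using g3 zb by auto
          from cases[of h] gh gp consider "N h = {b, z}" | "g = h" | "N h = {x, b, z}" "x \<notin> {b, z}"
            using supp[OF _ _ Lgh(1)] by auto
          then show ?thesis
          proof cases
            case 1 from F4[OF 2(3) g3(1) 1 d] show ?thesis ..
          next
            case 3 show ?thesis by (rule no_twins3[OF g3(1) 3(1) d])
          qed
        qed
      qed
    qed
  next
    case (3 b c)
    have Lp2: "?L p = {b, c}" using Lp 3 by auto
    have d: "distinct [x, b, c]" using 3 by auto
    have bc: "b \<in> N p" "c \<in> N p" using 3 by auto
    have no_leaf_p: "N p \<noteq> {e}" for e unfolding 3(6) using d by auto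
    have two: "N v = {b, c}" if v: "?L v = {b, c}" "v \<noteq> p" for v
    proof -
      from cases[of v] v consider "N v = {b, c}" | l where "N l = {v}" "?L l = {v}" | "N v = {x, b, c}" by auto
      then show ?thesis
      proof cases
        case (2 l)
        from supp[OF this, of p] Lp2 v show ?thesis by simp
      next
        case v3: 3
        have "v = p" by (rule no_twins3[OF v3 3(6) d])
        with v show ?thesis by simp
      qed
    qed
    \<comment> \<open>No leaf may appear at a common neighbour \<open>b'\<close> of \<open>p\<close>
      and its twin \<open>v\<close>: it would have been a leaf before, or support another leaf, or
      have lost \<open>x\<close>.\<close>
    have leaf: False if v: "N v = {b', c'}" and Np: "N p = {x, b', c'}" and d: "distinct [x, b', c']" and l: "?L l = {b'}" for v l b' c'
    proof -
      have "?L p = {b', c'}" unfolding Lp Np using d by auto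
      moreover have "{b'} \<noteq> {b', c'}" using d by auto
      ultimately have lp: "l \<noteq> p" using l by metis
      from cases[of l] l lp consider "N l = {b'}" | k where "N k = {l}" "?L k = {l}" | "N l = {x, b'}" by auto
      then show False
      proof cases
        case 1 show False by (rule no_leaf_square[OF Np v 1 d])
      next
        case (2 k)
        from suppin[OF 2(2)] l have "k = b'" by simp
        with 2(1) have "N b' = {l}" by simp
        moreover have "p \<in> N b'" using Np sym[of p b'] by simp
        ultimately show False using lp by simp
      next
        case 3 show False by (rule F4[OF 3 Np v d])
      qed
    qed
    show ?thesis
    proof (rule inert_degree2[OF G' Lp2])
      show "b \<noteq> c" using d by simp
      show False if "v \<noteq> p" "?L v = {b, c}" "?L l = {b} \<or> ?L l = {c}" for v l
      proof -
        have Nv: "N v = {b, c}" using two that by simp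
        have Nv': "N v = {c, b}" and Np': "N p = {x, c, b}" and d': "distinct [x, c, b]" using Nv 3(6) d by auto
        from that(3) show False using leaf[OF Nv 3(6) d, of l] leaf[OF Nv' Np' d', of l] by blast
      qed
      show False if "v \<noteq> w" "v \<noteq> p" "w \<noteq> p" "?L v = {b, c}" "?L w = {b, c}" for v w
        using no_gadget[OF two[OF that(4,2)] two[OF that(5,3)]] that(1) by simp
      assume L: "?L b = {p, c}" "?L c = {p, b}"
      have bp: "b \<noteq> p" "c \<noteq> p" using bc irr by metis+
      have tri: "N e = {p, f} \<or> N e = {x, p, f}" if ef: "?L e = {p, f}" "?L f = {p, e}" "e \<noteq> p" "f \<in> N p" "e \<noteq> f" "f \<noteq> p" for e f
      proof -
        have "?L e \<noteq> {}" using ef(1) by simp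
        from cases[OF this ef(3)] ef(1) consider "N e = {p, f}" | k where "N k = {e}" "?L k = {e}" | "N e = {x, p, f}" by auto
        then show ?thesis
        proof cases
          case (2 k)
          from suppin[OF 2(2)] ef have "k = p \<or> k = f" by auto
          then show ?thesis
          proof
            assume "k = p" with 2(1) no_leaf_p show ?thesis by simp
          next
            assume kf: "k = f"
            have "p \<in> N f" using inL[of p f] ef by simp
            with kf 2(1) ef show ?thesis by simp
          qed
        qed auto
      qed
      from tri[OF L(1,2) bp(1) bc(2) _ bp(2)] tri[OF L(2,1) bp(2) bc(1) _ bp(1)] d
      consider "N b = {p, c}" "N c = {p, b}" | "N b = {x, p, c}" "N c = {p, b}" | "N b = {p, c}" "N c = {x, p, b}"
        | "N b = {x, p, c}" "N c = {x, p, b}" by auto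
      then show False
      proof cases
        case 1 show False by (rule no_pendant_triangle[of b c p]) (use 1 in auto)
      next
        case 2 show False by (rule K3[of p b c]) (use 2 3 in auto)
      next
        case c3: 3 show False by (rule K3[of p c b]) (use c3 3 in auto)
      next
        case 4
        have "b \<in> N x" "c \<in> N x" using 4 sym[of b x] sym[of c x] by auto
        then have "N x = {p, b, c}" using N3[of p b c x] xp d bp by auto
        then show False by (rule no_tetrahedron[of x p b c]) (use 4 3 in auto)
      qed
    qed
  qed
qed

text \<open>The five vertices form a component, located by \<open>{x, p}\<close>: the codes of
  \<open>w\<close>, \<open>q\<close>, \<open>c\<close> are \<open>{x}\<close>,
  \<open>{x, p}\<close>, \<open>{p}\<close>.\<close>

lemma leaf_no_triangle:
  assumes w: "N w = {x}" and p: "N p = {x, q, c}" and q: "N q = {x, p, c}" and c: "N c = {p, q}"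
  shows False
proof -
  have i: "w \<in> N x" "p \<in> N x" "q \<in> N x" "c \<in> N p" "c \<in> N q" using w p q sym[of w x] sym[of p x] sym[of q x] by auto
  have ne: "w \<noteq> x" "p \<noteq> x" "q \<noteq> x" "c \<noteq> p" "c \<noteq> q" "p \<noteq> q" using i irr p by (metis insertI1 insertI2)+
  have xc: "x \<noteq> c"
  proof
    assume "x = c" with i c have "w = p \<or> w = q" by simp
    with w p q ne show False by auto
  qed
  have nw: "N w \<noteq> N p" "N w \<noteq> N q" "N w \<noteq> N c" unfolding w p q c using ne xc by auto
  then have wne: "w \<noteq> p" "w \<noteq> q" "w \<noteq> c" by auto
  have x: "N x = {w, p, q}" using N3[of w p q x] i wne ne by simp
  let ?W = "{w, x, p, q, c}" and ?D = "{x, p}"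
  have cl: "N w \<subseteq> ?W" "N x \<subseteq> ?W" "N p \<subseteq> ?W" "N q \<subseteq> ?W" "N c \<subseteq> ?W" unfolding w x p q c by auto
  show False
  proof (rule not_closed[of ?W ?D])
    show "2 * card ?D \<le> card ?W" using wne ne xc by (auto simp: card_insert_if)
    show "N e \<subseteq> ?W" if "e \<in> ?W" for e using that cl by blast
    have nE: "N w \<noteq> {}" "N x \<noteq> {}" "N p \<noteq> {}" "N q \<noteq> {}" "N c \<noteq> {}" unfolding w x p q c by auto
    show "N e \<noteq> {}" if "e \<in> ?W" for e using that nE by blast
    fix e assume "e \<in> ?W - ?D"
    then have e: "e = w \<or> e = q \<or> e = c" by blast
    show "N e \<inter> ?D \<noteq> {}" using e w q c by auto
    fix e' assume "e' \<in> ?W - ?D" and eq: "N e \<inter> ?D = N e' \<inter> ?D"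
    then have e': "e' = w \<or> e' = q \<or> e' = c" by blast
    have m: "(x \<in> N e) = (x \<in> N e')" "(p \<in> N e) = (p \<in> N e')" using eq by blast+
    have f: "x \<in> N w" "p \<notin> N w" "x \<in> N q" "p \<in> N q" "x \<notin> N c" using w q c ne xc by auto
    show "e = e'" using e e' m f by metis
  qed auto
qed

text \<open>The neighbourhoods of \<open>x\<close> and \<open>y\<close> are full, so the
  configuration continues only at \<open>z\<close>. A leaf at \<open>z\<close> closes up a component
  of eight vertices, located by \<open>{x, y, z}\<close>. Otherwise \<open>p\<close> and
  \<open>y\<close> can be deleted, although \<open>v\<close> becomes a leaf at
  \<open>z\<close>.\<close>

lemma leaf_no_square:
  assumes w: "N w = {x}" and p: "N p = {x, y}" and q: "N q = {x, y, z}" and v: "N v = {y, z}"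
    and d: "distinct [x, y, z]"
  shows False
proof -
  have i: "w \<in> N x" "p \<in> N x" "q \<in> N x" "p \<in> N y" "q \<in> N y" "v \<in> N y" "q \<in> N z" "v \<in> N z"
    using w p q v sym[of w x] sym[of p x] sym[of q x] sym[of p y] sym[of q y] sym[of v y] sym[of q z] sym[of v z] by auto
  have ne: "w \<noteq> x" "p \<noteq> x" "q \<noteq> x" "p \<noteq> y" "q \<noteq> y" "v \<noteq> y" "q \<noteq> z" "v \<noteq> z" using i irr by metis+
  have "N w \<noteq> N p" "N w \<noteq> N q" "N w \<noteq> N v" "N p \<noteq> N q" "N p \<noteq> N v" "N q \<noteq> N v" unfolding w p q v using d by (auto simp: doubleton_eq_iff)
  then have ne2: "w \<noteq> p" "w \<noteq> q" "w \<noteq> v" "p \<noteq> q" "p \<noteq> v" "q \<noteq> v" by auto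
  have x: "N x = {w, p, q}" and y: "N y = {p, q, v}" using N3[of w p q x] N3[of p q v y] i ne2 by auto
  have wz: "w \<noteq> z" using i(7) w ne by auto
  have wy: "w \<noteq> y" using i(4) w ne by auto
  have xv: "x \<noteq> v" using x v ne2 ne wz wy d i by auto
  have pz: "p \<noteq> z"
  proof
    assume "p = z"
    then have "v \<in> N p" using i(8) by simp
    with p have "v = x \<or> v = y" by simp
    with xv ne show False by simp
  qed
  show False
  proof (cases "\<exists>c. N c = {z}")
    case True
    then obtain c where c: "N c = {z}" by blast
    have cz: "c \<in> N z" using c sym[of c z] by simp
    have "N c \<noteq> N w" "N c \<noteq> N p" "N c \<noteq> N q" "N c \<noteq> N v" "N c \<noteq> N x" "N c \<noteq> N y"
      unfolding c w p q v x y using d ne2 by (auto simp: doubleton_eq_iff)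
    then have cne: "c \<noteq> w" "c \<noteq> p" "c \<noteq> q" "c \<noteq> v" "c \<noteq> x" "c \<noteq> y" by auto
    have "c \<noteq> z" using cz irr by metis
    have z: "N z = {q, v, c}" using N3[of q v c z] i cz ne2 cne by auto
    let ?W = "{w, x, p, q, y, v, z, c}" and ?D = "{x, y, z}"
    have cl: "N w \<subseteq> ?W" "N x \<subseteq> ?W" "N p \<subseteq> ?W" "N q \<subseteq> ?W" "N y \<subseteq> ?W" "N v \<subseteq> ?W" "N z \<subseteq> ?W" "N c \<subseteq> ?W"
      unfolding w x p q y v z c by auto
    have nE: "N w \<noteq> {}" "N x \<noteq> {}" "N p \<noteq> {}" "N q \<noteq> {}" "N y \<noteq> {}" "N v \<noteq> {}" "N z \<noteq> {}" "N c \<noteq> {}"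
      unfolding w x p q y v z c by auto
    show False
    proof (rule not_closed[of ?W ?D])
      show "2 * card ?D \<le> card ?W" using d ne ne2 wz wy xv pz cne \<open>c \<noteq> z\<close> by (auto simp: card_insert_if)
      show "N e \<subseteq> ?W" if "e \<in> ?W" for e using that cl by blast
      show "N e \<noteq> {}" if "e \<in> ?W" for e using that nE by blast
      fix e assume "e \<in> ?W - ?D"
      then have e: "e = w \<or> e = p \<or> e = q \<or> e = v \<or> e = c" by blast
      show "N e \<inter> ?D \<noteq> {}" using e w p q v c by auto
      fix e' assume "e' \<in> ?W - ?D" and eq: "N e \<inter> ?D = N e' \<inter> ?D"
      then have e': "e' = w \<or> e' = p \<or> e' = q \<or> e' = v \<or> e' = c" by blast
      have m: "(x \<in> N e) = (x \<in> N e')" "(y \<in> N e) = (y \<in> N e')" "(z \<in> N e) = (z \<in> N e')" using eq by blast+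
      have f: "x \<in> N w" "y \<notin> N w" "z \<notin> N w" "x \<in> N p" "y \<in> N p" "z \<notin> N p" "x \<in> N q" "y \<in> N q" "z \<in> N q"
        "x \<notin> N v" "y \<in> N v" "z \<in> N v" "x \<notin> N c" "y \<notin> N c" "z \<in> N c" using w p q v c d by auto
      show "e = e'" using e e' m f by metis
    qed auto
  next
    case noleaf: False
    let ?W = "{p, y}" let ?H = "del ?W E" let ?L = "nbhd ?H"
    have G': "graph (V - ?W) ?H" using G by (rule graph_del)
    have Lx: "?L x = {w, q}" using x ne ne2 d wy by (auto simp: nbhd_del)
    have Lq: "?L q = {x, z}" using q ne ne2 d pz by (auto simp: nbhd_del)
    have Lv: "?L v = {z}" using v ne ne2 d pz by (auto simp: nbhd_del)
    have Lw: "?L w = {x}" using w ne ne2 d wy by (auto simp: nbhd_del)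
    have aff: "e = x \<or> e = q \<or> e = v" if "e \<notin> ?W" "N e \<inter> ?W \<noteq> {}" for e
    proof -
      have "e \<in> N p \<or> e \<in> N y" using sym that by blast
      with p y that(1) show ?thesis by auto
    qed
    have same: "?L e = N e" if "e \<noteq> x" "e \<noteq> q" "e \<noteq> v" "?L e \<noteq> {}" for e
      using aff[of e] that by (auto simp: nbhd_del split: if_splits)
    have leafz: "e = v" if "?L e = {z}" for e
    proof (rule ccontr)
      assume "e \<noteq> v"
      moreover have "{z} \<noteq> {w, q}" "{z} \<noteq> {x, z}" using wz d by auto
      then have "e \<noteq> x" "e \<noteq> q" using that Lx Lq by metis+
      ultimately have "N e = {z}" using same[of e] that by simp
      with noleaf show False by blast
    qed
    have linkz: "e = q" if "?L e = {x, z}" for e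
    proof -
      have "e \<in> ?L x" using nbhd_sym[OF G', of e x] that by simp
      moreover have "{x} \<noteq> {x, z}" using d by auto
      then have "e \<noteq> w" using that Lw by metis
      ultimately show ?thesis using Lx by simp
    qed
    have "tame (V - ?W) ?H"
    proof (rule tame_delI[OF tame])
      fix e assume e: "e \<in> V - ?W" "N e \<inter> ?W \<noteq> {}"
      have "inert (V - ?W) ?H v"
      proof (rule inert_leaf[OF G' Lv leafz])
        fix g h k assume gh: "?L g = {z, k}" "?L h = {z, k}"
        show "g = h"
        proof (cases "k = z")
          case True
          with gh have "?L g = {z}" "?L h = {z}" by simp_all
          from leafz[OF this(1)] leafz[OF this(2)] show ?thesis by simp
        next
          case kz: False
          show ?thesis
          proof (cases "k = x")
            case True
            then have "?L g = {x, z}" "?L h = {x, z}" using gh by auto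
            from linkz[OF this(1)] linkz[OF this(2)] show ?thesis by simp
          next
            case False
            have "{z, k} \<noteq> {z}" "{z, k} \<noteq> {x, z}" "{z, k} \<noteq> {w, q}" using kz False wz ne by (auto simp: doubleton_eq_iff)
            then have "g \<noteq> v" "h \<noteq> v" "g \<noteq> q" "h \<noteq> q" "g \<noteq> x" "h \<noteq> x" using gh Lv Lq Lx by metis+
            then have "N g = {z, k}" "N h = {z, k}" using same[of g] same[of h] gh by (metis insert_not_empty)+
            then show ?thesis by (rule no_gadget)
          qed
        qed
      qed
      moreover have "inert (V - ?W) ?H q"
      proof (rule inert2[OF G' Lq _ linkz])
        show "x \<noteq> z" using d by simp
        assume "?L x = {q, z}"
        with Lx wz ne2 show False by (auto simp: doubleton_eq_iff)
      qed
      moreover have "inert (V - ?W) ?H x"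
        by (rule inert_support[OF G' Lw]) (use Lx ne2 in simp)
      ultimately show "inert (V - ?W) ?H e" using aff[of e] e by auto
    qed
    moreover have "N p = {y, x}" using p by auto
    ultimately show False using not_tame_deg2[of p y x] by (simp add: insert_commute)
  qed
qed

text \<open>The remaining danger in deleting \<open>w\<close> and \<open>x\<close> is that a link, a
  vertex of degree two between \<open>x\<close> and another support \<open>t\<close>, becomes a
  second leaf at \<open>t\<close>. Therefore all links at \<open>x\<close> are deleted too. There
  are at most two, since \<open>w\<close> takes one of the three places at \<open>x\<close>.\<close>

lemma no_leaf: "N w \<noteq> {x}"
proof
  assume w: "N w = {x}"
  have wx: "w \<in> N x" "w \<noteq> x" using w sym[of w x] irr[of w] by auto
  have F4: "False" if "N p = {x, b}" "N q = {x, b, z}" "N h = {b, z}" "distinct [x, b, z]" for p q b z h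
    using leaf_no_square[OF w that] .
  have K3: "False" if "N p = {x, q, c}" "N q = {x, p, c}" "N c = {p, q}" for p q c
    using leaf_no_triangle[OF w that] .
  have nx: "N p \<noteq> {x}" if "p \<noteq> w" for p using no_leaf_twins[OF w, of p] that by auto
  show False
  proof (cases "\<exists>p t l. N p = {x, t} \<and> N l = {t} \<and> t \<noteq> x")
    case False
    let ?W = "{w, x}"
    have aff: "N e \<inter> ?W = {x}" if "e \<notin> ?W" "N e \<inter> ?W \<noteq> {}" for e
      using that sym[of w e] w by auto
    have "tame (V - ?W) (del ?W E)"
    proof (rule tame_delI[OF tame])
      fix e assume e: "e \<in> V - ?W" "N e \<inter> ?W \<noteq> {}"
      show "inert (V - ?W) (del ?W E) e"
      proof (rule inert_affected[of x])
        show "N e \<inter> ?W = {x}" using aff e by simp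
        show "N e \<noteq> {x}" using nx e by simp
        show "False" if "N e = {x, b}" "N l = {b}" for b l
        proof -
          have "b = x" using False that by blast
          with that(1) \<open>N e \<noteq> {x}\<close> show False by simp
        qed
        show "e \<notin> ?W" "x \<in> ?W" using e by auto
        show "(\<exists>l. N l = {f} \<and> l \<notin> ?W) \<or> N f \<inter> ?W = {x}" if "f \<notin> ?W" "N f \<inter> ?W \<noteq> {}" for f
          using aff[OF that] by simp
      qed (fact F4, fact K3)
    qed
    with not_tame_leaf[OF w] show False by blast
  next
    case True
    then obtain p t l where p: "N p = {x, t}" "N l = {t}" "t \<noteq> x" by blast
    have px: "p \<in> N x" "p \<in> N t" using p sym[of p x] sym[of p t] by auto
    have pne: "p \<noteq> x" "p \<noteq> t" using px irr by metis+
    have "N w \<noteq> N p" "N l \<noteq> N p" unfolding w p using p(3) by auto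
    then have wp: "w \<noteq> p" "l \<noteq> p" by auto
    have "N l \<noteq> N w" unfolding p w using p(3) by auto
    then have lw: "l \<noteq> w" by auto
    have lx: "l \<noteq> x" using px p(2) wp pne wx by auto
    show False
    proof (cases "\<exists>q t' l'. N q = {x, t'} \<and> N l' = {t'} \<and> q \<noteq> p \<and> t' \<noteq> x")
      case True
      then obtain q t' l' where q: "N q = {x, t'}" "N l' = {t'}" "q \<noteq> p" "t' \<noteq> x" by blast
      have tt: "t \<noteq> t'" using no_gadget[of p x t q] p q by auto
      have qx: "q \<in> N x" "q \<in> N t'" using q sym[of q x] sym[of q t'] by auto
      have qne: "q \<noteq> x" "q \<noteq> t'" using qx irr by metis+
      have "N w \<noteq> N q" "N l' \<noteq> N q" "N l' \<noteq> N w" unfolding w q using q(4) by auto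
      then have wq: "w \<noteq> q" "l' \<noteq> q" "l' \<noteq> w" by auto
      have x: "N x = {w, p, q}" using N3[of w p q x] wx px qx wp wq q(3) by auto
      have "N l \<noteq> N q" "N l' \<noteq> N p" unfolding p q using p q by auto
      then have lq: "l \<noteq> q" "l' \<noteq> p" by auto
      have l'x: "l' \<noteq> x" using qx q(2) wq qne wx px lq by auto
      let ?W = "{w, x, p, q}" let ?H = "del ?W E"
      have G': "graph (V - ?W) ?H" using G by (rule graph_del)
      have "tame (V - ?W) ?H"
      proof (rule tame_delI[OF tame])
        fix e assume e: "e \<in> V - ?W" "N e \<inter> ?W \<noteq> {}"
        then have "e \<in> N w \<or> e \<in> N x \<or> e \<in> N p \<or> e \<in> N q" using sym by blast
        with e w x p q have et: "e = t \<or> e = t'" by auto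
        have L: "nbhd ?H l = {t}" if "e = t" using that e p(2) lw lx wp lq by (auto simp: nbhd_del)
        have L': "nbhd ?H l' = {t'}" if "e = t'" using that e q(2) wq l'x lq by (auto simp: nbhd_del)
        have ct: "card (nbhd ?H t) \<le> 2" if "e = t"
          by (rule card_del_le2[OF G subc, of t p]) (use p that e in auto)
        have ct': "card (nbhd ?H t') \<le> 2" if "e = t'"
          by (rule card_del_le2[OF G subc, of t' q]) (use q that e in auto)
        from et show "inert (V - ?W) ?H e"
          using inert_support[OF G' L] ct inert_support[OF G' L'] ct' by blast
      qed
      then have "half (V - ?W) ?H"
        by (rule half_smaller) (use inV' wx px qx inV[of x] inV[of w] w in auto)
      with half_two_links[OF G w x p(1) q(1) p(2) q(2) tt p(3) q(4)] no_half show False by simp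
    next
      case nolink: False
      let ?W = "{w, x, p}" let ?H = "del ?W E"
      have G': "graph (V - ?W) ?H" using G by (rule graph_del)
      have lW: "l \<notin> ?W" using lw lx wp by simp
      have aff: "e = t \<or> N e \<inter> ?W = {x}" if "e \<notin> ?W" "N e \<inter> ?W \<noteq> {}" for e
      proof (cases "e = t")
        case False
        then have "w \<notin> N e" "p \<notin> N e" using sym[of w e] sym[of p e] w p that(1) by auto
        with that(2) show ?thesis by auto
      qed simp
      have "tame (V - ?W) ?H"
      proof (rule tame_delI[OF tame])
        fix e assume e: "e \<in> V - ?W" "N e \<inter> ?W \<noteq> {}"
        show "inert (V - ?W) ?H e"
        proof (cases "e = t")
          case True
          have L: "nbhd ?H l = {t}" using e p(2) lW True by (auto simp: nbhd_del)
          have "card (nbhd ?H t) \<le> 2"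
            by (rule card_del_le2[OF G subc, of t p]) (use p True e in auto)
          with inert_support[OF G' L] True show ?thesis by simp
        next
          case False
          show ?thesis
          proof (rule inert_affected[of x])
            show "N e \<inter> ?W = {x}" using aff e False by blast
            show "N e \<noteq> {x}" using nx e by simp
            show "False" if "N e = {x, b}" "N k = {b}" for b k
            proof -
              have "b = x" using nolink that e by blast
              with that(1) \<open>N e \<noteq> {x}\<close> show False by simp
            qed
            show "(\<exists>l. N l = {f} \<and> l \<notin> ?W) \<or> N f \<inter> ?W = {x}" if "f \<notin> ?W" "N f \<inter> ?W \<noteq> {}" for f
              using aff[OF that] p(2) lW by blast
            show "e \<notin> ?W" "x \<in> ?W" using e by auto
          qed (fact F4, fact K3)
        qed
      qed
      then have "half (V - ?W) ?H"
        by (rule half_smaller) (use inV' wx px inV[of w] w in auto)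
      with half_link[OF G w p(1) p(2)] p(3) no_half show False by simp
    qed
  qed
qed

end

subsection \<open>Vertices of degree two\<close>

definition del_edge :: "'a \<Rightarrow> 'a \<Rightarrow> ('a \<Rightarrow> 'a \<Rightarrow> bool) \<Rightarrow> 'a \<Rightarrow> 'a \<Rightarrow> bool" where
  "del_edge u v E a b \<longleftrightarrow> E a b \<and> \<not> (a = u \<and> b = v) \<and> \<not> (a = v \<and> b = u)"

lemma nbhd_del_edge:
  "nbhd (del_edge u v E) a = (if a = u then nbhd E a - {v} else if a = v then nbhd E a - {u} else nbhd E a)"
  unfolding nbhd_def del_edge_def by auto

lemma graph_del_edge: "graph V E \<Longrightarrow> graph V (del_edge u v E)"
  unfolding graph_def del_edge_def by blast

context mincex begin

lemma not_tame_del_edge: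
  assumes uv: "v \<in> N u"
    and sq: "\<And>s t. s \<in> N v \<Longrightarrow> s \<noteq> u \<Longrightarrow> t \<in> N s \<Longrightarrow> t \<noteq> v \<Longrightarrow> u \<in> N t \<Longrightarrow> False"
    and i: "inert V (del_edge u v E) u" "inert V (del_edge u v E) v"
  shows False
proof -
  let ?E = "del_edge u v E"
  have G': "graph V ?E" using G by (rule graph_del_edge)
  have T: "tame V ?E"
    unfolding tame_def
  proof (intro conjI allI notI G')
    show "subcubic V ?E" by (rule subcubic_mono[OF G subc]) (auto simp: nbhd_del_edge)
    fix X assume X: "viol V ?E X"
    from viol_changed[OF tame X order_refl G'] obtain a where "a \<in> X" "nbhd ?E a \<noteq> N a" by blast
    then have "u \<in> X \<or> v \<in> X" by (auto simp: nbhd_del_edge split: if_splits)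
    with i X show False unfolding inert_def by blast
  qed
  have "{(a, b). ?E a b} \<subset> {(a, b). E a b}"
  proof -
    have "E u v" using uv unfolding nbhd_def by simp
    moreover have "\<not> ?E u v" unfolding del_edge_def by simp
    ultimately show ?thesis unfolding del_edge_def by blast
  qed
  then have "card {(a, b). ?E a b} < card {(a, b). E a b}" by (rule psubset_card_mono[OF fin_pairs])
  then have "half V ?E" using minimal[OF T] by simp
  then have "half V E"
    by (rule half_del_edge[OF G G' nbhd_del_edge, rotated -1]) (fact sq)
  with no_half show False ..
qed

lemma card_ge2:
  assumes "a \<in> N v"
  obtains b where "b \<noteq> a" "b \<noteq> v" "N v = {a, b}"
  | b c where "b \<noteq> a" "c \<noteq> a" "b \<noteq> c" "b \<noteq> v" "c \<noteq> v" "N v = {a, b, c}"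
  using assms
proof (cases rule: N1)
  case 1 with no_leaf show thesis by blast
qed (use that in blast)+

text \<open>The triangle \<open>w x y\<close> and the square \<open>x y h k\<close> form a house,
  open only at \<open>k\<close>. If \<open>k\<close> has no third neighbour, the house is a
  component located by \<open>{x, y}\<close>. Otherwise \<open>w\<close> and \<open>x\<close> can be
  deleted, and the third neighbour of \<open>k\<close> distinguishes \<open>k\<close> from the leaf
  that \<open>y\<close> becomes.\<close>

lemma no_house_corner:
  assumes w: "N w = {x, y}" and x: "N x = {w, y, k}" and h: "N h = {y, k}" and d: "distinct [w, y, k]"
  shows False
proof -
  have i: "w \<in> N x" "w \<in> N y" "x \<in> N y" "h \<in> N y" "h \<in> N k" "x \<in> N k"
    using w x h sym[of w x] sym[of w y] sym[of x y] sym[of h y] sym[of h k] sym[of x k] by auto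
  have ne: "w \<noteq> x" "w \<noteq> y" "x \<noteq> y" "h \<noteq> y" "h \<noteq> k" "x \<noteq> k" using i irr by metis+
  have "N w \<noteq> N h" "N x \<noteq> N h" unfolding w x h using ne d by (auto simp: doubleton_eq_iff)
  then have ne2: "h \<noteq> w" "h \<noteq> x" by auto
  have y: "N y = {w, x, h}" using N3[of w x h y] i ne ne2 by auto
  have hk: "h \<in> N k" "x \<in> N k" using i by auto
  have xh: "x \<noteq> h" using ne2 by simp
  have kNy: "k \<notin> N y" unfolding y using d ne by auto
  from N2[OF xh hk(2,1)] show False
  proof cases
    case k: 1
    let ?W = "{w, x, y, h, k}" and ?D = "{x, y}"
    have cl: "N w \<subseteq> ?W" "N x \<subseteq> ?W" "N y \<subseteq> ?W" "N h \<subseteq> ?W" "N k \<subseteq> ?W" unfolding w x y h k by auto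
    have nE: "N w \<noteq> {}" "N x \<noteq> {}" "N y \<noteq> {}" "N h \<noteq> {}" "N k \<noteq> {}" unfolding w x y h k by auto
    show False
    proof (rule not_closed[of ?W ?D])
      show "2 * card ?D \<le> card ?W" using d ne ne2 by (auto simp: card_insert_if)
      show "N e \<subseteq> ?W" if "e \<in> ?W" for e using that cl by blast
      show "N e \<noteq> {}" if "e \<in> ?W" for e using that nE by blast
      fix e assume "e \<in> ?W - ?D"
      then have e: "e = w \<or> e = h \<or> e = k" by blast
      show "N e \<inter> ?D \<noteq> {}" using e w h k by auto
      fix e' assume "e' \<in> ?W - ?D" and eq: "N e \<inter> ?D = N e' \<inter> ?D"
      then have e': "e' = w \<or> e' = h \<or> e' = k" by blast
      have m: "(x \<in> N e) = (x \<in> N e')" "(y \<in> N e) = (y \<in> N e')" using eq by blast+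
      have f: "x \<in> N w" "y \<in> N w" "x \<notin> N h" "y \<in> N h" "x \<in> N k" "y \<notin> N k"
        unfolding w h k using ne ne2 d by auto
      show "e = e'" using e e' m f by metis
    qed auto
  next
    case (2 k')
    note k = 2(4)
    let ?W = "{w, x}" let ?H = "del ?W E" let ?L = "nbhd ?H"
    have G': "graph (V - ?W) ?H" using G by (rule graph_del)
    have Ly: "?L y = {h}" using y ne ne2 by (auto simp: nbhd_del)
    have k'w: "k' \<noteq> w" using k sym[of w k] w ne d by auto
    have Lk: "?L k = {h, k'}" using k ne ne2 d k'w 2 by (auto simp: nbhd_del)
    have Lh: "?L h = {y, k}" using h ne ne2 d by (auto simp: nbhd_del)
    have near: "e = y \<or> e = k" if "h \<in> ?L e" for e using nbhd_sym[OF G', of h e] that Lh by simp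
    have hk': "{h} \<noteq> {h, k'}" using 2(2) by auto
    have k_inert: "inert (V - ?W) ?H k"
    proof (rule inert2[OF G' Lk])
      show "h \<noteq> k'" using 2 by simp
      show "e = k" if "?L e = {h, k'}" for e
      proof -
        have "e = y \<or> e = k" using near[of e] that by simp
        with that Ly hk' show ?thesis by metis
      qed
      assume "?L h = {k, k'}"
      with Lh d ne 2 have "k' = y" by (auto simp: doubleton_eq_iff)
      with k have "y \<in> N k" by simp
      with kNy sym show False by blast
    qed
    have one: "e = y" if "?L e = {h}" for e
    proof -
      have "e = y \<or> e = k" using near[of e] that by simp
      with that Lk hk' show ?thesis by metis
    qed
    have y_inert: "inert (V - ?W) ?H y"
    proof (rule inert_leaf[OF G' Ly one])
      fix g f q assume gf: "?L g = {h, q}" "?L f = {h, q}"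
      have "g = y \<or> g = k" "f = y \<or> f = k" using near[of g] near[of f] gf by auto
      moreover have "?L y \<noteq> ?L k" using Ly Lk hk' by simp
      ultimately show "g = f" using gf by metis
    qed
    have "tame (V - ?W) ?H"
    proof (rule tame_delI[OF tame])
      fix e assume e: "e \<in> V - ?W" "N e \<inter> ?W \<noteq> {}"
      then have "e \<in> N w \<or> e \<in> N x" using sym by blast
      with e w x have "e = y \<or> e = k" by auto
      with y_inert k_inert show "inert (V - ?W) ?H e" by blast
    qed
    with not_tame_deg2[OF w] show False .
  qed
qed

text \<open>Without a square, the edge \<open>wx\<close> could be deleted. Then \<open>w\<close> is
  a leaf at \<open>y\<close> and \<open>x\<close> loses a neighbour, and it has to be shown that
  neither end takes part in a violation.\<close>

lemma deg2_square:
  assumes w: "N w = {x, y}"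
  shows "\<exists>z. z \<noteq> w \<and> z \<in> N x \<and> z \<in> N y"
proof (rule ccontr)
  assume no: "\<not> ?thesis"
  let ?E = "del_edge w x E" let ?M = "nbhd ?E"
  have G': "graph V ?E" using G by (rule graph_del_edge)
  have xy: "x \<noteq> y" using no_leaf[of w x] w by auto
  have wx: "w \<in> N x" "w \<in> N y" using sym[of w x] sym[of w y] w by auto
  have ne: "w \<noteq> x" "w \<noteq> y" using wx irr by metis+
  have Mw: "?M w = {y}" using w xy ne by (auto simp: nbhd_del_edge)
  have Mx: "?M x = N x - {w}" using ne by (simp add: nbhd_del_edge)
  have same: "?M e = N e" if "e \<noteq> w" "e \<noteq> x" for e using that by (simp add: nbhd_del_edge)
  have Nxy: "N x \<noteq> {w, y}" using no_pendant_triangle[of w x y] w by auto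
  have leaf: "e = w \<or> e = x" if "?M e = {a}" for e a using same[of e] that no_leaf[of e a] by auto
  have xM: "?M x \<noteq> {y}" using Mx Nxy wx by auto
  have onew: "e = w" if "?M e = {y}" for e using leaf[OF that] that xM by auto
  \<comment> \<open>This is the violation that would join the two ends: \<open>x\<close> and
    \<open>g\<close> as twins of degree two, with \<open>w\<close> as a leaf at their common
    neighbour \<open>y\<close>. It comes from a house.\<close>
  have Q: False if "?M x = {y, k}" "?M g = {y, k}" "g \<noteq> x" "k \<noteq> y" for g k
  proof -
    have "w \<notin> {y, k}" using that(1) Mx by auto
    then have d: "distinct [w, y, k]" using that(4) by auto
    have "N x = {w, y, k}" using that(1) Mx wx by auto
    moreover have "g \<noteq> w" using that Mw by (auto simp: doubleton_eq_iff)
    then have "N g = {y, k}" using same[of g] that by simp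
    ultimately show False using no_house_corner[OF w _ _ d] by blast
  qed
  have w_inert: "inert V ?E w"
  proof (rule inert_leaf[OF G' Mw onew])
    fix g h k assume gh: "?M g = {y, k}" "?M h = {y, k}"
    show "g = h"
    proof (cases "k = y")
      case True
      with gh have "?M g = {y}" "?M h = {y}" by simp_all
      from onew[OF this(1)] onew[OF this(2)] show ?thesis by simp
    next
      case False
      then have yk: "{y, k} \<noteq> {y}" by auto
      then have gw: "g \<noteq> w" "h \<noteq> w" using gh Mw by metis+
      show ?thesis
      proof (cases "g = x \<or> h = x")
        case True with Q[of k g] Q[of k h] gh False show ?thesis by metis
      next
        case False
        then have "N g = {y, k}" "N h = {y, k}" using same[of g] same[of h] gh gw by simp_all
        then show ?thesis by (rule no_gadget)
      qed
    qed
  qed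
  have x_inert: "inert V ?E x"
    using wx(1)
  proof (cases rule: card_ge2)
    case (1 a)
    then have Ma: "?M x = {a}" using Mx ne by auto
    have ay: "a \<noteq> y" using xM Ma by auto
    have onex: "e = x" if "?M e = {a}" for e using leaf[OF that] that Mw ay by auto
    show ?thesis
    proof (rule inert_leaf[OF G' Ma onex])
      fix g h k assume gh: "?M g = {a, k}" "?M h = {a, k}"
      show "g = h"
      proof (cases "k = a")
        case True
        with gh have "?M g = {a}" "?M h = {a}" by simp_all
        from onex[OF this(1)] onex[OF this(2)] show ?thesis by simp
      next
        case False
        then have "{a, k} \<noteq> {y}" "{a, k} \<noteq> {a}" using ay by auto
        then have "g \<noteq> w" "h \<noteq> w" "g \<noteq> x" "h \<noteq> x" using gh Mw Ma by metis+
        then have "N g = {a, k}" "N h = {a, k}" using same[of g] same[of h] gh by simp_all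
        then show ?thesis by (rule no_gadget)
      qed
    qed
  next
    case (2 a b)
    then have Ma: "?M x = {a, b}" using Mx ne by auto
    have ab: "a \<noteq> b" using 2 by simp
    have other: "N v = {a, b}" if "?M v = {a, b}" "v \<noteq> x" for v
    proof -
      have "{a, b} \<noteq> {y}" using ab by auto
      then have "v \<noteq> w" using that Mw by metis
      with same[of v] that show ?thesis by simp
    qed
    show ?thesis
    proof (rule inert_degree2[OF G' Ma ab])
      show False if v: "v \<noteq> x" "?M v = {a, b}" "?M l = {a} \<or> ?M l = {b}" for v l
      proof -
        have "?M x \<noteq> {a}" "?M x \<noteq> {b}" unfolding Ma using ab by auto
        then have "l \<noteq> x" using v(3) by metis
        then have "l = w" using leaf v(3) by blast
        then have "y = a \<or> y = b" using Mw v(3) by auto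
        then show False
        proof
          assume "y = a" then show False using Q[of b v] Ma v ab by simp
        next
          assume "y = b" then show False using Q[of a v] Ma v ab by (simp add: insert_commute)
        qed
      qed
      show False if "v \<noteq> f" "v \<noteq> x" "f \<noteq> x" "?M v = {a, b}" "?M f = {a, b}" for v f
        using no_gadget[OF other[OF that(4,2)] other[OF that(5,3)]] that(1) by simp
      assume M: "?M a = {x, b}" "?M b = {x, a}"
      have "a \<noteq> w" "b \<noteq> w" "a \<noteq> x" "b \<noteq> x" using 2 by auto
      then have "N a = {x, b}" "N b = {x, a}" using same[of a] same[of b] M by simp_all
      with no_pendant_triangle[of a b x] show False by (simp add: insert_commute)
    qed
  qed
  show False
  proof (rule not_tame_del_edge[of x w])
    show "x \<in> N w" using w by simp
    fix s t assume st: "s \<in> N x" "s \<noteq> w" "t \<in> N s" "t \<noteq> x" "w \<in> N t"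
    then have "t = y" using sym[of w t] w by auto
    with st have "s \<in> N y" using sym[of y s] by simp
    with no st show False by blast
  qed (fact w_inert, fact x_inert)
qed

text \<open>The second common neighbour \<open>z\<close> of \<open>x\<close> and \<open>y\<close>
  has degree three, since \<open>w\<close> has no twin. If \<open>x\<close> and \<open>y\<close> are
  adjacent, \<open>w\<close> and \<open>x\<close> can be deleted. Otherwise at least one of them has
  a third neighbour, and \<open>core\<close> calls it \<open>y\<close>. There the obstacle is a
  third neighbour \<open>x'\<close> of \<open>x\<close> that becomes a leaf; the bad cases close up
  into components of seven vertices.\<close>

lemma no_deg2: "N w \<noteq> {x, y}"
proof
  assume w: "N w = {x, y}"
  from deg2_square[OF w] obtain z where z: "z \<noteq> w" "z \<in> N x" "z \<in> N y" by blast
  have xy: "x \<noteq> y" using no_leaf[of w x] w by auto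
  have i: "w \<in> N x" "w \<in> N y" "x \<in> N z" "y \<in> N z" using sym[of w x] sym[of w y] sym[of x z] sym[of y z] w z by auto
  have ne: "w \<noteq> x" "w \<noteq> y" "z \<noteq> x" "z \<noteq> y" using i z irr by metis+
  from N2[OF xy i(3,4)] obtain u where u: "u \<noteq> x" "u \<noteq> y" "u \<noteq> z" "N z = {x, y, u}"
    using no_gadget[OF w, of z] z by metis
  have uz: "z \<in> N u" using u sym[of z u] by simp
  have wNz: "w \<notin> N z" using sym[of w z] w ne by auto
  have uw: "u \<noteq> w" using wNz u by auto
  have wz: "w \<noteq> z" using z by simp
  have core: False if w: "N w = {x, y}" and xy: "x \<noteq> y" and i: "w \<in> N x" "w \<in> N y" and ne: "w \<noteq> x" "w \<noteq> y" "z \<noteq> x" "z \<noteq> y"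
    and zN: "z \<in> N x" "z \<in> N y" and u: "u \<noteq> x" "u \<noteq> y" "N z = {x, y, u}" and y: "N y = {w, z, y'}" and y': "y' \<noteq> w" "y' \<noteq> z" "y' \<noteq> x"
    and x: "N x = {w, z} \<or> (\<exists>x'. N x = {w, z, x'} \<and> x' \<noteq> w \<and> x' \<noteq> z \<and> x' \<noteq> y)" for x y y'
  proof -
    let ?W = "{w, x}" let ?H = "del ?W E" let ?L = "nbhd ?H"
    have G': "graph (V - ?W) ?H" using G by (rule graph_del)
    have Ly: "?L y = {z, y'}" using y y' ne xy wz by (auto simp: nbhd_del)
    have Lz: "?L z = {y, u}" using u ne xy wz uw by (auto simp: nbhd_del)
    have yu: "y \<noteq> u" using u by simp
    have zy': "z \<noteq> y'" using y' by simp
    have neary: "e = z \<or> e = y'" if "y \<in> ?L e" for e using nbhd_sym[OF G', of y e] that Ly by simp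
    have nearz: "e = y \<or> e = u" if "z \<in> ?L e" for e using nbhd_sym[OF G', of z e] that Lz by simp
    have aff: "e = y \<or> e = z \<or> e \<in> N x" if "e \<notin> ?W" "N e \<inter> ?W \<noteq> {}" for e
    proof -
      have "e \<in> N w \<or> e \<in> N x" using sym that by blast
      with w that(1) show ?thesis by auto
    qed
    have same: "?L e = N e" if "e \<notin> N x" "e \<noteq> y" "?L e \<noteq> {}" for e
      using aff[of e] that zN by (auto simp: nbhd_del split: if_splits)
    have yy': "y \<in> N y'" using y sym[of y y'] by simp
    have y'y: "y' \<noteq> y" using yy' irr by metis
    \<comment> \<open>This excludes a triangle on \<open>y\<close>, \<open>z\<close>,
      \<open>u\<close> in the smaller graph. If \<open>u\<close> is not adjacent to
      \<open>x\<close>, it has degree two and lies in no square with \<open>y\<close> and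
      \<open>z\<close>; otherwise \<open>x\<close> and \<open>y\<close> are twins of degree
      three.\<close>
    have cu: False if "y' = u" "?L u = {y, z}"
    proof (cases "u \<in> N x")
      case False
      then have Nu: "N u = {y, z}" using same[of u] that u yu by simp
      from deg2_square[OF this] obtain c where c: "c \<noteq> u" "c \<in> N y" "c \<in> N z" by blast
      with y u that(1) have "c = w \<or> c = z" by auto
      with c irr[of z] wNz show False by auto
    next
      case True
      then have x3: "N x = {w, z, u}" using N3[of w z u x] i zN uw uz wz irr[of u] by auto
      have y3: "N y = {w, z, u}" using y that by simp
      have "distinct [w, z, u]" using wz uw irr[of u] uz by auto
      from no_twins3[OF x3 y3 this] xy show False by simp
    qed
    have y_inert: "inert (V - ?W) ?H y" if "\<And>v l. v \<noteq> y \<Longrightarrow> ?L v = {z, y'} \<Longrightarrow> ?L l = {z} \<or> ?L l = {y'} \<Longrightarrow> False"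
    proof (rule inert_degree2[OF G' Ly zy'])
      show False if "v \<noteq> f" "v \<noteq> y" "f \<noteq> y" "?L v = {z, y'}" "?L f = {z, y'}" for v f
        using nearz[of v] nearz[of f] that by auto
      assume L: "?L z = {y, y'}" "?L y' = {y, z}"
      from L(1) Lz yu y'y have "y' = u" by (auto simp: doubleton_eq_iff)
      with cu L(2) show False by simp
    qed (fact that)
    have z_inert: "inert (V - ?W) ?H z" if "\<And>v l. v \<noteq> z \<Longrightarrow> ?L v = {y, u} \<Longrightarrow> ?L l = {y} \<or> ?L l = {u} \<Longrightarrow> False"
    proof (rule inert_degree2[OF G' Lz yu])
      show False if "v \<noteq> f" "v \<noteq> z" "f \<noteq> z" "?L v = {y, u}" "?L f = {y, u}" for v f
        using neary[of v] neary[of f] that by auto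
      assume L: "?L y = {z, u}" "?L u = {z, y}"
      from L(1) Ly zy' have "y' = u" by (auto simp: doubleton_eq_iff)
      moreover have "?L u = {y, z}" using L(2) by auto
      ultimately show False using cu by simp
    qed (fact that)
    have nsing: "?L y \<noteq> {a}" "?L z \<noteq> {a}" for a unfolding Ly Lz using yu zy' by auto
    from x show False
    proof (elim disjE exE conjE)
      assume x: "N x = {w, z}"
      have noleafH: "?L e \<noteq> {a}" for e a
      proof
        assume e: "?L e = {a}"
        then have "e \<noteq> w" by (auto simp: nbhd_del)
        show False
        proof (cases "e \<in> N x \<or> e = y")
          case True with x \<open>e \<noteq> w\<close> e nsing show False by auto
        next
          case False
          then have "N e = {a}" using same[of e] e by simp
          with no_leaf show False by blast
        qed
      qed
      have "tame (V - ?W) ?H"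
      proof (rule tame_delI[OF tame])
        fix e assume e: "e \<in> V - ?W" "N e \<inter> ?W \<noteq> {}"
        then have "e = y \<or> e = z" using aff[of e] x by auto
        with y_inert z_inert noleafH show "inert (V - ?W) ?H e" by blast
      qed
      with not_tame_deg2[OF w] show False .
    next
      fix x' assume x: "N x = {w, z, x'}" and x': "x' \<noteq> w" "x' \<noteq> z" "x' \<noteq> y"
      have xx': "x \<in> N x'" using x sym[of x x'] by simp
      have x'x: "x' \<noteq> x" using xx' irr by metis
      have wx': "w \<notin> N x'" using sym[of w x'] w x' x'x by auto
      have Lx': "?L x' = N x' - {x}" using x' x'x wx' by (auto simp: nbhd_del)
      have same': "?L e = N e" if "e \<noteq> x'" "e \<noteq> y" "e \<noteq> z" "?L e \<noteq> {}" for e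
      proof -
        have "e \<noteq> w" using that by (auto simp: nbhd_del)
        with x that same[of e] show ?thesis by auto
      qed
      have leafH: "e = x'" if "?L e = {a}" for e a
      proof (rule ccontr)
        assume "e \<noteq> x'"
        moreover have "e \<noteq> y" "e \<noteq> z" using that nsing by metis+
        ultimately have "N e = {a}" using same'[of e] that by simp
        with no_leaf show False by blast
      qed
      have aff': "e = y \<or> e = z \<or> e = x'" if "e \<in> V - ?W" "N e \<inter> ?W \<noteq> {}" for e
        using aff[of e] that x by auto
      show False
        using xx'
      proof (cases rule: card_ge2)
        case (2 t s)
        have Lx2: "?L x' = {t, s}" using Lx' 2 by auto
        \<comment> \<open>In this case \<open>x'\<close> keeps two neighbours, so no vertex becomes
          a leaf, and for \<open>x'\<close> only triplets and triangles are left to exclude.\<close>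
        have noleafH: "?L e \<noteq> {a}" for e a
        proof
          assume "?L e = {a}"
          with leafH[OF this] Lx2 2 show False by (auto simp: doubleton_eq_iff)
        qed
        have x'_inert: "inert (V - ?W) ?H x'"
        proof (rule inert_degree2[OF G' Lx2 2(3)])
          show False if "?L l = {t} \<or> ?L l = {s}" for l using that noleafH by blast
          show False if vf: "v \<noteq> f" "v \<noteq> x'" "f \<noteq> x'" "?L v = {t, s}" "?L f = {t, s}" for v f
          proof -
            have vf': "?L v = ?L x'" "?L f = ?L x'" using vf Lx2 by simp_all
            show False
            proof (cases "v = y \<or> f = y")
              case True
              then have "z \<in> ?L v" "z \<in> ?L f" "z \<in> ?L x'" using vf' Ly by auto
              with nearz[of v] nearz[of f] nearz[of x'] vf x' show False by auto
            next
              case nY: False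
              show False
              proof (cases "v = z \<or> f = z")
                case True
                then have "y \<in> ?L v" "y \<in> ?L f" "y \<in> ?L x'" using vf' Lz by auto
                with neary[of v] neary[of f] neary[of x'] vf x' show False by auto
              next
                case False
                then have "N v = {t, s}" "N f = {t, s}" using nY same'[of v] same'[of f] vf by (metis insert_not_empty)+
                with no_gadget vf show False by blast
              qed
            qed
          qed
          assume L: "?L t = {x', s}" "?L s = {x', t}"
          have yt: "y \<noteq> t" "y \<noteq> s"
          proof -
            have *: False if yc: "?L y = {x', b}" "?L b = {x', y}" for b
            proof -
              from yc(1) Ly x' have b: "b = z" "y' = x'" by (auto simp: doubleton_eq_iff)
              with yc(2) Lz x' yu have "u = x'" by (auto simp: doubleton_eq_iff)
              then have "u = y'" using b by simp
              moreover have "?L u = {y, z}"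
              proof -
                have "y \<in> ?L x'" "z \<in> ?L x'" using nbhd_sym[OF G', of x' y] nbhd_sym[OF G', of x' z] Ly Lz b \<open>u = x'\<close> by auto
                then have "?L x' = {y, z}" using Lx2 ne by auto
                with \<open>u = x'\<close> show ?thesis by simp
              qed
              ultimately show False using cu by simp
            qed
            show "y \<noteq> t" using *[of s] L by auto
            show "y \<noteq> s" using *[of t] L by auto
          qed
          have zt: "z \<noteq> t" "z \<noteq> s" using L Lz yt x' by (auto simp: doubleton_eq_iff)
          have "t \<noteq> x'" "s \<noteq> x'" using 2 by auto
          then have "N t = {x', s}" "N s = {x', t}" using same'[of t] same'[of s] L yt zt by simp_all
          with no_pendant_triangle[of t s x'] show False by (simp add: insert_commute)
        qed
        have "tame (V - ?W) ?H"
        proof (rule tame_delI[OF tame])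
          fix e assume e: "e \<in> V - ?W" "N e \<inter> ?W \<noteq> {}"
          then have "e = y \<or> e = z \<or> e = x'" using aff' by blast
          with y_inert z_inert x'_inert noleafH show "inert (V - ?W) ?H e" by blast
        qed
        with not_tame_deg2[OF w] show False .
      next
        case (1 t)
        \<comment> \<open>Here \<open>x'\<close> becomes the only leaf of the smaller graph, and it
          may meet twins at \<open>t\<close>. A twin of \<open>z\<close> leads to
          \<open>closed1\<close>, a twin of \<open>y\<close> to \<open>closed2\<close>.\<close>
        have Lt: "?L x' = {t}" using Lx' 1 by auto
        have ty: "t \<noteq> y"
        proof
          assume "t = y"
          with no_gadget[of w x y x'] w 1 x' show False by simp
        qed
        have x't: "x' \<in> N t" using 1 sym[of x' t] by simp
        have x'y': "x' \<noteq> y'"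
        proof
          assume "x' = y'" with yy' 1 xy ty show False by auto
        qed
        have closed1: False if t: "t = u" and y'N: "N y' = {u, y}"
        proof -
          have yu': "y' \<in> N u" using y'N sym[of y' u] by simp
          have "N u = {x', z, y'}" using N3[of x' z y' u] x't t uz yu' x'y' zy' x' by auto
          note u3 = this
          let ?X = "{w, x, y, z, u, x', y'}" and ?D = "{x, y, u}"
          have x'N: "N x' = {x, u}" using 1 t by simp
          have uu: "u \<noteq> x'" "u \<noteq> y'" "u \<noteq> z" using u3 irr[of u] by auto
          have cl: "N w \<subseteq> ?X" "N x \<subseteq> ?X" "N y \<subseteq> ?X" "N z \<subseteq> ?X" "N u \<subseteq> ?X" "N x' \<subseteq> ?X" "N y' \<subseteq> ?X"
            unfolding w x y u(3) u3 x'N y'N by auto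
          have nE: "N w \<noteq> {}" "N x \<noteq> {}" "N y \<noteq> {}" "N z \<noteq> {}" "N u \<noteq> {}" "N x' \<noteq> {}" "N y' \<noteq> {}"
            unfolding w x y u(3) u3 x'N y'N by auto
          show False
          proof (rule not_closed[of ?X ?D])
            show "2 * card ?D \<le> card ?X" using xy ne wz u uw uu x' x'x x'y' y' y'y by (auto simp: card_insert_if)
            show "N e \<subseteq> ?X" if "e \<in> ?X" for e using that cl by blast
            show "N e \<noteq> {}" if "e \<in> ?X" for e using that nE by blast
            fix e assume "e \<in> ?X - ?D"
            then have e: "e = w \<or> e = z \<or> e = x' \<or> e = y'" by blast
            have "x \<in> N w" "x \<in> N z" "x \<in> N x'" "y \<in> N y'" unfolding w u(3) x'N y'N by auto
            with e have "x \<in> N e \<or> y \<in> N e" by metis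
            then show "N e \<inter> ?D \<noteq> {}" by blast
            fix e' assume "e' \<in> ?X - ?D" and eq: "N e \<inter> ?D = N e' \<inter> ?D"
            then have e': "e' = w \<or> e' = z \<or> e' = x' \<or> e' = y'" by blast
            have m: "(x \<in> N e) = (x \<in> N e')" "(y \<in> N e) = (y \<in> N e')" "(u \<in> N e) = (u \<in> N e')" using eq by blast+
            have f: "x \<in> N w" "y \<in> N w" "u \<notin> N w" "x \<in> N z" "y \<in> N z" "u \<in> N z" "x \<in> N x'" "y \<notin> N x'" "u \<in> N x'"
              "x \<notin> N y'" "y \<in> N y'" "u \<in> N y'"
              unfolding w u(3) x'N y'N using xy u by auto
            show "e = e'" using e e' m f by metis
          qed auto
        qed
        have closed2: False if t: "t = y'" and uN: "N u = {z, y'}"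
        proof -
          have uy': "u \<in> N y'" using uN sym[of u y'] by simp
          have ux': "u \<noteq> x'"
          proof
            assume "u = x'"
            then have "z \<in> {x, t}" using uN 1 by blast
            with t ne zy' show False by simp
          qed
          have y'N: "N y' = {y, u, x'}" using N3[of y u x' y'] yy' uy' x't t yu x' ux' by auto
          let ?X = "{w, x, y, z, u, x', y'}" and ?D = "{w, z, y'}"
          have x'N: "N x' = {x, y'}" using 1 t by simp
          have uu: "u \<noteq> y'" "u \<noteq> z" using uN irr[of u] by auto
          have cl: "N w \<subseteq> ?X" "N x \<subseteq> ?X" "N y \<subseteq> ?X" "N z \<subseteq> ?X" "N u \<subseteq> ?X" "N x' \<subseteq> ?X" "N y' \<subseteq> ?X"
            unfolding w x y u(3) uN x'N y'N by auto
          have nE: "N w \<noteq> {}" "N x \<noteq> {}" "N y \<noteq> {}" "N z \<noteq> {}" "N u \<noteq> {}" "N x' \<noteq> {}" "N y' \<noteq> {}"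
            unfolding w x y u(3) uN x'N y'N by auto
          show False
          proof (rule not_closed[of ?X ?D])
            show "2 * card ?D \<le> card ?X" using xy ne wz u uw uu x' x'x x'y' y' y'y ux' by (auto simp: card_insert_if)
            show "N e \<subseteq> ?X" if "e \<in> ?X" for e using that cl by blast
            show "N e \<noteq> {}" if "e \<in> ?X" for e using that nE by blast
            fix e assume "e \<in> ?X - ?D"
            then have e: "e = x \<or> e = y \<or> e = u \<or> e = x'" by blast
            have "w \<in> N x" "w \<in> N y" "z \<in> N u" "y' \<in> N x'" unfolding x y uN x'N by auto
            with e have "w \<in> N e \<or> z \<in> N e \<or> y' \<in> N e" by metis
            then show "N e \<inter> ?D \<noteq> {}" by blast
            fix e' assume "e' \<in> ?X - ?D" and eq: "N e \<inter> ?D = N e' \<inter> ?D"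
            then have e': "e' = x \<or> e' = y \<or> e' = u \<or> e' = x'" by blast
            have m: "(w \<in> N e) = (w \<in> N e')" "(z \<in> N e) = (z \<in> N e')" "(y' \<in> N e) = (y' \<in> N e')" using eq by blast+
            have f: "w \<in> N x" "z \<in> N x" "y' \<notin> N x" "w \<in> N y" "z \<in> N y" "y' \<in> N y" "w \<notin> N u" "z \<in> N u" "y' \<in> N u"
              "w \<notin> N x'" "z \<notin> N x'" "y' \<in> N x'"
              unfolding x y uN x'N using x' x'y' y' wz ne by auto
            show "e = e'" using e e' m f by metis
          qed auto
        qed
        have ky: False if v: "v \<noteq> y" "?L v = {z, y'}" and tt: "t = z \<or> t = y'" for v
        proof -
          have "v = u" using nearz[of v] v by simp
          moreover have "v \<noteq> x'" using v(2) Lt zy' by (auto simp: doubleton_eq_iff)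
          moreover have "u \<noteq> z" using uz irr by metis
          ultimately have uN: "N u = {z, y'}" using same'[of u] v yu by simp
          from tt show False
          proof
            assume "t = z"
            then have "x' \<in> N z" using x't by simp
            with u x' x'x have "x' = u" by auto
            with \<open>v = u\<close> \<open>v \<noteq> x'\<close> show False by simp
          next
            assume "t = y'" with closed2 uN show False by simp
          qed
        qed
        have kz: False if v: "v \<noteq> z" "?L v = {y, u}" and tt: "t = y \<or> t = u" for v
        proof -
          have tu: "t = u" using tt ty by simp
          have "v = y'" using neary[of v] v by simp
          then have "N y' = {u, y}" using same'[of y'] v y'y zy' x'y' by auto
          with closed1 tu show False by simp
        qed
        have "inert (V - ?W) ?H y"
        proof (rule y_inert)
          fix v l assume v: "v \<noteq> y" "?L v = {z, y'}" and l: "?L l = {z} \<or> ?L l = {y'}"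
          have "l = x'" using leafH l by blast
          then have "t = z \<or> t = y'" using l Lt by auto
          with ky v show False by blast
        qed
        moreover have "inert (V - ?W) ?H z"
        proof (rule z_inert)
          fix v l assume v: "v \<noteq> z" "?L v = {y, u}" and l: "?L l = {y} \<or> ?L l = {u}"
          have "l = x'" using leafH l by blast
          then have "t = y \<or> t = u" using l Lt by auto
          with kz v show False by blast
        qed
        moreover have "inert (V - ?W) ?H x'"
        proof (rule inert_leaf[OF G' Lt])
          show "e = x'" if "?L e = {t}" for e using leafH that by blast
          fix g h k assume gh: "?L g = {t, k}" "?L h = {t, k}"
          show "g = h"
          proof (cases "k = t")
            case True
            with gh have "?L g = {t}" "?L h = {t}" by simp_all
            from leafH[OF this(1)] leafH[OF this(2)] show ?thesis by simp
          next
            case False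
            then have "{t, k} \<noteq> {t}" by auto
            then have ghx: "g \<noteq> x'" "h \<noteq> x'" using gh Lt by metis+
            have sub: "g = h" if gh: "?L g = {t, k}" "?L h = {t, k}" and gy: "g = y \<or> g = z" for g h
            proof (rule ccontr)
              assume "g \<noteq> h"
              from gy show False
              proof
                assume gy: "g = y"
                then have "{t, k} = {z, y'}" using gh Ly by simp
                then have "t = z \<or> t = y'" "?L h = {z, y'}" using gh by (auto simp: doubleton_eq_iff)
                with ky[of h] gy \<open>g \<noteq> h\<close> show False by blast
              next
                assume gz: "g = z"
                then have "{t, k} = {y, u}" using gh Lz by simp
                then have "t = y \<or> t = u" "?L h = {y, u}" using gh by (auto simp: doubleton_eq_iff)
                with kz[of h] gz \<open>g \<noteq> h\<close> show False by blast
              qed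
            qed
            show ?thesis
            proof (cases "g = y \<or> g = z \<or> h = y \<or> h = z")
              case True
              with sub[OF gh] sub[OF gh(2,1)] show ?thesis by metis
            next
              case False
              then have "N g = {t, k}" "N h = {t, k}" using same'[of g] same'[of h] gh ghx by (metis insert_not_empty)+
              then show ?thesis by (rule no_gadget)
            qed
          qed
        qed
        ultimately have "tame (V - ?W) ?H"
          using aff' tame_delI[OF tame, of ?W] by blast
        with not_tame_deg2[OF w] show False by blast
      qed
    qed
  qed
  have w': "N w = {y, x}" and u': "N z = {y, x, u}" using w u by auto
  show False
  proof (cases "x \<in> N y")
    case True
    then have yx: "y \<in> N x" using sym by blast
    \<comment> \<open>Now \<open>x\<close> and \<open>y\<close> have no neighbours beyond these, and
      after the deletion \<open>y\<close> is a leaf at \<open>z\<close>.\<close>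
    have x: "N x = {w, y, z}" and y: "N y = {w, x, z}"
      using N3[of w y z x] N3[of w x z y] i z True yx ne xy by auto
    let ?W = "{w, x}" let ?H = "del ?W E" let ?L = "nbhd ?H"
    have G': "graph (V - ?W) ?H" using G by (rule graph_del)
    have Ly: "?L y = {z}" using y ne xy wz by (auto simp: nbhd_del)
    have Lz: "?L z = {y, u}" using u ne xy wz uw by (auto simp: nbhd_del)
    have yu: "y \<noteq> u" using u by simp
    have aff: "e = y \<or> e = z" if "e \<notin> ?W" "N e \<inter> ?W \<noteq> {}" for e
    proof -
      have "e \<in> N w \<or> e \<in> N x" using sym that by blast
      with w x that(1) show ?thesis by auto
    qed
    have same: "?L e = N e" if "e \<noteq> y" "e \<noteq> z" "?L e \<noteq> {}" for e
      using aff[of e] that by (auto simp: nbhd_del split: if_splits)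
    have one: "e = y" if "?L e = {z}" for e
    proof (rule ccontr)
      assume "e \<noteq> y"
      moreover have "{z} \<noteq> {y, u}" using yu by auto
      then have "e \<noteq> z" using that Lz by metis
      ultimately have "N e = {z}" using same[of e] that by simp
      with no_leaf show False by blast
    qed
    have "inert (V - ?W) ?H y"
    proof (rule inert_leaf[OF G' Ly one])
      fix g h k assume gh: "?L g = {z, k}" "?L h = {z, k}"
      show "g = h"
      proof (cases "k = z")
        case True
        with gh have "?L g = {z}" "?L h = {z}" by simp_all
        from one[OF this(1)] one[OF this(2)] show ?thesis by simp
      next
        case False
        then have "{z, k} \<noteq> {z}" by auto
        then have "g \<noteq> y" "h \<noteq> y" using gh Ly by metis+
        moreover have "g \<noteq> z" "h \<noteq> z" using gh nbhd_irrefl[OF G', of z] by auto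
        ultimately have "N g = {z, k}" "N h = {z, k}" using same[of g] same[of h] gh by (metis insert_not_empty)+
        then show ?thesis by (rule no_gadget)
      qed
    qed
    moreover have "inert (V - ?W) ?H z"
    proof (rule inert2[OF G' Lz yu])
      fix e assume "?L e = {y, u}"
      then have "e \<in> ?L y" using nbhd_sym[OF G', of e y] by simp
      with Ly show "e = z" by simp
    next
      assume "?L y = {z, u}"
      with Ly u show False by (auto simp: doubleton_eq_iff)
    qed
    ultimately have "tame (V - ?W) ?H"
      using aff tame_delI[OF tame, of ?W] by blast
    with not_tame_deg2[OF w] show False .
  next
    case xNy: False
    then have yNx: "y \<notin> N x" using sym by blast
    have xs: "N x = {w, z} \<or> (\<exists>x'. N x = {w, z, x'} \<and> x' \<noteq> w \<and> x' \<noteq> z \<and> x' \<noteq> y)"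
      using N2[OF wz i(1) z(2)] yNx by (metis insertI1 insertI2 singletonI)
    have ys: "N y = {w, z} \<or> (\<exists>y'. N y = {w, z, y'} \<and> y' \<noteq> w \<and> y' \<noteq> z \<and> y' \<noteq> x)"
      using N2[OF wz i(2) z(3)] xNy by (metis insertI1 insertI2 singletonI)
    from ys show False
    proof (elim disjE exE conjE)
      fix y' assume "N y = {w, z, y'}" "y' \<noteq> w" "y' \<noteq> z" "y' \<noteq> x"
      from core[OF w xy i(1,2) ne z(2,3) u(1,2,4) this xs] show False .
    next
      assume y: "N y = {w, z}"
      from xs show False
      proof (elim disjE exE conjE)
        assume "N x = {w, z}"
        with no_gadget y xy show False by blast
      next
        fix x' assume "N x = {w, z, x'}" "x' \<noteq> w" "x' \<noteq> z" "x' \<noteq> y"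
        from core[OF w' xy[symmetric] i(2,1) ne(2,1,4,3) z(3,2) u(2,1) u' this] y show False by blast
      qed
    qed
  qed
qed

end

subsection \<open>Cubic graphs\<close>

lemma del_edge_commute: "del_edge u v E = del_edge v u E"
  unfolding del_edge_def by (auto simp: fun_eq_iff)

context mincex begin

lemma cubic:
  assumes "b \<in> N v"
  obtains c d where "N v = {b, c, d}" "distinct [v, b, c, d]"
  using assms
proof (cases rule: card_ge2)
  case (1 c) with no_deg2 show thesis by blast
next
  case (2 c d)
  with assms irr[of v] that[of c d] show thesis by auto
qed

lemma cubic2:
  assumes "b \<in> N v" "c \<in> N v" "b \<noteq> c"
  obtains d where "N v = {b, c, d}" "distinct [v, b, c, d]"
proof -
  from N2[OF assms(3,1,2)] show thesis
  proof cases
    case 1 with no_deg2 show thesis by blast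
  next
    case (2 d) with assms irr[of v] that[of d] show thesis by auto
  qed
qed

text \<open>After the deletion \<open>u\<close> and \<open>v\<close> are the only vertices of degree
  two, and there are no leaves. A violation through \<open>u\<close> would need a leaf or three
  vertices of degree two.\<close>

lemma inert_del_edge:
  assumes uv: "v \<in> N u" shows "inert V (del_edge u v E) u"
proof -
  let ?M = "nbhd (del_edge u v E)"
  have G': "graph V (del_edge u v E)" using G by (rule graph_del_edge)
  obtain b c where u: "N u = {v, b, c}" "distinct [u, v, b, c]" using cubic[OF uv] .
  obtain b' c' where v: "N v = {u, b', c'}" "distinct [v, u, b', c']" using cubic[of u v] uv sym by blast
  have Mu: "?M u = {b, c}" and Mv: "?M v = {b', c'}" using u v by (auto simp: nbhd_del_edge)
  have M: "?M e = N e" if "e \<noteq> u" "e \<noteq> v" for e using that by (simp add: nbhd_del_edge)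
  have bc: "b \<noteq> c" "b' \<noteq> c'" using u v by auto
  have leaf: "?M l \<noteq> {p}" for l p
  proof
    assume l: "?M l = {p}"
    have "l \<noteq> u" "l \<noteq> v" using l Mu Mv bc by (metis doubleton_eq_iff insert_absorb2)+
    with M l no_leaf show False by metis
  qed
  show ?thesis
  proof (rule inert_degree2[OF G' Mu bc(1)])
    fix f g assume *: "f \<noteq> g" "f \<noteq> u" "g \<noteq> u" "?M f = {b, c}" "?M g = {b, c}"
    then have "N f = {b, c} \<or> N g = {b, c}" using M by metis
    with no_deg2 bc show False by blast
  next
    assume "?M b = {u, c}"
    then have "N b = {u, c}" using M[of b] u by auto
    with no_deg2 u show False by auto
  qed (use leaf in blast)
qed

lemma edge_in_square:
  assumes uv: "v \<in> N u"
  obtains s t where "s \<in> N v" "s \<noteq> u" "t \<in> N s" "t \<noteq> v" "t \<in> N u"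
proof (rule ccontr)
  assume no: "\<not> thesis"
  have "u \<in> N v" using uv sym by blast
  from not_tame_del_edge[OF uv _ inert_del_edge[OF uv]] inert_del_edge[OF this] no that show False
    unfolding del_edge_commute[of v u] by (metis sym)
qed

section \<open>Triangles in a cubic graph and the prism\<close>

lemma no_diamond:
  assumes a: "N a = {b, c, k}" and b: "N b = {a, c, m}" and c: "N c = {a, b, k}"
    and d: "distinct [a, b, c, k]" "distinct [a, b, c, m]" and km: "k \<noteq> m"
  shows False
proof -
  have i: "b \<in> N m" "m \<in> N b" "a \<in> N k" "c \<in> N k" using a b c sym[of b m] sym[of a k] sym[of c k] by auto
  have nm: "m \<notin> N a" "m \<notin> N c" unfolding a c using d km by auto
  \<comment> \<open>The square on the edge \<open>bm\<close> returns to \<open>b\<close> through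
    \<open>a\<close> or \<open>c\<close>, whose only neighbour outside the triangle is
    \<open>k\<close>.\<close>
  have mk: "m \<in> N k"
  proof -
    obtain s t where s: "s \<in> N m" "s \<noteq> b" "t \<in> N s" "t \<noteq> m" "t \<in> N b" using edge_in_square[OF i(2)] .
    then have "t = a \<or> t = c" using b by auto
    then have "s = k \<or> s = a \<or> s = c" using s a c sym[of t s] by auto
    with s nm sym show ?thesis by blast
  qed
  have km': "k \<in> N m" using mk sym by blast
  have k: "N k = {a, c, m}" using N3[of a c m k] i mk d by auto
  have "b \<noteq> k" using d by simp
  from cubic2[OF i(1) km' this] obtain j where m: "N m = {b, k, j}" "distinct [m, b, k, j]" .
  \<comment> \<open>By now \<open>j\<close> is joined to \<open>a\<close>, \<open>b\<close>,
    \<open>c\<close>, \<open>k\<close>, \<open>m\<close> through \<open>m\<close> alone, so the edge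
    \<open>mj\<close> lies in no square.\<close>
  have mj: "j \<in> N m" using m by simp
  obtain s t where s: "s \<in> N j" "s \<noteq> m" "t \<in> N s" "t \<noteq> j" "t \<in> N m" using edge_in_square[OF mj] .
  then have "t = b \<or> t = k" using m by auto
  then have "s \<in> {a, c}" using s b k sym[of t s] by auto
  then have "j \<in> N a \<or> j \<in> N c" using s sym by auto
  moreover have "j \<notin> {b, k}" using m by auto
  moreover have "j \<noteq> a" "j \<noteq> c" using mj nm sym by metis+
  ultimately show False using a c by auto
qed

text \<open>The square on the edge \<open>ab\<close> avoids \<open>c\<close>, which is adjacent to
  neither \<open>a'\<close> nor \<open>b'\<close>; so its opposite side is
  \<open>a'b'\<close>.\<close>

lemma tails_adjacent:
  assumes a: "N a = {b, c, a'}" and b: "N b = {a, c, b'}" and c: "N c = {a, b, c'}"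
    and d: "distinct [a, b, c, a']" "distinct [a, b, c, b']" "distinct [a, b, c, c']" "distinct [a', b', c']"
  shows "a' \<in> N b'"
proof -
  have "b \<in> N a" using a by simp
  then obtain s t where s: "s \<in> N b" "s \<noteq> a" "t \<in> N s" "t \<noteq> b" "t \<in> N a" using edge_in_square by metis
  have nc: "b' \<notin> N c" "a' \<notin> N c" using c d by auto
  have "s = c \<or> s = b'" using s b by auto
  moreover have "t = c \<or> t = a'" using s a by auto
  moreover have "c \<notin> N c" using irr .
  ultimately show ?thesis using s(3) nc sym by metis
qed

text \<open>Exactly two equal third neighbours give a diamond and three equal ones a tetrahedron.
  Distinct ones are pairwise adjacent and complete a prism.\<close>

lemma no_K3:
  assumes "a \<in> N b" "b \<in> N c" "c \<in> N a" shows False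
proof -
  have s: "b \<in> N a" "c \<in> N b" "a \<in> N c" using assms sym by blast+
  have ne: "a \<noteq> b" "b \<noteq> c" "c \<noteq> a" using assms irr by metis+
  from cubic2[OF s(1) assms(3) ne(2)] obtain a' where a: "N a = {b, c, a'}" "distinct [a, b, c, a']" .
  from cubic2[OF assms(1) s(2) ne(3)[symmetric]] obtain b' where b: "N b = {a, c, b'}" "distinct [b, a, c, b']" .
  from cubic2[OF s(3) assms(2) ne(1)] obtain c' where c: "N c = {a, b, c'}" "distinct [c, a, b, c']" .
  have d: "distinct [a, b, c, a']" "distinct [a, b, c, b']" "distinct [a, b, c, c']" using a b c by auto
  have i: "a \<in> N a'" "b \<in> N b'" "c \<in> N c'" using a b c sym[of a a'] sym[of b b'] sym[of c c'] by auto
  have p: "N a = {c, b, a'}" "N b = {c, a, b'}" "N c = {b, a, c'}" using a b c by auto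
  consider "a' = b'" "b' = c'" | "a' = b'" "c' \<noteq> a'" | "b' = c'" "a' \<noteq> b'" | "c' = a'" "b' \<noteq> c'" | "distinct [a', b', c']" by auto
  then show False
  proof cases
    case 1
    then have "N a' = {a, b, c}" using N3[of a b c a'] i d by auto
    with no_tetrahedron[of a b c a'] a b c 1 show False by simp
  next
    case 2
    show False by (rule no_diamond[of a c b a' c']) (use p(1) c b 2 d in auto)
  next
    case 3
    show False by (rule no_diamond[of b a c b' a']) (use b a p 3 d in auto)
  next
    case 4
    show False by (rule no_diamond[of a b c a' b']) (use b a c p 4 d in auto)
  next
    case 5
    have "a' \<in> N b'" by (rule tails_adjacent[OF a(1) b(1) c(1) d 5])
    moreover have "b' \<in> N c'" by (rule tails_adjacent[OF p(2,3) a(1)]) (use d 5 in auto)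
    moreover have "c' \<in> N a'" by (rule tails_adjacent[OF c(1) p(1,2)]) (use d 5 in auto)
    ultimately have j: "a' \<in> N b'" "b' \<in> N a'" "b' \<in> N c'" "c' \<in> N b'" "c' \<in> N a'" "a' \<in> N c'" using sym by blast+
    have n: "a \<notin> N b'" "a \<notin> N c'" "b \<notin> N a'" "b \<notin> N c'" "c \<notin> N a'" "c \<notin> N b'"
      using sym[of a b'] sym[of a c'] sym[of b a'] sym[of b c'] sym[of c a'] sym[of c b'] a b c 5 by auto
    have ne': "a \<noteq> b'" "a \<noteq> c'" "b \<noteq> a'" "b \<noteq> c'" "c \<noteq> a'" "c \<noteq> b'" using d by auto
    have a': "N a' = {a, b', c'}" using N3[of a b' c' a'] i j ne' 5 by auto
    have b': "N b' = {b, a', c'}" using N3[of b a' c' b'] i j ne' 5 by auto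
    have c': "N c' = {c, a', b'}" using N3[of c a' b' c'] i j ne' 5 by auto
    \<comment> \<open>In the prism \<open>c'\<close> dominates the other three vertices, and the
      codes of \<open>c\<close>, \<open>a'\<close>, \<open>b'\<close> are \<open>{a, b, c'}\<close>,
      \<open>{a, c'}\<close>, \<open>{b, c'}\<close>.\<close>
    let ?W = "{a, b, c, a', b', c'}" and ?D = "{a, b, c'}"
    have cl: "N a \<subseteq> ?W" "N b \<subseteq> ?W" "N c \<subseteq> ?W" "N a' \<subseteq> ?W" "N b' \<subseteq> ?W" "N c' \<subseteq> ?W"
      unfolding a b c a' b' c' by auto
    have nE: "N a \<noteq> {}" "N b \<noteq> {}" "N c \<noteq> {}" "N a' \<noteq> {}" "N b' \<noteq> {}" "N c' \<noteq> {}"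
      unfolding a b c a' b' c' by auto
    have f: "a \<in> N c" "b \<in> N c" "c' \<in> N c" "a \<in> N a'" "b \<notin> N a'" "c' \<in> N a'" "a \<notin> N b'" "b \<in> N b'" "c' \<in> N b'"
      using i j n c by auto
    show False
    proof (rule not_closed[of ?W ?D])
      show "2 * card ?D \<le> card ?W" using d 5 by (auto simp: card_insert_if)
      show "N e \<subseteq> ?W" if "e \<in> ?W" for e using that cl by blast
      show "N e \<noteq> {}" if "e \<in> ?W" for e using that nE by blast
      fix e assume "e \<in> ?W - ?D"
      then have e: "e = c \<or> e = a' \<or> e = b'" by blast
      then have "c' \<in> N e" using f by metis
      then show "N e \<inter> ?D \<noteq> {}" by blast
      fix e' assume "e' \<in> ?W - ?D" and eq: "N e \<inter> ?D = N e' \<inter> ?D"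
      then have e': "e' = c \<or> e' = a' \<or> e' = b'" by blast
      have m: "(a \<in> N e) = (a \<in> N e')" "(b \<in> N e) = (b \<in> N e')" using eq by blast+
      show "e = e'" using e e' m f by metis
    qed auto
  qed
qed

section \<open>Triangle-free cubic graphs and the cube\<close>

lemma two_squares:
  assumes wx: "x \<in> N w"
  obtains y z t v where "N w = {x, y, z}" "N x = {w, t, v}" "distinct [x, y, z]" "distinct [w, t, v]" "t \<in> N z" "v \<in> N y"
proof -
  let ?W = "{w, x}" let ?H = "del ?W E" let ?M = "nbhd ?H"
  have G': "graph (V - ?W) ?H" using G by (rule graph_del)
  \<comment> \<open>A new leaf would have lost both \<open>w\<close> and \<open>x\<close> and would
    form a triangle with them.\<close>
  have leaf: "?M l \<noteq> {p}" for l p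
  proof
    assume l: "?M l = {p}"
    then have lW: "l \<notin> ?W" by (auto simp: nbhd_del)
    with l have l': "N l - {w, x} = {p}" by (simp add: nbhd_del)
    then have pl: "p \<in> N l" by blast
    obtain c d where N: "N l = {p, c, d}" "distinct [l, p, c, d]" using cubic[OF pl] .
    then have "c \<in> N l" "d \<in> N l" "c \<noteq> p" "d \<noteq> p" by auto
    then have "c \<in> {w, x}" "d \<in> {w, x}" using l' by blast+
    with N have "w \<in> N l" "x \<in> N l" by auto
    with wx no_K3[of l x w] sym show False by blast
  qed
  have third: "\<exists>r\<in>{w, x}. N f = {r, b, c}" if M: "?M f = {b, c}" and ne: "b \<noteq> c" for f b c
  proof -
    have fW: "f \<notin> ?W" using M by (auto simp: nbhd_del)
    with M have f: "N f - {w, x} = {b, c}" by (simp add: nbhd_del)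
    then have "b \<in> N f" "c \<in> N f" by blast+
    then obtain d where d: "N f = {b, c, d}" "distinct [f, b, c, d]" using cubic2 ne by metis
    then have "d \<in> N f" "d \<notin> {b, c}" by auto
    with f have "d \<in> {w, x}" by blast
    with d show ?thesis by (auto simp: insert_commute)
  qed
  have "tame (V - ?W) ?H"
  proof (rule tame_delI[OF tame])
    fix e assume e: "e \<in> V - ?W" "N e \<inter> ?W \<noteq> {}"
    then obtain r where r: "r \<in> ?W" "r \<in> N e" by blast
    obtain b c where N: "N e = {r, b, c}" "distinct [e, r, b, c]" using cubic[OF r(2)] .
    have bc: "b \<noteq> c" using N by simp
    have "b \<notin> ?W" "c \<notin> ?W" using N r wx no_K3[of e x w] sym[of e x] sym[of w e] by auto
    then have Me: "?M e = {b, c}" using N r e by (auto simp: nbhd_del)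
    have ebc: "b \<in> N e" "c \<in> N e" using N by auto
    show "inert (V - ?W) ?H e"
    proof (rule inert_degree2[OF G' Me bc])
      fix f g assume fg: "f \<noteq> g" "f \<noteq> e" "g \<noteq> e" "?M f = {b, c}" "?M g = {b, c}"
      obtain p q where p: "p \<in> ?W" "N f = {p, b, c}" and q: "q \<in> ?W" "N g = {q, b, c}"
        using third[OF fg(4) bc] third[OF fg(5) bc] by blast
      \<comment> \<open>Each of \<open>e\<close>, \<open>f\<close>, \<open>g\<close> has lost
        \<open>w\<close> or \<open>x\<close>, so two of them have lost the same vertex and were
        twins of degree three.\<close>
      have "distinct [p, b, c]" "distinct [q, b, c]" "distinct [r, b, c]" using p q r \<open>b \<notin> ?W\<close> \<open>c \<notin> ?W\<close> bc by auto
      then have "p \<noteq> q" "p \<noteq> r" "q \<noteq> r" using no_twins3 p q N fg by metis+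
      with p q r show False by auto
    next
      assume "?M b = {e, c}"
      then have "c \<in> N b" by (auto simp: nbhd_del split: if_splits)
      with no_K3[of e b c] ebc sym show False by blast
    qed (use leaf in blast)
  qed
  then obtain y z t v where *: "y \<in> N w" "z \<in> N w" "distinct [x, y, z]" "t \<in> N x" "v \<in> N x" "distinct [w, t, v]"
    "t \<in> N z" "v \<in> N y"
    using not_tame_edge[OF wx] by metis
  have "w \<in> N x" using wx sym by blast
  with * wx N3[of x y z w] N3[of w t v x] that show thesis by metis
qed

text \<open>The cube is a component in which \<open>p\<close> and \<open>d\<close> are antipodal.
  With respect to the three neighbours of \<open>p\<close> together with \<open>d\<close>, the codes
  of \<open>p\<close>, \<open>a\<close>, \<open>b\<close>, \<open>c\<close> are
  \<open>{x, y, z}\<close>, \<open>{x, y, d}\<close>, \<open>{x, z, d}\<close>,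
  \<open>{y, z, d}\<close>.\<close>

lemma no_cube:
  assumes 0: "N p = {x, y, z}" and x: "N x = {p, a, b}" and y: "N y = {p, a, c}" and z: "N z = {p, b, c}"
    and a: "N a = {x, y, d}" and b: "N b = {x, z, d}" and c: "N c = {y, z, d}"
    and ne: "distinct [p, x, y, z, a, b, c, d]"
  shows False
proof -
  have "a \<in> N d" "b \<in> N d" "c \<in> N d" using a b c sym[of a d] sym[of b d] sym[of c d] by auto
  then have d: "N d = {a, b, c}" using N3[of a b c d] ne by auto
  let ?W = "{p, x, y, z, a, b, c, d}" and ?D = "{x, y, z, d}"
  have cl: "N p \<subseteq> ?W" "N x \<subseteq> ?W" "N y \<subseteq> ?W" "N z \<subseteq> ?W" "N a \<subseteq> ?W" "N b \<subseteq> ?W" "N c \<subseteq> ?W" "N d \<subseteq> ?W"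
    unfolding 0 x y z a b c d by auto
  have nE: "N p \<noteq> {}" "N x \<noteq> {}" "N y \<noteq> {}" "N z \<noteq> {}" "N a \<noteq> {}" "N b \<noteq> {}" "N c \<noteq> {}" "N d \<noteq> {}"
    unfolding 0 x y z a b c d by auto
  have f: "x \<in> N p" "y \<in> N p" "z \<in> N p" "x \<in> N a" "y \<in> N a" "z \<notin> N a" "x \<in> N b" "y \<notin> N b" "z \<in> N b"
    "x \<notin> N c" "y \<in> N c" "z \<in> N c" unfolding 0 a b c using ne by auto
  show False
  proof (rule not_closed[of ?W ?D])
    show "2 * card ?D \<le> card ?W" using ne by simp
    show "N e \<subseteq> ?W" if "e \<in> ?W" for e using that cl by blast
    show "N e \<noteq> {}" if "e \<in> ?W" for e using that nE by blast
    fix e assume "e \<in> ?W - ?D"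
    then have e: "e = p \<or> e = a \<or> e = b \<or> e = c" by blast
    then have "x \<in> N e \<or> y \<in> N e" using f by metis
    then show "N e \<inter> ?D \<noteq> {}" by blast
    fix e' assume "e' \<in> ?W - ?D" and eq: "N e \<inter> ?D = N e' \<inter> ?D"
    then have e': "e' = p \<or> e' = a \<or> e' = b \<or> e' = c" by blast
    have m: "(x \<in> N e) = (x \<in> N e')" "(y \<in> N e) = (y \<in> N e')" "(z \<in> N e) = (z \<in> N e')" using eq by blast+
    show "e = e'" using e e' m f by metis
  qed auto
qed

text \<open>By \<open>two_squares\<close>, edges match \<open>{y, z}\<close> with
  \<open>{t, v}\<close> in one of two ways; one missing edge decides which.\<close>

lemma square_beside:
  assumes "N w = {x, y, z}" "N x = {w, t, v}" "distinct [x, y, z]" "distinct [w, t, v]" "t \<notin> N z"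
  shows "t \<in> N y" "v \<in> N z"
proof -
  have "x \<in> N w" using assms by simp
  then obtain y' z' t' v' where *: "N w = {x, y', z'}" "N x = {w, t', v'}" "distinct [x, y', z']" "distinct [w, t', v']" "t' \<in> N z'" "v' \<in> N y'"
    by (rule two_squares)
  then have "y' = y \<and> z' = z \<or> y' = z \<and> z' = y" using assms by (auto simp: insert_eq_iff doubleton_eq_iff)
  moreover have "t' = t \<and> v' = v \<or> t' = v \<and> v' = t" using assms * by (auto simp: insert_eq_iff doubleton_eq_iff)
  ultimately show "t \<in> N y" "v \<in> N z" using * assms(5) by metis+
qed

text \<open>The edge \<open>px\<close> yields the squares \<open>p x a y\<close> and
  \<open>p x b z\<close>. As twins are excluded, enough edges are missing to determine the squares
  at \<open>py\<close>, \<open>xa\<close> and \<open>ya\<close> by \<open>square_beside\<close>, and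
  they complete a cube.\<close>

lemma no_edge: "x \<notin> N p"
proof
  assume "x \<in> N p"
  then obtain y z b a where p: "N p = {x, y, z}" "distinct [x, y, z]" and x: "N x = {p, b, a}" "distinct [p, b, a]"
    and i: "b \<in> N z" "a \<in> N y" using two_squares by metis
  have ip: "p \<in> N x" "p \<in> N y" "p \<in> N z" "x \<in> N a" "x \<in> N b" "y \<in> N a" "z \<in> N b"
    using p x i sym[of p y] sym[of p z] sym[of x a] sym[of x b] sym[of y a] sym[of z b] by auto
  have xyz: "x \<in> N p" "y \<in> N p" "z \<in> N p" using p by auto
  have K: "x \<notin> N y" "x \<notin> N z" "y \<notin> N z" using no_K3[of x y p] no_K3[of x z p] no_K3[of y z p] ip xyz by blast+
  then have K': "y \<notin> N x" "z \<notin> N x" "z \<notin> N y" using sym by blast+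
  have pne: "x \<noteq> p" "y \<noteq> p" "z \<noteq> p" using xyz irr by metis+
  have ab: "a \<noteq> p" "b \<noteq> p" "a \<noteq> b" using x by auto
  have iab: "a \<in> N x" "b \<in> N x" using x by auto
  have abx: "a \<noteq> x" "b \<noteq> x" "a \<noteq> y" "b \<noteq> y" "a \<noteq> z" "b \<noteq> z" using iab K' irr by metis+
  have az: "a \<notin> N z"
  proof
    assume "a \<in> N z"
    then have "z \<in> N a" using sym by blast
    then have "N a = {x, y, z}" using N3[of x y z a] p ip by simp
    from no_twins3[OF this p] ab show False by simp
  qed
  have za: "z \<notin> N a" using az sym by blast
  obtain c where y: "N y = {p, a, c}" "distinct [y, p, a, c]" using cubic2[OF ip(2) i(2) ab(1)[symmetric]] .
  have iy: "c \<in> N y" using y by simp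
  have cx: "c \<noteq> x" "c \<noteq> y" "c \<noteq> z" using iy K K' irr by metis+
  have bc: "b \<noteq> c"
  proof
    assume "b = c"
    then have y': "N y = {p, b, a}" using y by auto
    from no_twins3[OF x(1) y' x(2)] p show False by simp
  qed
  have cz: "c \<in> N z" by (rule square_beside(2)[of p y x z a c]) (use p y az in auto)
  have z: "N z = {p, b, c}" using N3[of p b c z] ip i cz x y bc by auto
  have ic: "y \<in> N c" "z \<in> N c" using iy cz sym by blast+
  obtain d where a: "N a = {x, y, d}" "distinct [a, x, y, d]" using cubic2[OF ip(4,6)] p by auto
  have dz: "d \<noteq> z" using za a by auto
  have "b \<notin> N y" unfolding y using ab bc by auto
  then have yb: "y \<notin> N b" using sym by blast
  have "c \<notin> N x" unfolding x using y bc by auto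
  then have xc: "x \<notin> N c" using sym by blast
  have db: "d \<in> N b" by (rule square_beside(2)[of x a p b y d]) (use x a yb abx ab in auto)
  have dc: "d \<in> N c" by (rule square_beside(2)[of y a p c x d]) (use y a xc abx ab in auto)
  have b: "N b = {x, z, d}" using N3[of x z d b] ip db p a dz by auto
  have c: "N c = {y, z, d}" using N3[of y z d c] ic dc p a dz by auto
  have dbc: "d \<noteq> b" "d \<noteq> c" using db dc irr by metis+
  have "a \<notin> N p" unfolding p using abx by simp
  then have "p \<notin> N a" using sym by blast
  then have dp: "d \<noteq> p" using a by auto
  show False
  proof (rule no_cube[OF p(1) _ y(1) z a(1) b c])
    show "N x = {p, a, b}" using x by auto
    show "distinct [p, x, y, z, a, b, c, d]" using p(2) a(2) y(2) pne ab abx cx bc dz dbc dp by auto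
  qed
qed

end

text \<open>A minimal counterexample has no edge, so any vertex of it is isolated, which is a
  violation; and the empty graph satisfies the bound.\<close>

lemma tame_imp_half:
  assumes "tame V E" shows "half (V :: 'a set) E"
  using assms
proof (induction "card V + card {(a, b). E a b}" arbitrary: V E rule: less_induct)
  case less
  show ?case
  proof (rule ccontr)
    assume nh: "\<not> half V E"
    interpret mincex V E by unfold_locales (use less nh in auto)
    have "half {} E" unfolding half_def LD_def by (rule exI[of _ "{}"]) simp
    then have "V \<noteq> {}" using nh by metis
    then obtain v where v: "v \<in> V" by blast
    have "N v = {}" using no_edge by blast
    with viol.isolated[OF v] no_viol show False by blast
  qed
qed

subsection \<open>Connected graphs\<close>

lemma connected_closed:
  assumes "connected_graph V E" "W \<subseteq> V" "W \<noteq> {}" "\<And>w. w \<in> W \<Longrightarrow> nbhd E w \<subseteq> W"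
  shows "V = W"
proof
  obtain w where w: "w \<in> W" using assms(3) by blast
  show "V \<subseteq> W"
  proof
    fix v assume "v \<in> V"
    then have "E\<^sup>*\<^sup>* w v" using assms(1,2) w unfolding connected_graph_def by blast
    then show "v \<in> W"
    proof induction
      case (step a b)
      then have "b \<in> nbhd E a" unfolding nbhd_def by simp
      with step assms(4) show ?case by blast
    qed (fact w)
  qed
qed (fact assms(2))

lemma card_edges_le:
  assumes "graph V E" shows "card (edges E) \<le> card V choose 2"
proof -
  have fin: "finite V" using assms unfolding graph_def by simp
  have "edges E \<subseteq> {X. X \<subseteq> V \<and> card X = 2}"
  proof
    fix X assume "X \<in> edges E"
    then obtain u v where X: "X = {u, v}" "E u v" unfolding edges_def by blast
    with assms have "u \<in> V" "v \<in> V" "u \<noteq> v" unfolding graph_def by auto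
    with X show "X \<in> {X. X \<subseteq> V \<and> card X = 2}" by simp
  qed
  then have "card (edges E) \<le> card {X. X \<subseteq> V \<and> card X = 2}" by (rule card_mono[rotated]) (use fin in simp)
  also have "\<dots> = card V choose 2" using fin by (rule n_subsets)
  finally show ?thesis .
qed

lemma K33_iso:
  assumes G: "graph V E" and V: "V = A \<union> X" and card: "card A = 3" "card X = 3"
    and A: "\<And>a. a \<in> A \<Longrightarrow> nbhd E a = X" and X: "\<And>x. x \<in> X \<Longrightarrow> nbhd E x = A"
  shows "graph_iso V E K33_V K33_E"
proof -
  have fin: "finite A" "finite X" using card by (simp_all add: card_ge_0_finite)
  have disj: "A \<inter> X = {}" using A nbhd_irrefl[OF G] by blast
  obtain g h where g: "bij_betw g A {0..<3::nat}" and h: "bij_betw h X {3..<6::nat}"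
    using finite_same_card_bij[OF fin(1), of "{0..<3::nat}"] finite_same_card_bij[OF fin(2), of "{3..<6::nat}"] card by auto
  define f where "f a = (if a \<in> A then g a else h a)" for a
  have "bij_betw f A {0..<3}" using g by (rule bij_betw_cong[THEN iffD1, rotated]) (simp add: f_def)
  moreover have "bij_betw f X {3..<6}" using h by (rule bij_betw_cong[THEN iffD1, rotated]) (use disj in \<open>auto simp: f_def\<close>)
  ultimately have bij: "bij_betw f V ({0..<3} \<union> {3..<6})" unfolding V by (rule bij_betw_combine) auto
  have fA: "f a < 3" if "a \<in> A" for a using bij_betwE[OF g] that unfolding f_def by auto
  have fX: "3 \<le> f a \<and> f a < 6" if "a \<in> X" for a using bij_betwE[OF h] that disj unfolding f_def by auto
  have "E a b \<longleftrightarrow> K33_E (f a) (f b)" if ab: "a \<in> V" "b \<in> V" for a b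
  proof -
    have E: "E a b \<longleftrightarrow> b \<in> nbhd E a" unfolding nbhd_def by simp
    show ?thesis
    proof (cases "a \<in> A")
      case True
      then show ?thesis using E A[of a] ab(2) fA[of a] fA[of b] fX[of b] disj unfolding V K33_E_def by auto
    next
      case False
      then have "a \<in> X" using ab V by simp
      then show ?thesis using E X[of a] ab(2) fX[of a] fA[of b] fX[of b] disj unfolding V K33_E_def by auto
    qed
  qed
  moreover have "{0..<3} \<union> {3..<6} = K33_V" unfolding K33_V_def by auto
  ultimately show ?thesis using bij unfolding graph_iso_def by auto
qed

text \<open>The components K1, K3 and K4 have at most six edges, one less than required. Every other
  violation contains twins; those of degree one and two are excluded by hypothesis, and three twins
  of degree three span K33, which is then the whole graph.\<close>

lemma connected_tame:
  assumes G: "graph V E" and conn: "connected_graph V E" and S: "subcubic V E" and e: "card (edges E) \<ge> 7"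
    and K33: "\<not> graph_iso V E K33_V K33_E"
    and 1: "\<And>u v. \<not> open_twins_deg V E 1 u v" and 2: "\<And>u v. \<not> open_twins_deg V E 2 u v"
  shows "tame V E"
proof -
  have outside: "v \<in> V" if "nbhd E v \<noteq> {}" for v using nbhd_outside[OF G, of v] that by blast
  have big: False if W: "W \<noteq> {}" "W \<subseteq> V" "card W \<le> 4" "\<And>w. w \<in> W \<Longrightarrow> nbhd E w \<subseteq> W" for W
  proof -
    have "V = W" using connected_closed[OF conn W(2,1,4)] .
    then have "card (edges E) \<le> card W choose 2" using card_edges_le[OF G] by simp
    also have "\<dots> = card W * (card W - 1) div 2" by (rule choose_two)
    also have "\<dots> \<le> 4 * 3 div 2" using W(3) by (intro div_le_mono mult_le_mono) simp_all
    finally show False using e by simp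
  qed
  have twins: "u = v" if "nbhd E u = X" "nbhd E v = X" "X \<noteq> {}" "card X \<noteq> 3" for u v X
  proof (rule ccontr)
    assume "u \<noteq> v"
    moreover have "u \<in> V" "v \<in> V" using outside[of u] outside[of v] that by simp_all
    moreover have "card X = 1 \<or> card X = 2"
    proof -
      have "card X \<noteq> 0" using that finite_nbhd[OF G, of u] by auto
      moreover have "card X \<le> 3" using subcubic_card[OF G S, of u] that by simp
      ultimately show ?thesis using that(4) by linarith
    qed
    ultimately show False using 1[of u v] 2[of u v] that unfolding open_twins_deg_def by auto
  qed
  have small: "card {a} \<noteq> 3" "card {a, b} \<noteq> 3" for a b :: 'a by (auto simp: card_insert_if)
  have "\<not> viol V E Y" for Y
  proof
    assume "viol V E Y"
    then show False
    proof cases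
      case (isolated v)
      show False by (rule big[of "{v}"]) (use isolated in auto)
    next
      case (leaf_twins u v x)
      with twins[of u "{x}" v] small show False by simp
    next
      case (leaf_gadget u v l y z)
      with twins[of u "{y, z}" v] small show False by simp
    next
      case (triangle a b c)
      have "a \<in> V" "b \<in> V" "c \<in> V" using outside[of a] outside[of b] outside[of c] triangle by simp_all
      moreover have "nbhd E w \<subseteq> {a, b, c}" if "w \<in> {a, b, c}" for w using that triangle by auto
      moreover have "card {a, b, c} \<le> 4" by (simp add: card_insert_if)
      ultimately show False by (intro big[of "{a, b, c}"]) simp_all
    next
      case (tetrahedron a b c d)
      have "a \<in> V" "b \<in> V" "c \<in> V" "d \<in> V" using outside[of a] outside[of b] outside[of c] outside[of d] tetrahedron by simp_all
      moreover have "nbhd E w \<subseteq> {a, b, c, d}" if "w \<in> {a, b, c, d}" for w using that tetrahedron by auto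
      moreover have "card {a, b, c, d} \<le> 4" by (simp add: card_insert_if)
      ultimately show False by (intro big[of "{a, b, c, d}"]) simp_all
    next
      case (triplets u v w X)
      let ?A = "{u, v, w}"
      have X3: "card X = 3" using twins[of u X v] triplets by auto
      have A3: "card ?A = 3" using triplets by simp
      have A: "nbhd E a = X" if "a \<in> ?A" for a using that triplets by auto
      have X: "nbhd E x = ?A" if "x \<in> X" for x
      proof -
        have "?A \<subseteq> nbhd E x" using A that nbhd_sym[OF G] by blast
        moreover have "card (nbhd E x) \<le> card ?A" using subcubic_card[OF G S, of x] A3 by simp
        ultimately show ?thesis using finite_nbhd[OF G, of x] card_seteq by metis
      qed
      have "V = ?A \<union> X"
      proof (rule connected_closed[OF conn])
        show "?A \<union> X \<subseteq> V" using A X triplets outside by (metis Un_iff insert_not_empty subsetI)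
        show "nbhd E a \<subseteq> ?A \<union> X" if "a \<in> ?A \<union> X" for a using that A X by blast
      qed simp
      with K33_iso[OF G this A3 X3 A X] K33 show False by blast
    qed
  qed
  with G S show ?thesis unfolding tame_def by blast
qed

theorem theorem8:
  fixes V :: "'a set" and E :: "'a \<Rightarrow> 'a \<Rightarrow> bool"
  assumes "graph V E"
    and "connected_graph V E"
    and "subcubic V E"
    and "card (edges E) \<ge> 7"
    and "\<not> graph_iso V E K33_V K33_E"
    and "\<forall>u v. \<not> open_twins_deg V E 1 u v"
    and "\<forall>u v. \<not> open_twins_deg V E 2 u v"
  shows "2 * ld_number V E \<le> card V"
proof -
  have "tame V E" by (rule connected_tame) (use assms in auto)
  then obtain S where S: "LD V E S" "2 * card S \<le> card V" using tame_imp_half unfolding half_def by blast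
  have "ld_number V E \<le> card S"
    unfolding ld_number_def by (rule Least_le) (use LD_locating_dominating[OF S(1)] in blast)
  with S(2) show ?thesis by linarith
qed

end
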